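(* Let $\mathsf T$ be a thermodynamically consistent open continuum thermodynamic system and $u_\star$ a dissipation-neutral reference equilibrium satisfying the linearizable constitutive class assumption; in particular there is a linear flux $q_{\mathrm{lin}}^{\mathrm{rev}}$ with $\eta[w]\cdot\operatorname{div}A_\star[w]=\operatorname{div}q_{\mathrm{lin}}^{\mathrm{rev}}[w]$ in $\mathscr D'(\Omega)$ for every smooth perturbation $w$. Assume the boundary matching condition $$-\int_{\partial\Omega}\bigl(q_{\mathrm{lin}}^{\mathrm{rev}}[w]+q_{\mathrm{lin}}^{\mathrm{diss}}[w]\bigr)\cdot n\,dS=\mathcal B_{\mathrm{lin}}[w],\qquad q_{\mathrm{lin}}^{\mathrm{diss}}[w]:=\eta[w]\cdot J_{\mathrm{lin}}^{\mathrm{diss}}[w].$$ Then every smooth solution $w$ of $$\partial_tw+\operatorname{div}\bigl(A_\star[w]+J_{\mathrm{lin}}^{\mathrm{diss}}[w]\bigr)=G_\star[w]$$ satisfies $$\frac{d}{dt}\mathcal F_{\mathrm{lin}}[w(t)]=-\mathcal D_{\mathrm{lin}}[w(t)]+\mathcal B_{\mathrm{lin}}[w(t)]+\mathcal S_{\mathrm{lin}}[w(t)].$$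
   Context: Let $\Omega\subset\mathbb R^d$ be a bounded Lipschitz domain with outward unit normal $n$, let $U\subset\mathbb R^m$ be nonempty, open and convex, and let $\psi:\overline\Omega\times U\to\mathbb R$ be a $C^2$ storage density such that $u\mapsto\psi(x,u)$ is convex on $U$ for each $x\in\overline\Omega$. The admissible field space is $\mathcal X:=\{u\in H^1(\Omega;\mathbb R^m): u(x)\in U\text{ a.e.},\ \psi(\cdot,u(\cdot))\in L^1(\Omega)\}$; $\mathcal F[u]:=\int_\Omega\psi(x,u(x))\,dx$; $\mu[u](x):=D_u\psi(x,u(x))$. An open constitutive structure consists of fluxes $J^{\mathrm{rev}},J^{\mathrm{diss}}:\mathcal X\to L^1(\Omega;\mathbb R^{m\times d})$, a source $R:\mathcal X\to L^1(\Omega;\mathbb R^m)$, port spaces $Y_e,Y_f$, trace maps $e:\mathcal X\to Y_e$, $f:\mathcal X\to Y_f$, and a continuous duality pairing $\langle\cdot,\cdot\rangle_Y:Y_e\times Y_f\to\mathbb R$; $\mathcal B[u]:=\langle e[u],f[u]\rangle_Y$. Divergences of matrix fields are row-wise. It is thermodynamically admissible if there exist $q^{\mathrm{rev}},q^{\mathrm{diss}}:\mathcal X\to L^1(\Omega;\mathbb R^d)$ and $\sigma:\mathcal X\to L^1(\Omega)$ such that for every sufficiently smooth $u\in\mathcal X$: $\mu[u]\cdot\operatorname{div}J^{\mathrm{rev}}[u]=\operatorname{div}q^{\mathrm{rev}}[u]$ and $\mu[u]\cdot\operatorname{div}J^{\mathrm{diss}}[u]=\operatorname{div}q^{\mathrm{diss}}[u]+\sigma[u]$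 in $\mathscr D'(\Omega)$; $\sigma[u]\ge0$ a.e.; $-\int_{\partial\Omega}(q^{\mathrm{rev}}[u]+q^{\mathrm{diss}}[u])\cdot n\,dS=\mathcal B[u]$; and $\mathcal S[u]:=\int_\Omega\mu[u]\cdot R[u]\,dx$ is finite. Put $\mathcal D[u]:=\int_\Omega\sigma[u]\,dx$. An open continuum thermodynamic system is such a tuple $\mathsf T=(\Omega,U,\mathcal X,\psi,\mu,J^{\mathrm{rev}},J^{\mathrm{diss}},R,Y_e,Y_f,e,f)$ with thermodynamically admissible structure. A smooth admissible trajectory is a map $u:[0,T]\to\mathcal X$, sufficiently regular in space and time for all terms to be meaningful, satisfying $\partial_tu+\operatorname{div}(J^{\mathrm{rev}}[u]+J^{\mathrm{diss}}[u])=R[u]$ a.e. in $\Omega\times(0,T)$. $\mathsf T$ is thermodynamically consistent if every smooth admissible trajectory satisfies $\frac{d}{dt}\mathcal F[u]=-\mathcal D[u]+\mathcal B[u]+\mathcal S[u]$. A state $u_\star\in\mathcal X$ is a dissipation-neutral reference equilibrium if $\operatorname{div}(J^{\mathrm{rev}}[u_\star]+J^{\mathrm{diss}}[u_\star])=R[u_\star]$, $J^{\mathrm{diss}}[u_\star]=0$, $\sigma[u_\star]=0$, $e[u_\star]=0$, $f[u_\star]=0$, $R[u_\star]=0$. Linearizable constitutive class assumption: (a) $\psi$ is $C^3$ in $u$ near $u_\star$; (b) $J^{\mathrm{rev}},R,e,f$ are Fréchet differentiable at $u_\star$; (c) $\nabla\mu[u_\star]=0$ in $\Omega$; (d) $J^{\mathrm{diss}}[u]=-M(u)\nabla\mu[u]$,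 where $M(u)$ is pointwise symmetric positive semidefinite (acting linearly on $\mathbb R^{m\times d}$); (e) there is a linear flux $q_{\mathrm{lin}}^{\mathrm{rev}}$ such that $\eta[w]\cdot\operatorname{div}A_\star[w]=\operatorname{div}q_{\mathrm{lin}}^{\mathrm{rev}}[w]$ in $\mathscr D'(\Omega)$ for every smooth perturbation $w$. Linearized quantities: $H_\star(x):=D^2_{uu}\psi(x,u_\star(x))$; $\eta[w]:=H_\star w$; $A_\star[w]:=DJ^{\mathrm{rev}}[u_\star]w$; $G_\star[w]:=DR[u_\star]w$; $E_\star[w]:=De[u_\star]w$; $F_\star[w]:=Df[u_\star]w$; $M_\star:=M(u_\star)$; $J_{\mathrm{lin}}^{\mathrm{diss}}[w]:=-M_\star\nabla\eta[w]$. Functionals: $\mathcal F_{\mathrm{lin}}[w]:=\frac12\int_\Omega w^\top H_\star w\,dx$; $\mathcal D_{\mathrm{lin}}[w]:=\int_\Omega\nabla\eta[w]:M_\star\nabla\eta[w]\,dx$; $\mathcal S_{\mathrm{lin}}[w]:=\int_\Omega\eta[w]\cdot G_\star[w]\,dx$; $\mathcal B_{\mathrm{lin}}[w]:=\langle E_\star[w],F_\star[w]\rangle_Y$. Here $:$ is the Frobenius product and $(\eta\cdot J)_k=\sum_a\eta_aJ_{ak}$. *)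

theory Defs
  imports "HOL-Analysis.Analysis"
begin

text \<open>
  Conventions. Elements of \<open>L\<^sup>1\<close> and \<open>H\<^sup>1\<close> are represented by functions on the whole space, of
  which only the values in \<open>\<Omega>\<close> matter, modulo Lebesgue-null sets; a field that is required to be
  smooth is given by its smooth representative. A matrix field has type \<open>real^'d^'m\<close> (\<open>m\<close> rows, \<open>d\<close> columns); on
  this type \<open>\<bullet>\<close> is the Frobenius product, \<open>J *v a\<close> acts row by row, and \<open>\<eta> v* J\<close> is the vector
  with components \<open>\<Sum>a. \<eta>\<^sub>a J\<^sub>a\<^sub>k\<close>.
\<close>


section \<open>Smoothness\<close>

text \<open>
  \<open>Ck_upto n S T f\<close> for \<open>S\<close> open and \<open>S \<subseteq> T \<subseteq> closure S\<close>: \<open>f\<close> is \<open>C\<^sup>n\<close> on \<open>S\<close> and all derivatives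
  of order at most \<open>n\<close> extend continuously to \<open>T\<close>. For \<open>T = S\<close> this is \<open>C\<^sup>n(S)\<close>; for
  \<open>T = closure S\<close> it is \<open>C\<^sup>n\<close> up to the boundary.
\<close>

primrec Ck_upto :: "nat \<Rightarrow> 'a::real_normed_vector set \<Rightarrow> 'a set \<Rightarrow> ('a \<Rightarrow> 'b::real_normed_vector) \<Rightarrow> bool"
where
  "Ck_upto 0 S T f \<longleftrightarrow> (\<exists>g. continuous_on T g \<and> (\<forall>x\<in>S. g x = f x))"
| "Ck_upto (Suc n) S T f \<longleftrightarrow>
     (\<exists>g. continuous_on T g \<and> (\<forall>x\<in>S. g x = f x)) \<and>
     (\<forall>x\<in>S. f differentiable at x) \<and>
     (\<forall>v. Ck_upto n S T (\<lambda>x. frechet_derivative f (at x) v))"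

definition smooth_upto :: "enat \<Rightarrow> 'a::real_normed_vector set \<Rightarrow> 'a set \<Rightarrow> ('a \<Rightarrow> 'b::real_normed_vector) \<Rightarrow> bool"
  where "smooth_upto k S T f \<longleftrightarrow> (\<forall>n. enat n \<le> k \<longrightarrow> Ck_upto n S T f)"

definition grad :: "(real^'n \<Rightarrow> real) \<Rightarrow> real^'n \<Rightarrow> real^'n"
  where "grad f x = (\<chi> i. frechet_derivative f (at x) (axis i 1))"


section \<open>Bounded Lipschitz domains, outward normal and surface measure\<close>

text \<open>
  The graph coordinates are written without a rotation: \<open>\<nu>\<close> is the unit vector of the vertical
  axis, a function on the hyperplane orthogonal to \<open>\<nu>\<close> is a function on the whole space that is
  invariant under translation along \<open>\<nu>\<close>, and the domain lies locally below the graph of \<open>g\<close>.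
\<close>

definition lipschitz_chart :: "(real^'d) set \<Rightarrow> (real^'d) set \<Rightarrow> real^'d \<Rightarrow> (real^'d \<Rightarrow> real) \<Rightarrow> bool"
where
  "lipschitz_chart \<Omega> N \<nu> g \<longleftrightarrow>
     open N \<and> norm \<nu> = 1 \<and> (\<exists>L. L-lipschitz_on UNIV g) \<and>
     (\<forall>x t. g (x + t *\<^sub>R \<nu>) = g x) \<and>
     \<Omega> \<inter> N = {x \<in> N. x \<bullet> \<nu> < g x}"

definition bounded_lipschitz_domain :: "(real^'d) set \<Rightarrow> bool"
where
  "bounded_lipschitz_domain \<Omega> \<longleftrightarrow>
     open \<Omega> \<and> connected \<Omega> \<and> bounded \<Omega> \<and> \<Omega> \<noteq> {} \<and>
     (\<forall>p\<in>frontier \<Omega>. \<exists>N \<nu> g. p \<in> N \<and> lipschitz_chart \<Omega> N \<nu> g)"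

definition graph_point :: "real^'d \<Rightarrow> (real^'d \<Rightarrow> real) \<Rightarrow> real^'d \<Rightarrow> real^'d"
  where "graph_point \<nu> g x = x + (g x - x \<bullet> \<nu>) *\<^sub>R \<nu>"

text \<open>
  The almost everywhere defined gradient of a Lipschitz function; it exists by Rademacher's theorem
  and is unique up to null sets, so the existential quantifiers over it below are harmless. For \<open>g\<close> as in a chart it is orthogonal to \<open>\<nu>\<close>.
\<close>

definition ae_gradient :: "(real^'d \<Rightarrow> real) \<Rightarrow> (real^'d \<Rightarrow> real^'d) \<Rightarrow> bool"
where
  "ae_gradient g Dg \<longleftrightarrow>
     Dg \<in> borel_measurable borel \<and>
     (AE x in lborel. (g has_derivative (\<lambda>h. Dg x \<bullet> h)) (at x))"

definition outward_unit_normal :: "(real^'d) set \<Rightarrow> (real^'d \<Rightarrow> real^'d) \<Rightarrow> bool"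
where
  "outward_unit_normal \<Omega> n \<longleftrightarrow>
     n \<in> borel_measurable (restrict_space borel (frontier \<Omega>)) \<and>
     (\<forall>N \<nu> g. lipschitz_chart \<Omega> N \<nu> g \<longrightarrow>
        (\<exists>Dg. ae_gradient g Dg \<and>
           (AE x in lborel. graph_point \<nu> g x \<in> N \<longrightarrow>
              n (graph_point \<nu> g x) = (1 / sqrt (1 + (norm (Dg x))\<^sup>2)) *\<^sub>R (\<nu> - Dg x))))"

text \<open>
  In every chart \<open>dS = sqrt (1 + |\<nabla>g|\<^sup>2) dx'\<close>, where \<open>dx'\<close> is the \<open>(d-1)\<close>-dimensional Lebesgue
  measure of the hyperplane orthogonal to \<open>\<nu>\<close>. The integrand is invariant along \<open>\<nu>\<close>, so its
  integral over that hyperplane equals its \<open>d\<close>-dimensional integral over a slab of thickness 1.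
\<close>

definition surface_measure :: "(real^'d) set \<Rightarrow> (real^'d) measure \<Rightarrow> bool"
where
  "surface_measure \<Omega> S \<longleftrightarrow>
     sets S = sets (restrict_space borel (frontier \<Omega>)) \<and>
     (\<forall>N \<nu> g. lipschitz_chart \<Omega> N \<nu> g \<longrightarrow>
        (\<exists>Dg. ae_gradient g Dg \<and>
           (\<forall>B\<in>sets borel. B \<subseteq> N \<inter> frontier \<Omega> \<longrightarrow>
              emeasure S B =
                (\<integral>\<^sup>+x. ennreal (indicator {x. 0 < x \<bullet> \<nu> \<and> x \<bullet> \<nu> < 1} x *
                               indicator B (graph_point \<nu> g x) *
                               sqrt (1 + (norm (Dg x))\<^sup>2)) \<partial>lborel))))"

text \<open>
  \<open>has_boundary_flux \<Omega> n S q c\<close>: the field \<open>q\<close> has a representative that is continuous up to the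
  boundary, and \<open>c\<close> is the integral of its normal component over the boundary.
\<close>

definition has_boundary_flux ::
  "(real^'d) set \<Rightarrow> (real^'d \<Rightarrow> real^'d) \<Rightarrow> (real^'d) measure \<Rightarrow> (real^'d \<Rightarrow> real^'d) \<Rightarrow> real \<Rightarrow> bool"
where
  "has_boundary_flux \<Omega> n S q c \<longleftrightarrow>
     (\<exists>q'. (AE x in lebesgue_on \<Omega>. q' x = q x) \<and> continuous_on (closure \<Omega>) q' \<and>
           c = (LINT x|S. q' x \<bullet> n x))"


section \<open>Distributions and Sobolev functions\<close>

definition test_function :: "(real^'d) set \<Rightarrow> (real^'d \<Rightarrow> real) \<Rightarrow> bool"
where
  "test_function \<Omega> \<phi> \<longleftrightarrow>
     smooth_upto \<infinity> UNIV UNIV \<phi> \<and>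
     compact (closure {x. \<phi> x \<noteq> 0}) \<and> closure {x. \<phi> x \<noteq> 0} \<subseteq> \<Omega>"

definition locally_integrable :: "(real^'d) set \<Rightarrow> (real^'d \<Rightarrow> 'b::euclidean_space) \<Rightarrow> bool"
  where "locally_integrable \<Omega> f \<longleftrightarrow> (\<forall>K. compact K \<and> K \<subseteq> \<Omega> \<longrightarrow> integrable (lebesgue_on K) f)"

definition has_weak_gradient ::
  "(real^'d) set \<Rightarrow> (real^'d \<Rightarrow> real^'m) \<Rightarrow> (real^'d \<Rightarrow> real^'d^'m) \<Rightarrow> bool"
where
  "has_weak_gradient \<Omega> u P \<longleftrightarrow>
     locally_integrable \<Omega> u \<and> locally_integrable \<Omega> P \<and>
     (\<forall>\<phi>. test_function \<Omega> \<phi> \<longrightarrow>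
        (\<forall>a k. (LINT x|lebesgue_on \<Omega>. u x $ a * grad \<phi> x $ k) =
              - (LINT x|lebesgue_on \<Omega>. P x $ a $ k * \<phi> x)))"

definition wgrad :: "(real^'d) set \<Rightarrow> (real^'d \<Rightarrow> real^'m) \<Rightarrow> real^'d \<Rightarrow> real^'d^'m"
  where "wgrad \<Omega> u = (SOME P. has_weak_gradient \<Omega> u P)"

definition H1 :: "(real^'d) set \<Rightarrow> (real^'d \<Rightarrow> real^'m) set"
where
  "H1 \<Omega> = {u. u \<in> borel_measurable (lebesgue_on \<Omega>) \<and>
              integrable (lebesgue_on \<Omega>) (\<lambda>x. (norm (u x))\<^sup>2) \<and>
              (\<exists>P. has_weak_gradient \<Omega> u P) \<and>
              wgrad \<Omega> u \<in> borel_measurable (lebesgue_on \<Omega>) \<and>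
              integrable (lebesgue_on \<Omega>) (\<lambda>x. (norm (wgrad \<Omega> u x))\<^sup>2)}"

definition H1norm :: "(real^'d) set \<Rightarrow> (real^'d \<Rightarrow> real^'m) \<Rightarrow> real"
where
  "H1norm \<Omega> u =
     sqrt ((LINT x|lebesgue_on \<Omega>. (norm (u x))\<^sup>2) + (LINT x|lebesgue_on \<Omega>. (norm (wgrad \<Omega> u x))\<^sup>2))"

definition L1norm :: "(real^'d) set \<Rightarrow> (real^'d \<Rightarrow> 'b::euclidean_space) \<Rightarrow> real"
  where "L1norm \<Omega> f = (LINT x|lebesgue_on \<Omega>. norm (f x))"

text \<open>\<open>div J = r\<close> in the sense of distributions, with \<open>r \<in> L\<^sup>1\<close> (row-wise divergence).\<close>

definition has_distr_div ::
  "(real^'d) set \<Rightarrow> (real^'d \<Rightarrow> real^'d^'m) \<Rightarrow> (real^'d \<Rightarrow> real^'m) \<Rightarrow> bool"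
where
  "has_distr_div \<Omega> J r \<longleftrightarrow>
     integrable (lebesgue_on \<Omega>) J \<and> integrable (lebesgue_on \<Omega>) r \<and>
     (\<forall>\<phi>. test_function \<Omega> \<phi> \<longrightarrow>
        - (LINT x|lebesgue_on \<Omega>. J x *v grad \<phi> x) = (LINT x|lebesgue_on \<Omega>. \<phi> x *\<^sub>R r x))"

text \<open>The distribution \<open>div q\<close> for a vector field \<open>q \<in> L\<^sup>1\<close>.\<close>

definition distr_div :: "(real^'d) set \<Rightarrow> (real^'d \<Rightarrow> real^'d) \<Rightarrow> (real^'d \<Rightarrow> real) \<Rightarrow> real"
  where "distr_div \<Omega> q \<phi> = - (LINT x|lebesgue_on \<Omega>. q x \<bullet> grad \<phi> x)"

text \<open>
  The distribution \<open>\<eta> \<cdot> div J\<close> for \<open>\<eta> \<in> C\<^sup>1(\<Omega>)\<close> and \<open>J \<in> L\<^sup>1\<close>: the product of \<open>div J\<close>, a distribution of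
  order 1, with the multiplier \<open>\<eta>\<close>, i.e. \<open>\<langle>\<eta> \<cdot> div J, \<phi>\<rangle> = \<langle>div J, \<phi>\<eta>\<rangle> = - \<integral> J : \<nabla>(\<phi>\<eta>)\<close>.
\<close>

definition distr_mult_div ::
  "(real^'d) set \<Rightarrow> (real^'d \<Rightarrow> real^'m) \<Rightarrow> (real^'d \<Rightarrow> real^'d^'m) \<Rightarrow> (real^'d \<Rightarrow> real) \<Rightarrow> real"
where
  "distr_mult_div \<Omega> \<eta> J \<phi> = - (LINT x|lebesgue_on \<Omega>. J x \<bullet> wgrad \<Omega> (\<lambda>y. \<phi> y *\<^sub>R \<eta> y) x)"


section \<open>Open continuum thermodynamic systems\<close>

text \<open>
  The field space and the chemical potential are determined by the other entries and are defined
  afterwards. The fields \<open>nrml\<close> and \<open>surf\<close> hold the outward normal and the surface measure of the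
  domain; they are fixed by \<open>outward_unit_normal\<close> and \<open>surface_measure\<close> below.
\<close>

record ('d, 'm, 'e, 'f) octs =
  dom :: "(real^'d) set"
  nrml :: "real^'d \<Rightarrow> real^'d"
  surf :: "(real^'d) measure"
  states :: "(real^'m) set"
  psi :: "real^'d \<Rightarrow> real^'m \<Rightarrow> real"
  Jrev :: "(real^'d \<Rightarrow> real^'m) \<Rightarrow> real^'d \<Rightarrow> real^'d^'m"
  Jdiss :: "(real^'d \<Rightarrow> real^'m) \<Rightarrow> real^'d \<Rightarrow> real^'d^'m"
  Rsrc :: "(real^'d \<Rightarrow> real^'m) \<Rightarrow> real^'d \<Rightarrow> real^'m"
  eport :: "(real^'d \<Rightarrow> real^'m) \<Rightarrow> 'e"
  fport :: "(real^'d \<Rightarrow> real^'m) \<Rightarrow> 'f"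
  pairing :: "'e \<Rightarrow> 'f \<Rightarrow> real"

definition field_space :: "('d::finite,'m::finite,'e,'f) octs \<Rightarrow> (real^'d \<Rightarrow> real^'m) set"
where
  "field_space T =
     {u \<in> H1 (dom T). (AE x in lebesgue_on (dom T). u x \<in> states T) \<and>
                      integrable (lebesgue_on (dom T)) (\<lambda>x. psi T x (u x))}"

definition mu :: "('d::finite,'m::finite,'e,'f) octs \<Rightarrow> (real^'d \<Rightarrow> real^'m) \<Rightarrow> real^'d \<Rightarrow> real^'m"
  where "mu T u x = grad (psi T x) (u x)"

definition free_energy :: "('d::finite,'m::finite,'e,'f) octs \<Rightarrow> (real^'d \<Rightarrow> real^'m) \<Rightarrow> real"
  where "free_energy T u = (LINT x|lebesgue_on (dom T). psi T x (u x))"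

definition boundary_supply :: "('d::finite,'m::finite,'e,'f) octs \<Rightarrow> (real^'d \<Rightarrow> real^'m) \<Rightarrow> real"
  where "boundary_supply T u = pairing T (eport T u) (fport T u)"

definition source_supply :: "('d::finite,'m::finite,'e,'f) octs \<Rightarrow> (real^'d \<Rightarrow> real^'m) \<Rightarrow> real"
  where "source_supply T u = (LINT x|lebesgue_on (dom T). mu T u x \<bullet> Rsrc T u x)"

definition dissipation ::
  "('d::finite,'m::finite,'e,'f) octs \<Rightarrow> ((real^'d \<Rightarrow> real^'m) \<Rightarrow> real^'d \<Rightarrow> real) \<Rightarrow> (real^'d \<Rightarrow> real^'m) \<Rightarrow> real"
  where "dissipation T \<sigma> u = (LINT x|lebesgue_on (dom T). \<sigma> u x)"

definition ae_invariant ::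
  "('d::finite,'m::finite,'e,'f) octs \<Rightarrow> ((real^'d \<Rightarrow> real^'m) \<Rightarrow> real^'d \<Rightarrow> 'b) \<Rightarrow> bool"
where
  "ae_invariant T F \<longleftrightarrow>
     (\<forall>u\<in>field_space T. \<forall>v\<in>field_space T. (AE x in lebesgue_on (dom T). u x = v x) \<longrightarrow>
        (AE x in lebesgue_on (dom T). F u x = F v x))"

definition L1_map ::
  "('d::finite,'m::finite,'e,'f) octs \<Rightarrow> ((real^'d \<Rightarrow> real^'m) \<Rightarrow> real^'d \<Rightarrow> 'b::euclidean_space) \<Rightarrow> bool"
where
  "L1_map T F \<longleftrightarrow> ae_invariant T F \<and> (\<forall>u\<in>field_space T. integrable (lebesgue_on (dom T)) (F u))"

definition port_map :: "('d::finite,'m::finite,'e,'f) octs \<Rightarrow> ((real^'d \<Rightarrow> real^'m) \<Rightarrow> 'b) \<Rightarrow> bool"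
where
  "port_map T F \<longleftrightarrow>
     (\<forall>u\<in>field_space T. \<forall>v\<in>field_space T. (AE x in lebesgue_on (dom T). u x = v x) \<longrightarrow> F u = F v)"

definition open_constitutive_structure ::
  "('d::finite,'m::finite,'e::real_normed_vector,'f::real_normed_vector) octs \<Rightarrow> bool"
where
  "open_constitutive_structure T \<longleftrightarrow>
     bounded_lipschitz_domain (dom T) \<and>
     outward_unit_normal (dom T) (nrml T) \<and>
     surface_measure (dom T) (surf T) \<and>
     states T \<noteq> {} \<and> open (states T) \<and> convex (states T) \<and>
     continuous_on (closure (dom T) \<times> states T) (\<lambda>(x, v). psi T x v) \<and>
     Ck_upto 2 (dom T \<times> states T) (closure (dom T) \<times> states T) (\<lambda>(x, v). psi T x v) \<and>
     (\<forall>x\<in>closure (dom T). convex_on (states T) (psi T x)) \<and>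
     L1_map T (Jrev T) \<and> L1_map T (Jdiss T) \<and> L1_map T (Rsrc T) \<and>
     port_map T (eport T) \<and> port_map T (fport T) \<and>
     bounded_bilinear (pairing T)"

text \<open>
  Sufficiently smooth states: \<open>C\<^sup>k\<close> up to the boundary, with values in a compact part of the open set
  \<open>U\<close>, so that \<open>\<mu>[u]\<close> is \<open>C\<^sup>1\<close> up to the boundary as soon as \<open>k \<ge> 1\<close>. The order \<open>k\<close>, possibly
  \<open>\<infinity>\<close>, is a parameter of all notions that refer to smooth fields.
\<close>

definition smooth_state ::
  "enat \<Rightarrow> ('d::finite,'m::finite,'e,'f) octs \<Rightarrow> (real^'d \<Rightarrow> real^'m) \<Rightarrow> bool"
where
  "smooth_state k T u \<longleftrightarrow>
     u \<in> field_space T \<and> smooth_upto k (dom T) (closure (dom T)) u \<and>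
     (\<exists>K. compact K \<and> K \<subseteq> states T \<and> u ` dom T \<subseteq> K)"

text \<open>
  The witnesses \<open>qrev\<close>, \<open>qdiss\<close>, \<open>\<sigma>\<close> of admissibility are explicit arguments, because the
  dissipation functional depends on the choice of \<open>\<sigma>\<close>.
\<close>

definition thermodynamically_admissible ::
  "enat \<Rightarrow> ('d::finite,'m::finite,'e::real_normed_vector,'f::real_normed_vector) octs \<Rightarrow>
   ((real^'d \<Rightarrow> real^'m) \<Rightarrow> real^'d \<Rightarrow> real^'d) \<Rightarrow> ((real^'d \<Rightarrow> real^'m) \<Rightarrow> real^'d \<Rightarrow> real^'d) \<Rightarrow>
   ((real^'d \<Rightarrow> real^'m) \<Rightarrow> real^'d \<Rightarrow> real) \<Rightarrow> bool"
where
  "thermodynamically_admissible k T qrev qdiss \<sigma> \<longleftrightarrow>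
     L1_map T qrev \<and> L1_map T qdiss \<and> L1_map T \<sigma> \<and>
     (\<forall>u. smooth_state k T u \<longrightarrow>
        (\<forall>\<phi>. test_function (dom T) \<phi> \<longrightarrow>
           distr_mult_div (dom T) (mu T u) (Jrev T u) \<phi> = distr_div (dom T) (qrev u) \<phi> \<and>
           distr_mult_div (dom T) (mu T u) (Jdiss T u) \<phi> =
             distr_div (dom T) (qdiss u) \<phi> + (LINT x|lebesgue_on (dom T). \<sigma> u x * \<phi> x)) \<and>
        (AE x in lebesgue_on (dom T). 0 \<le> \<sigma> u x) \<and>
        has_boundary_flux (dom T) (nrml T) (surf T) (\<lambda>x. qrev u x + qdiss u x) (- boundary_supply T u) \<and>
        integrable (lebesgue_on (dom T)) (\<lambda>x. mu T u x \<bullet> Rsrc T u x))"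

definition open_continuum_thermodynamic_system ::
  "enat \<Rightarrow> ('d::finite,'m::finite,'e::real_normed_vector,'f::real_normed_vector) octs \<Rightarrow>
   ((real^'d \<Rightarrow> real^'m) \<Rightarrow> real^'d \<Rightarrow> real^'d) \<Rightarrow> ((real^'d \<Rightarrow> real^'m) \<Rightarrow> real^'d \<Rightarrow> real^'d) \<Rightarrow>
   ((real^'d \<Rightarrow> real^'m) \<Rightarrow> real^'d \<Rightarrow> real) \<Rightarrow> bool"
where
  "open_continuum_thermodynamic_system k T qrev qdiss \<sigma> \<longleftrightarrow>
     open_constitutive_structure T \<and> thermodynamically_admissible k T qrev qdiss \<sigma>"

definition time_deriv :: "(real \<Rightarrow> real^'d \<Rightarrow> real^'m) \<Rightarrow> real \<Rightarrow> real^'d \<Rightarrow> real^'m"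
  where "time_deriv u t x = vector_derivative (\<lambda>s. u s x) (at t)"

definition smooth_admissible_trajectory ::
  "enat \<Rightarrow> ('d::finite,'m::finite,'e,'f) octs \<Rightarrow> real \<Rightarrow> (real \<Rightarrow> real^'d \<Rightarrow> real^'m) \<Rightarrow> bool"
where
  "smooth_admissible_trajectory k T \<tau> u \<longleftrightarrow>
     (\<forall>t\<in>{0..\<tau>}. u t \<in> field_space T) \<and>
     continuous_on ({0..\<tau>} \<times> dom T) (\<lambda>(t, x). u t x) \<and>
     smooth_upto k ({0<..<\<tau>} \<times> dom T) ({0..\<tau>} \<times> closure (dom T)) (\<lambda>(t, x). u t x) \<and>
     (\<exists>K. compact K \<and> K \<subseteq> states T \<and> (\<forall>t\<in>{0..\<tau>}. u t ` dom T \<subseteq> K)) \<and>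
     (\<exists>Z. (\<forall>t\<in>{0<..<\<tau>}. has_distr_div (dom T) (\<lambda>x. Jrev T (u t) x + Jdiss T (u t) x) (Z t)) \<and>
          (AE (t, x) in lebesgue_on ({0<..<\<tau>} \<times> dom T).
             time_deriv u t x + Z t x = Rsrc T (u t) x))"

text \<open>
  The evolution equation is required almost everywhere in space-time only, hence the balance is
  asserted for almost every time.
\<close>

definition thermodynamically_consistent ::
  "enat \<Rightarrow> ('d::finite,'m::finite,'e,'f) octs \<Rightarrow> ((real^'d \<Rightarrow> real^'m) \<Rightarrow> real^'d \<Rightarrow> real) \<Rightarrow> bool"
where
  "thermodynamically_consistent k T \<sigma> \<longleftrightarrow>
     (\<forall>\<tau> u. 0 < \<tau> \<and> smooth_admissible_trajectory k T \<tau> u \<longrightarrow>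
        (AE t in lebesgue_on {0<..<\<tau>}.
           ((\<lambda>s. free_energy T (u s)) has_real_derivative
              (- dissipation T \<sigma> (u t) + boundary_supply T (u t) + source_supply T (u t))) (at t)))"

definition dissipation_neutral_equilibrium ::
  "('d::finite,'m::finite,'e::real_normed_vector,'f::real_normed_vector) octs \<Rightarrow>
   ((real^'d \<Rightarrow> real^'m) \<Rightarrow> real^'d \<Rightarrow> real) \<Rightarrow> (real^'d \<Rightarrow> real^'m) \<Rightarrow> bool"
where
  "dissipation_neutral_equilibrium T \<sigma> us \<longleftrightarrow>
     us \<in> field_space T \<and>
     has_distr_div (dom T) (\<lambda>x. Jrev T us x + Jdiss T us x) (Rsrc T us) \<and>
     (AE x in lebesgue_on (dom T). Jdiss T us x = 0) \<and>
     (AE x in lebesgue_on (dom T). \<sigma> us x = 0) \<and>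
     eport T us = 0 \<and> fport T us = 0 \<and>
     (AE x in lebesgue_on (dom T). Rsrc T us x = 0)"


section \<open>Linearization\<close>

text \<open>
  Frechet differentiability at \<open>us\<close> of a map on the field space, which is a subset of \<open>H\<^sup>1\<close>, with
  values in \<open>L\<^sup>1\<close> or in a port space. The derivative is a bounded linear operator on \<open>H\<^sup>1\<close>.
\<close>

definition frechet_L1 ::
  "('d::finite,'m::finite,'e,'f) octs \<Rightarrow> ((real^'d \<Rightarrow> real^'m) \<Rightarrow> real^'d \<Rightarrow> 'b::euclidean_space) \<Rightarrow>
   (real^'d \<Rightarrow> real^'m) \<Rightarrow> ((real^'d \<Rightarrow> real^'m) \<Rightarrow> real^'d \<Rightarrow> 'b) \<Rightarrow> bool"
where
  "frechet_L1 T F us L \<longleftrightarrow>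
     (\<forall>h\<in>H1 (dom T). integrable (lebesgue_on (dom T)) (L h)) \<and>
     (\<forall>g\<in>H1 (dom T). \<forall>h\<in>H1 (dom T). \<forall>a b.
        AE x in lebesgue_on (dom T). L (\<lambda>y. a *\<^sub>R g y + b *\<^sub>R h y) x = a *\<^sub>R L g x + b *\<^sub>R L h x) \<and>
     (\<exists>C. \<forall>h\<in>H1 (dom T). L1norm (dom T) (L h) \<le> C * H1norm (dom T) h) \<and>
     (\<forall>\<epsilon>>0. \<exists>\<delta>>0. \<forall>u\<in>field_space T. H1norm (dom T) (\<lambda>x. u x - us x) < \<delta> \<longrightarrow>
        L1norm (dom T) (\<lambda>x. F u x - F us x - L (\<lambda>y. u y - us y) x)
          \<le> \<epsilon> * H1norm (dom T) (\<lambda>x. u x - us x))"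

definition frechet_port ::
  "('d::finite,'m::finite,'e,'f) octs \<Rightarrow> ((real^'d \<Rightarrow> real^'m) \<Rightarrow> 'b::real_normed_vector) \<Rightarrow>
   (real^'d \<Rightarrow> real^'m) \<Rightarrow> ((real^'d \<Rightarrow> real^'m) \<Rightarrow> 'b) \<Rightarrow> bool"
where
  "frechet_port T F us L \<longleftrightarrow>
     (\<forall>g\<in>H1 (dom T). \<forall>h\<in>H1 (dom T). \<forall>a b.
        L (\<lambda>y. a *\<^sub>R g y + b *\<^sub>R h y) = a *\<^sub>R L g + b *\<^sub>R L h) \<and>
     (\<exists>C. \<forall>h\<in>H1 (dom T). norm (L h) \<le> C * H1norm (dom T) h) \<and>
     (\<forall>\<epsilon>>0. \<exists>\<delta>>0. \<forall>u\<in>field_space T. H1norm (dom T) (\<lambda>x. u x - us x) < \<delta> \<longrightarrow>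
        norm (F u - F us - L (\<lambda>y. u y - us y)) \<le> \<epsilon> * H1norm (dom T) (\<lambda>x. u x - us x))"

definition Hstar ::
  "('d::finite,'m::finite,'e,'f) octs \<Rightarrow> (real^'d \<Rightarrow> real^'m) \<Rightarrow> real^'d \<Rightarrow> real^'m^'m"
  where "Hstar T us x = jacobian (grad (psi T x)) (at (us x))"

definition eta ::
  "('d::finite,'m::finite,'e,'f) octs \<Rightarrow> (real^'d \<Rightarrow> real^'m) \<Rightarrow> (real^'d \<Rightarrow> real^'m) \<Rightarrow> real^'d \<Rightarrow> real^'m"
  where "eta T us w x = Hstar T us x *v w x"

definition Jlin_diss ::
  "('d::finite,'m::finite,'e,'f) octs \<Rightarrow> (real^'d \<Rightarrow> real^'m) \<Rightarrow>
   ((real^'d \<Rightarrow> real^'m) \<Rightarrow> real^'d \<Rightarrow> real^'d^'m \<Rightarrow> real^'d^'m) \<Rightarrow>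
   (real^'d \<Rightarrow> real^'m) \<Rightarrow> real^'d \<Rightarrow> real^'d^'m"
  where "Jlin_diss T us M w x = - M us x (wgrad (dom T) (eta T us w) x)"

definition qlin_diss ::
  "('d::finite,'m::finite,'e,'f) octs \<Rightarrow> (real^'d \<Rightarrow> real^'m) \<Rightarrow>
   ((real^'d \<Rightarrow> real^'m) \<Rightarrow> real^'d \<Rightarrow> real^'d^'m \<Rightarrow> real^'d^'m) \<Rightarrow>
   (real^'d \<Rightarrow> real^'m) \<Rightarrow> real^'d \<Rightarrow> real^'d"
  where "qlin_diss T us M w x = eta T us w x v* Jlin_diss T us M w x"

definition F_lin ::
  "('d::finite,'m::finite,'e,'f) octs \<Rightarrow> (real^'d \<Rightarrow> real^'m) \<Rightarrow> (real^'d \<Rightarrow> real^'m) \<Rightarrow> real"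
  where "F_lin T us w = (1/2) * (LINT x|lebesgue_on (dom T). w x \<bullet> (Hstar T us x *v w x))"

definition D_lin ::
  "('d::finite,'m::finite,'e,'f) octs \<Rightarrow> (real^'d \<Rightarrow> real^'m) \<Rightarrow>
   ((real^'d \<Rightarrow> real^'m) \<Rightarrow> real^'d \<Rightarrow> real^'d^'m \<Rightarrow> real^'d^'m) \<Rightarrow> (real^'d \<Rightarrow> real^'m) \<Rightarrow> real"
where
  "D_lin T us M w =
     (LINT x|lebesgue_on (dom T).
        wgrad (dom T) (eta T us w) x \<bullet> M us x (wgrad (dom T) (eta T us w) x))"

definition S_lin ::
  "('d::finite,'m::finite,'e,'f) octs \<Rightarrow> (real^'d \<Rightarrow> real^'m) \<Rightarrow>
   ((real^'d \<Rightarrow> real^'m) \<Rightarrow> real^'d \<Rightarrow> real^'m) \<Rightarrow> (real^'d \<Rightarrow> real^'m) \<Rightarrow> real"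
  where "S_lin T us G w = (LINT x|lebesgue_on (dom T). eta T us w x \<bullet> G w x)"

definition B_lin ::
  "('d::finite,'m::finite,'e,'f) octs \<Rightarrow> ((real^'d \<Rightarrow> real^'m) \<Rightarrow> 'e) \<Rightarrow> ((real^'d \<Rightarrow> real^'m) \<Rightarrow> 'f) \<Rightarrow>
   (real^'d \<Rightarrow> real^'m) \<Rightarrow> real"
  where "B_lin T E F w = pairing T (E w) (F w)"

text \<open>
  Smooth perturbations: \<open>w\<close> is \<open>C\<^sup>k\<close> up to the boundary. As \<open>us\<close> is only an \<open>H\<^sup>1\<close> state, the terms
  \<open>\<nabla>\<eta>[w]\<close>, \<open>\<eta>[w] \<cdot> div A[w]\<close> and \<open>M \<nabla>\<eta>[w]\<close> do not become meaningful through smoothness of \<open>w\<close>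
  alone; the last two conditions make them so. They form a linear space.
\<close>

definition smooth_perturbation ::
  "enat \<Rightarrow> ('d::finite,'m::finite,'e,'f) octs \<Rightarrow> (real^'d \<Rightarrow> real^'m) \<Rightarrow>
   ((real^'d \<Rightarrow> real^'m) \<Rightarrow> real^'d \<Rightarrow> real^'d^'m \<Rightarrow> real^'d^'m) \<Rightarrow> (real^'d \<Rightarrow> real^'m) \<Rightarrow> bool"
where
  "smooth_perturbation k T us M w \<longleftrightarrow>
     w \<in> H1 (dom T) \<and> smooth_upto k (dom T) (closure (dom T)) w \<and>
     (\<exists>\<eta>. (AE x in lebesgue_on (dom T). \<eta> x = eta T us w x) \<and> Ck_upto 1 (dom T) (closure (dom T)) \<eta>) \<and>
     integrable (lebesgue_on (dom T)) (Jlin_diss T us M w)"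

text \<open>
  In the clause for \<open>M\<close>, the formula for \<open>Jdiss T u\<close> is imposed at all states for which \<open>\<nabla>\<mu>[u]\<close> exists
  as a weak gradient. \<open>A\<close>, \<open>G\<close>, \<open>E\<close>, \<open>F\<close> are the derivatives of \<open>Jrev T\<close>, \<open>Rsrc T\<close>, \<open>eport T\<close>,
  \<open>fport T\<close> at \<open>us\<close>.
\<close>

definition linearizable_class ::
  "enat \<Rightarrow> ('d::finite,'m::finite,'e::real_normed_vector,'f::real_normed_vector) octs \<Rightarrow>
   (real^'d \<Rightarrow> real^'m) \<Rightarrow>
   ((real^'d \<Rightarrow> real^'m) \<Rightarrow> real^'d \<Rightarrow> real^'d^'m \<Rightarrow> real^'d^'m) \<Rightarrow>
   ((real^'d \<Rightarrow> real^'m) \<Rightarrow> real^'d \<Rightarrow> real^'d^'m) \<Rightarrow>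
   ((real^'d \<Rightarrow> real^'m) \<Rightarrow> real^'d \<Rightarrow> real^'m) \<Rightarrow>
   ((real^'d \<Rightarrow> real^'m) \<Rightarrow> 'e) \<Rightarrow> ((real^'d \<Rightarrow> real^'m) \<Rightarrow> 'f) \<Rightarrow>
   ((real^'d \<Rightarrow> real^'m) \<Rightarrow> real^'d \<Rightarrow> real^'d) \<Rightarrow> bool"
where
  "linearizable_class k T us M A G E F qlin_rev \<longleftrightarrow>
     (AE x in lebesgue_on (dom T).
        \<exists>V. open V \<and> us x \<in> V \<and> V \<subseteq> states T \<and> Ck_upto 3 V V (psi T x)) \<and>
     frechet_L1 T (Jrev T) us A \<and> frechet_L1 T (Rsrc T) us G \<and>
     frechet_port T (eport T) us E \<and> frechet_port T (fport T) us F \<and>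
     has_weak_gradient (dom T) (mu T us) (\<lambda>x. 0) \<and>
     (ae_invariant T M \<and>
      (\<forall>u\<in>field_space T.
         (AE x in lebesgue_on (dom T).
            linear (M u x) \<and> (\<forall>P Q. P \<bullet> M u x Q = M u x P \<bullet> Q) \<and> (\<forall>P. 0 \<le> P \<bullet> M u x P)) \<and>
         (\<forall>P. has_weak_gradient (dom T) (mu T u) P \<longrightarrow>
            (AE x in lebesgue_on (dom T). Jdiss T u x = - M u x (P x))))) \<and>
     ((\<forall>w v a b. smooth_perturbation k T us M w \<and> smooth_perturbation k T us M v \<longrightarrow>
         (AE x in lebesgue_on (dom T).
            qlin_rev (\<lambda>y. a *\<^sub>R w y + b *\<^sub>R v y) x = a *\<^sub>R qlin_rev w x + b *\<^sub>R qlin_rev v x)) \<and>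
      (\<forall>w. smooth_perturbation k T us M w \<longrightarrow>
         integrable (lebesgue_on (dom T)) (qlin_rev w) \<and>
         (\<forall>\<phi>. test_function (dom T) \<phi> \<longrightarrow>
            distr_mult_div (dom T) (eta T us w) (A w) \<phi> = distr_div (dom T) (qlin_rev w) \<phi>)))"

definition boundary_matching ::
  "enat \<Rightarrow> ('d::finite,'m::finite,'e,'f) octs \<Rightarrow> (real^'d \<Rightarrow> real^'m) \<Rightarrow>
   ((real^'d \<Rightarrow> real^'m) \<Rightarrow> real^'d \<Rightarrow> real^'d^'m \<Rightarrow> real^'d^'m) \<Rightarrow>
   ((real^'d \<Rightarrow> real^'m) \<Rightarrow> 'e) \<Rightarrow> ((real^'d \<Rightarrow> real^'m) \<Rightarrow> 'f) \<Rightarrow>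
   ((real^'d \<Rightarrow> real^'m) \<Rightarrow> real^'d \<Rightarrow> real^'d) \<Rightarrow> bool"
where
  "boundary_matching k T us M E F qlin_rev \<longleftrightarrow>
     (\<forall>w. smooth_perturbation k T us M w \<longrightarrow>
        has_boundary_flux (dom T) (nrml T) (surf T)
          (\<lambda>x. qlin_rev w x + qlin_diss T us M w x) (- B_lin T E F w))"

text \<open>
  As for \<open>smooth_perturbation\<close>, the regularity of \<open>\<eta>[w]\<close> in space and time does not follow from that
  of \<open>w\<close>. The equation holds in the sense of distributions on \<open>\<Omega>\<close> at every time; its divergence
  term is then the integrable function \<open>G[w(t)] - \<partial>\<^sub>t w(t)\<close>.
\<close>

definition smooth_linear_solution ::
  "enat \<Rightarrow> ('d::finite,'m::finite,'e,'f) octs \<Rightarrow> (real^'d \<Rightarrow> real^'m) \<Rightarrow>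
   ((real^'d \<Rightarrow> real^'m) \<Rightarrow> real^'d \<Rightarrow> real^'d^'m \<Rightarrow> real^'d^'m) \<Rightarrow>
   ((real^'d \<Rightarrow> real^'m) \<Rightarrow> real^'d \<Rightarrow> real^'d^'m) \<Rightarrow>
   ((real^'d \<Rightarrow> real^'m) \<Rightarrow> real^'d \<Rightarrow> real^'m) \<Rightarrow> real \<Rightarrow> (real \<Rightarrow> real^'d \<Rightarrow> real^'m) \<Rightarrow> bool"
where
  "smooth_linear_solution k T us M A G \<tau> w \<longleftrightarrow>
     smooth_upto k ({0<..<\<tau>} \<times> dom T) ({0<..<\<tau>} \<times> closure (dom T)) (\<lambda>(t, x). w t x) \<and>
     (\<forall>t\<in>{0<..<\<tau>}. smooth_perturbation k T us M (w t)) \<and>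
     (\<exists>\<eta>. (\<forall>t\<in>{0<..<\<tau>}. AE x in lebesgue_on (dom T). \<eta> t x = eta T us (w t) x) \<and>
          Ck_upto 1 ({0<..<\<tau>} \<times> dom T) ({0<..<\<tau>} \<times> closure (dom T)) (\<lambda>(t, x). \<eta> t x)) \<and>
     (\<forall>t\<in>{0<..<\<tau>}.
        has_distr_div (dom T) (\<lambda>x. A (w t) x + Jlin_diss T us M (w t) x)
          (\<lambda>x. G (w t) x - time_deriv w t x))"

end

theory Submission
  imports Defs
begin

text \<open>
  The balance law is a computation in two steps. In time, \<open>F_lin\<close> is one half of the integral of
  \<open>w \<bullet> H w\<close>, where \<open>H\<close> is the Hessian of the storage density at the equilibrium; by the symmetry of
  \<open>H\<close> its derivative is \<open>\<integral> \<eta> \<bullet> \<partial>\<^sub>t w\<close> with \<open>\<eta> = H w\<close> (\<open>quadratic_energy_derivative\<close>). In space, the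
  equation reads \<open>\<partial>\<^sub>t w = G[w] - div (A[w] + J)\<close> with \<open>J = - M \<nabla>\<eta>\<close>. Multiplied by \<open>\<eta>\<close>, the first part
  of the divergence is \<open>div q\<close> for the linear reversible flux \<open>q\<close>, the second one is
  \<open>div (\<eta> \<bullet> J) - \<nabla>\<eta> : J = div (\<eta> \<bullet> J) + \<nabla>\<eta> : M \<nabla>\<eta>\<close>. Integration over the domain turns the two
  divergences into the boundary flux, which boundary matching identifies with the port power
  (\<open>energy_identity\<close>).

  Almost all of the work is in the regularity at which the last step is made. The equation and the
  identity for \<open>q\<close> hold only in the sense of distributions, the fluxes are only integrable, and the
  total energy flux is continuous up to the boundary while its divergence is merely an \<open>L\<^sup>1\<close>
  function. Three tools bridge this gap.

  The first is mollification. An identity for smooth test functions extends to compactly supported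
  \<open>C\<^sup>1\<close> functions (\<open>distr_div_C1_test\<close>), so that one may test with the product of a test function and
  \<open>\<eta>\<close>. For a continuous flux it even extends to Lipschitz functions with an almost everywhere
  gradient (\<open>distr_div_lipschitz_test\<close>).

  The second is the fundamental lemma of the calculus of variations (\<open>fundamental_lemma\<close>). It shows
  that weak gradients are unique, so that the weak gradient of a \<open>C\<^sup>1\<close> function, although chosen
  arbitrarily, is the classical one almost everywhere (\<open>wgrad_classical\<close>).

  The third is the divergence theorem on a bounded Lipschitz domain for a field that is continuous up
  to the boundary and has an integrable distributional divergence (\<open>divergence_theorem\<close>). Near a
  boundary point the domain lies below the graph of a Lipschitz function \<open>g\<close>. A smooth function
  supported there is cut off by a profile in the height below the graph, over a layer of thickness
  \<open>\<epsilon>\<close>. This is an admissible Lipschitz test function; in the layer its gradient is dominated by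
  the derivative of the profile times \<open>(\<nabla>g - \<nu>) / \<epsilon>\<close>. As \<open>\<epsilon>\<close> tends to \<open>0\<close>, the layer integral converges to the flux
  through the graph (\<open>boundary_layer_limit\<close>, \<open>normal_flux\<close>); the factor \<open>sqrt (1 + |\<nabla>g|\<^sup>2)\<close> of
  the surface measure cancels the normalization of the outward normal. Smooth plateau functions
  patch the charts together.
\<close>

section \<open>Smooth functions on the whole space\<close>

abbreviation Ck :: "nat \<Rightarrow> ('a::real_normed_vector \<Rightarrow> 'b::real_normed_vector) \<Rightarrow> bool"
  where "Ck n f \<equiv> Ck_upto n UNIV UNIV f"

abbreviation smooth :: "('a::real_normed_vector \<Rightarrow> 'b::real_normed_vector) \<Rightarrow> bool"
  where "smooth f \<equiv> \<forall>n. Ck n f"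

lemma Ck_0: "Ck 0 f \<longleftrightarrow> continuous_on UNIV f"
proof
  assume "Ck 0 f"
  then obtain g where "continuous_on UNIV g" "\<forall>x. g x = f x" by auto
  then have "g = f" by auto
  with \<open>continuous_on UNIV g\<close> show "continuous_on UNIV f" by simp
qed auto

lemma Ck_imp_continuous: "Ck n f \<Longrightarrow> continuous_on UNIV f"
  unfolding Ck_0[symmetric] by (cases n) auto

lemma smooth_imp_continuous: "smooth f \<Longrightarrow> continuous_on UNIV f"
  using Ck_imp_continuous by blast

lemma Ck_SucI:
  assumes D: "\<And>x. (f has_derivative D x) (at x)" and "\<And>v. Ck n (\<lambda>x. D x v)"
  shows "Ck (Suc n) f"
proof -
  have "frechet_derivative f (at x) = D x" for x
    using frechet_derivative_at[OF D] by auto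
  moreover have "continuous_on UNIV f"
    by (intro continuous_at_imp_continuous_on ballI has_derivative_continuous[OF D])
  moreover have "\<forall>x. f differentiable at x" using D differentiable_def by blast
  ultimately show ?thesis using assms(2) by auto
qed

lemma Ck_SucD:
  assumes "Ck (Suc n) f"
  shows "\<exists>D. (\<forall>x. (f has_derivative D x) (at x)) \<and> (\<forall>v. Ck n (\<lambda>x. D x v))"
proof (intro exI conjI allI)
  show "(f has_derivative frechet_derivative f (at x)) (at x)" for x
    using assms by (simp flip: frechet_derivative_works)
  show "Ck n (\<lambda>x. frechet_derivative f (at x) v)" for v
    using assms by simp
qed

lemma Ck_Suc_imp_Ck: "Ck (Suc n) f \<Longrightarrow> Ck n f"
proof (induction n arbitrary: f)
  case 0
  then show ?case using Ck_imp_continuous Ck_0 by metis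
next
  case (Suc n)
  obtain D where D: "\<forall>x. (f has_derivative D x) (at x)" "\<forall>v. Ck (Suc n) (\<lambda>x. D x v)"
    using Ck_SucD[OF Suc.prems] by (elim exE conjE) (erule (1) that)
  note D = D[rule_format]
  show ?case by (rule Ck_SucI[OF D(1)]) (rule Suc.IH[OF D(2)])
qed

lemma Ck_const: "Ck n (\<lambda>x. c)"
proof (induction n arbitrary: c)
  case (Suc n)
  show ?case by (rule Ck_SucI[where D="\<lambda>x v. 0"]) (auto intro: Suc)
qed (auto intro: continuous_on_const)

lemma Ck_bounded_linear:
  assumes "bounded_linear f" shows "Ck n f"
proof (cases n)
  case 0
  then show ?thesis using assms by (auto intro: linear_continuous_on)
next
  case (Suc m)
  show ?thesis unfolding Suc
    by (rule Ck_SucI[where D="\<lambda>x. f"]) (auto intro: Ck_const bounded_linear_imp_has_derivative assms)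
qed

lemma Ck_add: "Ck n f \<Longrightarrow> Ck n g \<Longrightarrow> Ck n (\<lambda>x. f x + g x)"
proof (induction n arbitrary: f g)
  case 0
  then show ?case unfolding Ck_0 by (rule continuous_on_add)
next
  case (Suc n)
  obtain D where D: "\<forall>x. (f has_derivative D x) (at x)" "\<forall>v. Ck n (\<lambda>x. D x v)"
    using Ck_SucD[OF Suc.prems(1)] by (elim exE conjE) (erule (1) that)
  note D = D[rule_format]
  obtain E where E: "\<forall>x. (g has_derivative E x) (at x)" "\<forall>v. Ck n (\<lambda>x. E x v)"
    using Ck_SucD[OF Suc.prems(2)] by (elim exE conjE) (erule (1) that)
  note E = E[rule_format]
  show ?case
    by (rule Ck_SucI[where D="\<lambda>x v. D x v + E x v"]) (rule has_derivative_add[OF D(1) E(1)] Suc.IH[OF D(2) E(2)])+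
qed

lemma Ck_mult:
  fixes f g :: "'a::real_normed_vector \<Rightarrow> real"
  shows "Ck n f \<Longrightarrow> Ck n g \<Longrightarrow> Ck n (\<lambda>x. f x * g x)"
proof (induction n arbitrary: f g)
  case 0
  then show ?case unfolding Ck_0 by (rule continuous_on_mult)
next
  case (Suc n)
  obtain D where D: "\<forall>x. (f has_derivative D x) (at x)" "\<forall>v. Ck n (\<lambda>x. D x v)"
    using Ck_SucD[OF Suc.prems(1)] by (elim exE conjE) (erule (1) that)
  note D = D[rule_format]
  obtain E where E: "\<forall>x. (g has_derivative E x) (at x)" "\<forall>v. Ck n (\<lambda>x. E x v)"
    using Ck_SucD[OF Suc.prems(2)] by (elim exE conjE) (erule (1) that)
  note E = E[rule_format]
  show ?case
    by (rule Ck_SucI[where D="\<lambda>x v. f x * E x v + D x v * g x"])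
       (rule has_derivative_mult[OF D(1) E(1)]
         Ck_add[OF Suc.IH[OF Ck_Suc_imp_Ck[OF Suc.prems(1)] E(2)]
                   Suc.IH[OF D(2) Ck_Suc_imp_Ck[OF Suc.prems(2)]]])+
qed

lemma Ck_compose_real:
  fixes f :: "'a::real_normed_vector \<Rightarrow> real" and h :: "real \<Rightarrow> real"
  shows "Ck n h \<Longrightarrow> Ck n f \<Longrightarrow> Ck n (\<lambda>x. h (f x))"
proof (induction n arbitrary: h)
  case 0
  then show ?case unfolding Ck_0 using continuous_on_compose2 by blast
next
  case (Suc n)
  obtain H where H: "\<forall>x. (h has_derivative H x) (at x)" "\<forall>v. Ck n (\<lambda>x. H x v)"
    using Ck_SucD[OF Suc.prems(1)] by (elim exE conjE) (erule (1) that)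
  note H = H[rule_format]
  obtain D where D: "\<forall>x. (f has_derivative D x) (at x)" "\<forall>v. Ck n (\<lambda>x. D x v)"
    using Ck_SucD[OF Suc.prems(2)] by (elim exE conjE) (erule (1) that)
  note D = D[rule_format]
  have lin: "H y z = H y 1 * z" for y z
    using linear_cmul[OF has_derivative_linear[OF H(1)], of y z 1] by simp
  show ?case
  proof (rule Ck_SucI)
    show "((\<lambda>x. h (f x)) has_derivative (\<lambda>v. H (f x) 1 * D x v)) (at x)" for x
      using has_derivative_compose[OF D(1) H(1), of x] by (subst (asm) lin)
    show "Ck n (\<lambda>x. H (f x) 1 * D x v)" for v
      by (rule Ck_mult[OF Suc.IH[OF H(2) Ck_Suc_imp_Ck[OF Suc.prems(2)]] D(2)])
  qed
qed

text \<open>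
  The functions \<open>p (1/t) exp (-1/t)\<close>, extended by zero, form a family that is closed under
  differentiation; this is why the polynomial is a parameter.
\<close>

definition flat :: "real poly \<Rightarrow> real \<Rightarrow> real" where
  "flat p t = (if t > 0 then poly p (inverse t) * exp (- inverse t) else 0)"

lemma flat_tendsto_0: "((\<lambda>t. poly p (inverse t) * exp (- inverse t)) \<longlongrightarrow> 0) (at_right (0::real))"
proof -
  have "((\<lambda>s. \<Sum>i\<le>degree p. coeff p i * (s ^ i / exp s)) \<longlongrightarrow> (\<Sum>i\<le>degree p. coeff p i * 0)) at_top"
    by (intro tendsto_sum tendsto_mult tendsto_const tendsto_power_div_exp_0)
  then have "((\<lambda>s. poly p s * exp (- s)) \<longlongrightarrow> 0) at_top"
    by (simp add: poly_altdef exp_minus sum_distrib_right divide_inverse mult.assoc)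
  then show ?thesis using filterlim_compose filterlim_inverse_at_top_right by fast
qed

text \<open>
  For \<open>s = 1/t\<close> the product rule gives \<open>d/dt (p(s) exp (-s)) = s\<^sup>2 (p(s) - p'(s)) exp (-s)\<close>. At \<open>0\<close> the
  difference quotient is again of this form, with the polynomial \<open>X p\<close>, and tends to \<open>0\<close>.
\<close>

lemma flat_has_derivative:
  "(flat p has_real_derivative flat (monom 1 2 * (p - pderiv p)) t) (at t)"
proof -
  have pos: "((\<lambda>t. poly p (inverse t) * exp (- inverse t)) has_real_derivative
     flat (monom 1 2 * (p - pderiv p)) t) (at t)" if "t > 0" for t
    using that unfolding flat_def
    by (auto intro!: derivative_eq_intros DERIV_chain2[OF poly_DERIV] simp: poly_monom power2_eq_square algebra_simps)
  consider "t > 0" | "t < 0" | "t = 0" by linarith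
  then show ?thesis
  proof cases
    case 1
    have "\<forall>\<^sub>F x in nhds t. flat p x = poly p (inverse x) * exp (- inverse x)"
      by (rule eventually_nhds_in_open[of "{0<..}", THEN eventually_mono]) (use 1 in \<open>auto simp: flat_def\<close>)
    from DERIV_cong_ev[OF refl this refl] pos[OF 1] show ?thesis by simp
  next
    case 2
    have "((\<lambda>x. 0) has_real_derivative 0) (at t)" by simp
    moreover have "\<forall>\<^sub>F x in nhds t. flat p x = 0"
      by (rule eventually_nhds_in_open[of "{..<0}", THEN eventually_mono]) (use 2 in \<open>auto simp: flat_def\<close>)
    ultimately show ?thesis using 2 DERIV_cong_ev[of t t "flat p" "\<lambda>x. 0" 0 0] by (simp add: flat_def)
  next
    case 3
    have "((\<lambda>y. (flat p y - flat p 0) / (y - 0)) \<longlongrightarrow> 0) (at 0)"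
      unfolding filterlim_at_split
    proof
      have "\<forall>\<^sub>F y in at_left 0. (flat p y - flat p 0) / (y - 0) = 0"
        unfolding eventually_at_filter by (simp add: flat_def)
      then show "((\<lambda>y. (flat p y - flat p 0) / (y - 0)) \<longlongrightarrow> 0) (at_left 0)"
        by (rule tendsto_eventually)
      have "\<forall>\<^sub>F y in at_right 0. poly ([:0,1:] * p) (inverse y) * exp (- inverse y) = (flat p y - flat p 0) / (y - 0)"
        by (rule eventually_mono[OF eventually_at_right_less[of 0]]) (simp add: flat_def divide_inverse)
      then show "((\<lambda>y. (flat p y - flat p 0) / (y - 0)) \<longlongrightarrow> 0) (at_right 0)"
        by (rule Lim_transform_eventually[OF flat_tendsto_0])
    qed
    then show ?thesis using 3 by (simp add: has_field_derivative_iff flat_def)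
  qed
qed

lemma Ck_flat: "Ck n (flat p)"
proof (induction n arbitrary: p)
  case 0
  then show ?case unfolding Ck_0
    by (intro continuous_at_imp_continuous_on ballI DERIV_isCont[OF flat_has_derivative])
next
  case (Suc n)
  show ?case
  proof (rule Ck_SucI)
    show "(flat p has_derivative (\<lambda>v. flat (monom 1 2 * (p - pderiv p)) x * v)) (at x)" for x
      using flat_has_derivative[of p x] by (simp add: has_field_derivative_def)
    show "Ck n (\<lambda>x. flat (monom 1 2 * (p - pderiv p)) x * v)" for v
      by (rule Ck_mult[OF Suc Ck_const])
  qed
qed

lemma Ck_inner_self: "Ck n (\<lambda>x::'a::euclidean_space. x \<bullet> x)"
proof -
  have *: "Ck n (\<lambda>x::'a. \<Sum>b\<in>B. (x \<bullet> b) * (x \<bullet> b))" if "finite B" for B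
    using that
  proof (induction B)
    case empty
    show ?case unfolding sum.empty by (rule Ck_const)
  next
    case (insert b B)
    show ?case unfolding sum.insert[OF insert.hyps]
      by (rule Ck_add[OF Ck_mult[OF Ck_bounded_linear Ck_bounded_linear] insert.IH])
         (rule bounded_linear_inner_left)+
  qed
  have "(\<lambda>x::'a. x \<bullet> x) = (\<lambda>x::'a. \<Sum>b\<in>Basis. (x \<bullet> b) * (x \<bullet> b))"
    by (simp add: euclidean_inner[symmetric])
  then show ?thesis using *[OF finite_Basis] by (simp only:)
qed

text \<open>
  The function \<open>exp (- 1 / (\<delta>\<^sup>2 - |z|\<^sup>2))\<close> on the ball of radius \<open>\<delta>\<close>, normalized.
\<close>

lemma smooth_kernel_exists:
  assumes "\<delta> > 0"
  obtains \<rho> :: "'a::euclidean_space \<Rightarrow> real" where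
    "smooth \<rho>" "\<And>z. 0 \<le> \<rho> z" "\<And>z. \<delta> \<le> norm z \<Longrightarrow> \<rho> z = 0"
    "integrable lborel \<rho>" "integral\<^sup>L lborel \<rho> = 1"
proof -
  define b where "b = (\<lambda>z::'a. flat 1 (\<delta>\<^sup>2 + (-1) * (z \<bullet> z)))"
  have b_smooth: "Ck n b" for n
    unfolding b_def by (rule Ck_compose_real[OF Ck_flat Ck_add[OF Ck_const Ck_mult[OF Ck_const Ck_inner_self]]])
  have b0: "b z = 0" if "\<delta> \<le> norm z" for z
  proof -
    have "\<delta>\<^sup>2 \<le> (norm z)\<^sup>2" using that assms by (intro power_mono) auto
    then show ?thesis by (simp add: b_def flat_def dot_square_norm)
  qed
  have bpos: "0 < b z" if "norm z < \<delta>" for z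
  proof -
    have "(norm z)\<^sup>2 < \<delta>\<^sup>2" using that assms by (intro power_strict_mono) auto
    then show ?thesis by (simp add: b_def flat_def dot_square_norm)
  qed
  have bnn: "0 \<le> b z" for z
    using b0[of z] bpos[of z] by linarith
  have cont: "continuous_on UNIV b" using Ck_imp_continuous[OF b_smooth[of 0]] .
  have int: "integrable lborel b"
  proof -
    have "integrable lborel (\<lambda>x. indicator (cball 0 \<delta>) x *\<^sub>R b x)"
      using borel_integrable_compact[OF compact_cball, of 0 \<delta> b] continuous_on_subset[OF cont]
      by (auto simp: set_integrable_def)
    moreover have "(\<lambda>x. indicator (cball 0 \<delta>) x *\<^sub>R b x) = b"
      using b0 by (force simp: indicator_def)
    ultimately show ?thesis by simp
  qed
  have pos: "integral\<^sup>L lborel b > 0"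
  proof (rule ccontr)
    assume "\<not> ?thesis"
    then have "integral\<^sup>L lborel b = 0"
      using Bochner_Integration.integral_nonneg[of lborel b] bnn by (simp add: order.antisym not_less)
    then have "AE x in lborel. b x = 0"
      using integral_nonneg_eq_0_iff_AE[OF int] bnn by auto
    then have "AE x in lborel. x \<notin> ball (0::'a) \<delta>"
      by eventually_elim (use bpos in force)
    then have "ball (0::'a) \<delta> \<in> null_sets lborel"
      by (subst AE_iff_null_sets) auto
    then have "negligible (ball (0::'a) \<delta>)"
      by (simp add: negligible_iff_null_sets null_sets_completionI)
    then show False using assms open_not_negligible[of "ball (0::'a) \<delta>"] by auto
  qed
  show thesis
  proof
    show "\<forall>n. Ck n (\<lambda>z. inverse (integral\<^sup>L lborel b) * b z)"
      by (intro allI) (rule Ck_mult[OF Ck_const b_smooth])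
  qed (use int pos bnn b0 in auto)
qed

section \<open>Differentiation under the integral sign\<close>

lemma has_derivative_imp_LIMSEQ:
  fixes F :: "'a::real_normed_vector \<Rightarrow> real"
  assumes "(F has_derivative D) (at x)"
  shows "(\<lambda>n. real (Suc n) * (F (x + inverse (real (Suc n)) *\<^sub>R h) - F x)) \<longlonglongrightarrow> D h"
proof -
  have "((\<lambda>t. F (x + t *\<^sub>R h)) has_derivative (\<lambda>t. D (t *\<^sub>R h))) (at 0)"
    by (rule has_derivative_compose[of "\<lambda>t. x + t *\<^sub>R h" "\<lambda>t. t *\<^sub>R h" 0 UNIV F D])
       (auto intro!: derivative_eq_intros assms)
  moreover have "(\<lambda>t. D (t *\<^sub>R h)) = (\<lambda>t. D h * t)"
    using linear_cmul[OF has_derivative_linear[OF assms]] by (auto simp: mult.commute)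
  ultimately have "((\<lambda>t. F (x + t *\<^sub>R h)) has_real_derivative D h) (at 0)"
    by (simp add: has_field_derivative_def)
  then have "((\<lambda>t. (F (x + t *\<^sub>R h) - F x) / t) \<longlongrightarrow> D h) (at 0)"
    by (simp add: has_field_derivative_iff)
  then have "(\<lambda>n. (F (x + inverse (real (Suc n)) *\<^sub>R h) - F x) / inverse (real (Suc n))) \<longlonglongrightarrow> D h"
    unfolding LIMSEQ_SEQ_conv[symmetric] using LIMSEQ_inverse_real_of_nat by auto
  then show ?thesis by (simp add: divide_inverse mult.commute)
qed

text \<open>
  A bound for difference quotients is inherited by the derivative. With \<open>l = 0\<close> this bounds the
  derivative of a Lipschitz function; with \<open>l\<close> the derivative of another function it compares the two.
\<close>

lemma has_derivative_bound_near_linear: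
  fixes F :: "'a::real_normed_vector \<Rightarrow> real"
  assumes D: "(F has_derivative D) (at x)" and l: "linear l"
    and "r > 0" and bnd: "\<And>h. norm h < r \<Longrightarrow> \<bar>F (x + h) - F x - l h\<bar> \<le> C * norm h"
  shows "\<bar>D h - l h\<bar> \<le> C * norm h"
proof (rule tendsto_upperbound)
  show "(\<lambda>n. \<bar>real (Suc n) * (F (x + inverse (real (Suc n)) *\<^sub>R h) - F x) - l h\<bar>) \<longlonglongrightarrow> \<bar>D h - l h\<bar>"
    by (intro tendsto_intros has_derivative_imp_LIMSEQ D)
  have "(\<lambda>n. norm (inverse (real (Suc n)) *\<^sub>R h)) \<longlonglongrightarrow> norm (0 *\<^sub>R h)"
    by (intro tendsto_intros LIMSEQ_inverse_real_of_nat)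
  then have "\<forall>\<^sub>F n in sequentially. norm (inverse (real (Suc n)) *\<^sub>R h) < r"
    using \<open>r > 0\<close> by (auto intro: order_tendstoD(2))
  then show "\<forall>\<^sub>F n in sequentially. \<bar>real (Suc n) * (F (x + inverse (real (Suc n)) *\<^sub>R h) - F x) - l h\<bar> \<le> C * norm h"
  proof eventually_elim
    case (elim n)
    let ?k = "inverse (real (Suc n)) *\<^sub>R h"
    have "l h = real (Suc n) * l ?k" using linear_cmul[OF l, of "inverse (real (Suc n))" h]
      by (simp add: field_simps)
    then have "real (Suc n) * (F (x + ?k) - F x) - l h = real (Suc n) * (F (x + ?k) - F x - l ?k)"
      by (simp only: right_diff_distrib)
    then have "\<bar>real (Suc n) * (F (x + ?k) - F x) - l h\<bar> = real (Suc n) * \<bar>F (x + ?k) - F x - l ?k\<bar>"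
      by (simp only: abs_mult abs_of_nat)
    also have "\<dots> \<le> real (Suc n) * (C * norm ?k)"
      by (intro mult_left_mono bnd[OF elim]) auto
    also have "\<dots> = C * norm h" by (simp add: field_simps)
    finally show ?case .
  qed
qed simp

lemma inner_right_cancel_fun: "(\<lambda>h. a \<bullet> h) = (\<lambda>h. b \<bullet> h) \<Longrightarrow> a = b"
  by (metis vector_eq_rdot)

lemma norm_le_if_inner_le:
  assumes "\<And>h. \<bar>a \<bullet> h\<bar> \<le> K * norm h" "0 \<le> K"
  shows "norm a \<le> K"
proof (cases "a = 0")
  case False
  have "norm a * norm a \<le> K * norm a"
    using assms(1)[of a] by (simp add: dot_square_norm power2_eq_square)
  then show ?thesis using False by simp
qed (use assms in simp)

lemma lipschitz_gradient_bound:
  fixes f :: "'a::real_inner \<Rightarrow> real"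
  assumes "(f has_derivative (\<lambda>h. g \<bullet> h)) (at x)" and "\<And>x y. \<bar>f x - f y\<bar> \<le> L * norm (x - y)" "0 \<le> L"
  shows "norm g \<le> L"
proof (rule norm_le_if_inner_le[OF _ assms(3)])
  fix h
  have "\<bar>g \<bullet> h - 0\<bar> \<le> L * norm h"
    by (rule has_derivative_bound_near_linear[OF assms(1), where l="\<lambda>h. 0" and r=1])
       (use assms(2)[of "x + _" x] in \<open>auto simp: linear_zero\<close>)
  then show "\<bar>g \<bullet> h\<bar> \<le> L * norm h" by simp
qed

text \<open>
  Dominated convergence for the difference quotients. The derivative of the integrand may exist only
  almost everywhere, provided that the integrand is Lipschitz in the parameter with an integrable
  constant; this covers Lipschitz functions that are not \<open>C\<^sup>1\<close>.
\<close>

lemma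
  fixes F :: "'a::real_normed_vector \<Rightarrow> 'b \<Rightarrow> real"
  assumes "r > 0"
    and F: "\<And>h. norm h < r \<Longrightarrow> integrable M (F (x + h))"
    and D: "AE y in M. ((\<lambda>x. F x y) has_derivative D y) (at x)"
    and Dm[measurable]: "\<And>h. (\<lambda>y. D y h) \<in> borel_measurable M"
    and lip: "\<And>h. norm h < r \<Longrightarrow> AE y in M. \<bar>F (x + h) y - F x y\<bar> \<le> B y * norm h"
    and B: "integrable M B"
  shows integrable_parametric_derivative: "integrable M (\<lambda>y. D y h)"
    and has_derivative_parametric_integral:
      "((\<lambda>x. LINT y|M. F x y) has_derivative (\<lambda>h. LINT y|M. D y h)) (at x)"
proof -
  have D_bnd: "AE y in M. \<bar>D y h\<bar> \<le> B y * norm h" for h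
  proof -
    have "(\<lambda>n. norm (inverse (real (Suc n)) *\<^sub>R h)) \<longlonglongrightarrow> norm (0 *\<^sub>R h)"
      by (intro tendsto_intros LIMSEQ_inverse_real_of_nat)
    then have "\<forall>\<^sub>F n in sequentially. norm (inverse (real (Suc n)) *\<^sub>R h) < r"
      using \<open>r > 0\<close> by (auto intro: order_tendstoD(2))
    then obtain N where N: "\<And>n. n \<ge> N \<Longrightarrow> norm (inverse (real (Suc n)) *\<^sub>R h) < r"
      by (auto simp: eventually_sequentially)
    have "AE y in M. \<forall>n. n \<ge> N \<longrightarrow> \<bar>F (x + inverse (real (Suc n)) *\<^sub>R h) y - F x y\<bar>
            \<le> B y * norm (inverse (real (Suc n)) *\<^sub>R h)"
      unfolding AE_all_countable using lip[OF N] by auto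
    with D show ?thesis
    proof eventually_elim
      case (elim y)
      show ?case
      proof (rule tendsto_upperbound)
        show "(\<lambda>n. \<bar>real (Suc n) * (F (x + inverse (real (Suc n)) *\<^sub>R h) y - F x y)\<bar>) \<longlonglongrightarrow> \<bar>D y h\<bar>"
          by (intro tendsto_rabs has_derivative_imp_LIMSEQ elim)
        have "\<bar>real (Suc n) * (F (x + inverse (real (Suc n)) *\<^sub>R h) y - F x y)\<bar> \<le> B y * norm h"
          if "n \<ge> N" for n
        proof -
          have "\<bar>real (Suc n) * (F (x + inverse (real (Suc n)) *\<^sub>R h) y - F x y)\<bar>
              = real (Suc n) * \<bar>F (x + inverse (real (Suc n)) *\<^sub>R h) y - F x y\<bar>"
            by (simp add: abs_mult)
          also have "\<dots> \<le> real (Suc n) * (B y * norm (inverse (real (Suc n)) *\<^sub>R h))"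
            using elim(2) that by (intro mult_left_mono) auto
          also have "\<dots> = B y * norm h" by (simp add: field_simps)
          finally show ?thesis .
        qed
        then show "\<forall>\<^sub>F n in sequentially. \<bar>real (Suc n) * (F (x + inverse (real (Suc n)) *\<^sub>R h) y - F x y)\<bar> \<le> B y * norm h"
          by (auto simp: eventually_sequentially)
      qed simp
    qed
  qed
  have D_int: "integrable M (\<lambda>y. D y h)" for h
    by (rule Bochner_Integration.integrable_bound[of _ "\<lambda>y. B y * norm h"])
       (use B D_bnd[of h] in \<open>auto elim!: eventually_mono\<close>)
  then show "integrable M (\<lambda>y. D y h)" .
  have D_norm: "\<bar>LINT y|M. D y h\<bar> \<le> norm h * integral\<^sup>L M B" for h
  proof -
    have "\<bar>LINT y|M. D y h\<bar> \<le> (LINT y|M. \<bar>D y h\<bar>)"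
      by (rule integral_abs_bound)
    also have "\<dots> \<le> (LINT y|M. B y * norm h)"
      by (rule integral_mono_AE) (use B D_int D_bnd in auto)
    finally show ?thesis by (simp add: mult.commute)
  qed
  have bl: "bounded_linear (\<lambda>h. LINT y|M. D y h)"
  proof (rule bounded_linear_intro)
    fix h k :: 'a and c :: real
    have "(LINT y|M. D y (h + k)) = (LINT y|M. D y h + D y k)"
      by (rule integral_cong_AE)
         (use D in \<open>auto elim!: eventually_mono dest: has_derivative_linear linear_add\<close>)
    then show "(LINT y|M. D y (h + k)) = (LINT y|M. D y h) + (LINT y|M. D y k)"
      by (simp add: D_int)
    have "(LINT y|M. D y (c *\<^sub>R h)) = (LINT y|M. c *\<^sub>R D y h)"
      by (rule integral_cong_AE)
         (use D in \<open>auto elim!: eventually_mono dest!: has_derivative_linear simp: linear_cmul\<close>)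
    then show "(LINT y|M. D y (c *\<^sub>R h)) = c *\<^sub>R (LINT y|M. D y h)" by simp
    show "norm (LINT y|M. D y h) \<le> norm h * integral\<^sup>L M B" using D_norm by simp
  qed
  show "((\<lambda>x. LINT y|M. F x y) has_derivative (\<lambda>h. LINT y|M. D y h)) (at x)"
    unfolding has_derivative_at LIMSEQ_SEQ_conv[symmetric]
  proof (intro conjI bl allI impI, elim conjE)
    fix S :: "nat \<Rightarrow> 'a" assume S: "\<forall>n. S n \<noteq> 0" "S \<longlonglongrightarrow> 0"
    have "(\<lambda>n. norm (S n)) \<longlonglongrightarrow> 0" using S(2) tendsto_norm_zero by blast
    then have "\<forall>\<^sub>F n in sequentially. norm (S n) < r"
      using \<open>r > 0\<close> by (auto intro: order_tendstoD(2))
    then obtain N where "\<And>n. N \<le> n \<Longrightarrow> norm (S n) < r"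
      unfolding eventually_sequentially by blast
    then have N: "norm (S (n + N)) < r" for n by simp
    \<comment> \<open>The estimates hold near the base point only, so an initial segment of the sequence is dropped.\<close>
    define s where "s n = S (n + N)" for n
    have s: "s n \<noteq> 0" "norm (s n) < r" for n using S N by (auto simp: s_def)
    have s0: "s \<longlonglongrightarrow> 0" unfolding s_def using S(2) by (rule LIMSEQ_ignore_initial_segment)
    have Fx: "integrable M (F x)" using F[of 0] \<open>r > 0\<close> by simp
    note [measurable] = borel_measurable_integrable[OF F[OF s(2)]] borel_measurable_integrable[OF Fx]
      borel_measurable_integrable[OF B]
    have "(\<lambda>n. LINT y|M. (F (x + s n) y - F x y - D y (s n)) / norm (s n)) \<longlonglongrightarrow> (LINT y|M. 0)"
    proof (rule integral_dominated_convergence)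
      show "integrable M (\<lambda>y. 2 * B y)" using B by simp
      show "AE y in M. norm ((F (x + s n) y - F x y - D y (s n)) / norm (s n)) \<le> 2 * B y" for n
        using lip[OF s(2), of n] D_bnd[of "s n"]
        by eventually_elim (use s(1)[of n] in \<open>auto simp: divide_simps abs_if split: if_splits\<close>)
      show "AE y in M. (\<lambda>n. (F (x + s n) y - F x y - D y (s n)) / norm (s n)) \<longlonglongrightarrow> 0"
        using D
      proof eventually_elim
        case (elim y)
        then have "(\<lambda>h. norm (F (x + h) y - F x y - D y h) / norm h) \<midarrow>0\<rightarrow> 0"
          by (simp add: has_derivative_at)
        then have "(\<lambda>n. norm (F (x + s n) y - F x y - D y (s n)) / norm (s n)) \<longlonglongrightarrow> 0"
          unfolding LIMSEQ_SEQ_conv[symmetric] using s(1) s0 by auto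
        then show ?case
          by (subst tendsto_norm_zero_iff[symmetric]) simp
      qed
    qed auto
    moreover have "(LINT y|M. (F (x + s n) y - F x y - D y (s n)) / norm (s n))
        = ((LINT y|M. F (x + s n) y) - (LINT y|M. F x y) - (LINT y|M. D y (s n))) / norm (s n)" for n
      using F[OF s(2)] Fx D_int by simp
    ultimately have "(\<lambda>n. ((LINT y|M. F (x + s n) y) - (LINT y|M. F x y) - (LINT y|M. D y (s n))) / norm (s n)) \<longlonglongrightarrow> 0"
      by (simp only: Bochner_Integration.integral_zero)
    then have "(\<lambda>n. norm ((LINT y|M. F (x + s n) y) - (LINT y|M. F x y) - (LINT y|M. D y (s n))) / norm (s n)) \<longlonglongrightarrow> 0"
      by (subst (asm) tendsto_norm_zero_iff[symmetric]) simp
    then show "(\<lambda>n. norm ((LINT y|M. F (x + S n) y) - (LINT y|M. F x y) - (LINT y|M. D y (S n))) / norm (S n)) \<longlonglongrightarrow> 0"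
      unfolding s_def by (rule LIMSEQ_offset)
  qed
qed

text \<open>
  Continuity of the directional derivatives suffices: they are bounded on the compact support, and
  the whole derivative is controlled by those in the basis directions.
\<close>

lemma C1_compact_support_bounds:
  fixes f :: "'a::euclidean_space \<Rightarrow> real"
  assumes D: "\<And>x. (f has_derivative D x) (at x)" and cont: "\<And>v. continuous_on UNIV (\<lambda>x. D x v)"
    and supp: "\<And>x. R < norm x \<Longrightarrow> f x = 0"
  obtains C where "C \<ge> 0" "\<And>x h. \<bar>D x h\<bar> \<le> C * norm h" "\<And>x y. \<bar>f x - f y\<bar> \<le> C * norm (x - y)"
proof -
  have D0: "D x h = 0" if "R < norm x" for x h
  proof -
    have "open {x::'a. R < norm x}" by (intro open_Collect_less continuous_intros)
    then have "((\<lambda>x. 0) has_derivative D x) (at x)"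
      using that supp by (intro has_derivative_transform_within_open[OF D, where s="{x. R < norm x}"]) auto
    then have "D x = (\<lambda>h. 0)" by (rule has_derivative_unique) simp
    then show ?thesis by simp
  qed
  have "\<exists>c. \<forall>x. \<bar>D x b\<bar> \<le> c" for b
  proof -
    have "compact ((\<lambda>x. D x b) ` cball 0 R)"
      by (intro compact_continuous_image compact_cball continuous_on_subset[OF cont]) auto
    then obtain c where c: "\<And>x. x \<in> cball 0 R \<Longrightarrow> \<bar>D x b\<bar> \<le> c"
      by (force dest!: compact_imp_bounded simp: bounded_iff)
    have "\<bar>D x b\<bar> \<le> max c 0" for x
      using c[of x] D0[of x b] by (cases "norm x \<le> R") auto
    then show ?thesis by blast
  qed
  then obtain c where c: "\<And>b x. \<bar>D x b\<bar> \<le> c b" by metis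
  define C where "C = (\<Sum>b\<in>Basis. c b)"
  have c0: "c b \<ge> 0" for b using c[of undefined b] by linarith
  have bnd: "\<bar>D x h\<bar> \<le> C * norm h" for x h
  proof -
    have "D x h = D x (\<Sum>b\<in>Basis. (h \<bullet> b) *\<^sub>R b)" by (simp add: euclidean_representation)
    also have "\<dots> = (\<Sum>b\<in>Basis. (h \<bullet> b) * D x b)"
      using has_derivative_linear[OF D] by (simp add: linear_sum linear_cmul)
    also have "\<bar>\<dots>\<bar> \<le> (\<Sum>b\<in>Basis. \<bar>(h \<bullet> b) * D x b\<bar>)" by (rule sum_abs)
    also have "\<dots> \<le> (\<Sum>b\<in>Basis. norm h * c b)"
      by (intro sum_mono) (auto simp: abs_mult intro!: mult_mono Basis_le_norm c)
    finally show ?thesis by (simp add: C_def sum_distrib_left mult.commute)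
  qed
  show thesis
  proof
    show "C \<ge> 0" unfolding C_def by (intro sum_nonneg c0)
    show "\<bar>f x - f y\<bar> \<le> C * norm (x - y)" for x y
    proof -
      have "onorm (D x) \<le> C" for x
        by (rule onorm_le) (use bnd in auto)
      then show ?thesis
        using differentiable_bound[of UNIV f D C x y] D by (auto simp: has_derivative_at_withinI)
    qed
  qed (rule bnd)
qed

section \<open>Convolution\<close>

definition conv :: "('a::euclidean_space \<Rightarrow> real) \<Rightarrow> ('a \<Rightarrow> real) \<Rightarrow> 'a \<Rightarrow> real"
  where "conv \<rho> f x = (LBINT y. f y * \<rho> (x - y))"

lemma lborel_distr_reflect: "distr lborel borel (\<lambda>y::'a::euclidean_space. x - y) = lborel"
  using lborel_affine[of "-1" x] by (simp add: density_1)

lemma integral_reflect: 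
  fixes f :: "'a::euclidean_space \<Rightarrow> real"
  assumes "f \<in> borel_measurable borel"
  shows "(LBINT y. f (x - y)) = (LBINT y. f y)"
  using integral_distr[of "\<lambda>y. x - y" lborel borel f] assms by (simp add: lborel_distr_reflect)

lemma integrable_reflect: 
  fixes f :: "'a::euclidean_space \<Rightarrow> real"
  assumes "integrable lborel f"
  shows "integrable lborel (\<lambda>y. f (x - y))"
  using integrable_distr[of "\<lambda>y. x - y" lborel borel f] assms by (simp add: lborel_distr_reflect)

lemma integral_translate: 
  fixes f :: "'a::euclidean_space \<Rightarrow> real"
  assumes "f \<in> borel_measurable borel"
  shows "(LBINT y. f (x + y)) = (LBINT y. f y)"
  using integral_distr[of "\<lambda>y. x + y" lborel borel f] assms by (simp add: lborel_distr_plus)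

lemma integrable_translate: 
  fixes f :: "'a::euclidean_space \<Rightarrow> real"
  assumes "integrable lborel f"
  shows "integrable lborel (\<lambda>y. f (x + y))"
  using integrable_distr[of "\<lambda>y. x + y" lborel borel f] assms by (simp add: lborel_distr_plus)

lemma has_derivative_conv:
  fixes \<rho> f :: "'a::euclidean_space \<Rightarrow> real"
  assumes D: "\<And>x. (\<rho> has_derivative D x) (at x)" and cont: "\<And>v. continuous_on UNIV (\<lambda>x. D x v)"
    and supp: "\<And>x. R < norm x \<Longrightarrow> \<rho> x = 0" and f: "integrable lborel f"
  shows "(conv \<rho> f has_derivative (\<lambda>h. conv (\<lambda>z. D z h) f x)) (at x)"
proof -
  obtain C where C: "C \<ge> 0" "\<And>x h. \<bar>D x h\<bar> \<le> C * norm h" "\<And>x y. \<bar>\<rho> x - \<rho> y\<bar> \<le> C * norm (x - y)"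
    using C1_compact_support_bounds[OF D cont supp] by metis
  note [measurable] = borel_measurable_integrable[OF f, simplified]
  have \<rho>cont: "continuous_on UNIV \<rho>"
    by (intro continuous_at_imp_continuous_on ballI has_derivative_continuous[OF D])
  have [measurable]: "\<rho> \<in> borel_measurable borel" by (rule borel_measurable_continuous_onI[OF \<rho>cont])
  have [measurable]: "(\<lambda>x. D x v) \<in> borel_measurable borel" for v
    by (rule borel_measurable_continuous_onI[OF cont])
  obtain z :: 'a where z: "R < norm z" 
    using vector_choose_size[of "\<bar>R\<bar> + 1"] by (metis abs_ge_self abs_ge_zero add_nonneg_pos less_add_one less_eq_real_def order_le_less_trans zero_less_one)
  have \<rho>bnd: "\<bar>\<rho> x\<bar> \<le> C * (\<bar>R\<bar> + norm z)" for x
  proof (cases "norm x \<le> R")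
    case True
    have "\<bar>\<rho> x\<bar> \<le> C * norm (x - z)" using C(3)[of x z] supp[OF z] by simp
    also have "\<dots> \<le> C * (\<bar>R\<bar> + norm z)"
      using norm_triangle_ineq4[of x z] True by (intro mult_left_mono C) linarith+
    finally show ?thesis .
  qed (use C supp in auto)
  show ?thesis unfolding conv_def
  proof (rule has_derivative_parametric_integral[where r=1 and B="\<lambda>y. C * \<bar>f y\<bar>"])
    show "integrable lborel (\<lambda>y. f y * \<rho> (x + h - y))" for h
      by (rule Bochner_Integration.integrable_bound[of _ "\<lambda>y. (C * (\<bar>R\<bar> + norm z)) * f y"])
         (use f C(1) in \<open>auto simp: abs_mult mult.commute intro!: AE_I2 mult_left_mono order_trans[OF \<rho>bnd]\<close>)
    show "AE y in lborel. ((\<lambda>x. f y * \<rho> (x - y)) has_derivative (\<lambda>h. f y * D (x - y) h)) (at x)"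
    proof (intro AE_I2)
      fix y
      have "((\<lambda>x. \<rho> (x - y)) has_derivative D (x - y)) (at x)"
        by (rule has_derivative_compose[of "\<lambda>x. x - y" "\<lambda>h. h", OF _ D]) (auto intro!: derivative_eq_intros)
      then show "((\<lambda>x. f y * \<rho> (x - y)) has_derivative (\<lambda>h. f y * D (x - y) h)) (at x)"
        by (rule has_derivative_mult_right)
    qed
    show "AE y in lborel. \<bar>f y * \<rho> (x + h - y) - f y * \<rho> (x - y)\<bar> \<le> C * \<bar>f y\<bar> * norm h" for h
    proof (intro AE_I2)
      fix y
      have "\<bar>f y * \<rho> (x + h - y) - f y * \<rho> (x - y)\<bar> = \<bar>f y\<bar> * \<bar>\<rho> (x + h - y) - \<rho> (x - y)\<bar>"
        by (simp add: abs_mult flip: right_diff_distrib)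
      also have "\<dots> \<le> \<bar>f y\<bar> * (C * norm h)"
        using C(3)[of "x + h - y" "x - y"] by (intro mult_left_mono) auto
      finally show "\<bar>f y * \<rho> (x + h - y) - f y * \<rho> (x - y)\<bar> \<le> C * \<bar>f y\<bar> * norm h"
        by (simp add: mult_ac)
    qed
  qed (use f in auto)
qed

text \<open>
  Derivatives of a convolution fall on the kernel, and a derivative of a kernel is again a kernel;
  hence the induction runs over all kernels at once.
\<close>

lemma Ck_conv:
  fixes \<rho> f :: "'a::euclidean_space \<Rightarrow> real"
  assumes "smooth \<rho>" and "\<And>x. R < norm x \<Longrightarrow> \<rho> x = 0" and f: "integrable lborel f"
  shows "Ck n (conv \<rho> f)"
  using assms(1,2)
proof (induction n arbitrary: \<rho>)
  case (0 \<rho>)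
  have D: "(\<rho> has_derivative frechet_derivative \<rho> (at x)) (at x)" for x
    using 0(1)[rule_format, of 1] by (simp flip: frechet_derivative_works)
  have "continuous_on UNIV (\<lambda>x. frechet_derivative \<rho> (at x) v)" for v
    using 0(1)[rule_format, of 1] unfolding Ck_0[symmetric] by simp
  from has_derivative_conv[OF D this 0(2) f] show ?case
    unfolding Ck_0
    by (intro continuous_at_imp_continuous_on ballI) (rule has_derivative_continuous)
next
  case (Suc n \<rho>)
  have D: "(\<rho> has_derivative frechet_derivative \<rho> (at x)) (at x)" for x
    using Suc.prems(1)[rule_format, of 1] by (simp flip: frechet_derivative_works)
  have sm: "Ck m (\<lambda>x. frechet_derivative \<rho> (at x) v)" for m v
    using Suc.prems(1)[rule_format, of "Suc m"] by simp
  have D0: "frechet_derivative \<rho> (at x) v = 0" if "R < norm x" for x v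
  proof -
    have "open {x::'a. R < norm x}" by (intro open_Collect_less continuous_intros)
    then have "((\<lambda>x. 0) has_derivative frechet_derivative \<rho> (at x)) (at x)"
      using that Suc.prems(2) by (intro has_derivative_transform_within_open[OF D, where s="{x. R < norm x}"]) auto
    then have "frechet_derivative \<rho> (at x) = (\<lambda>h. 0)" by (rule has_derivative_unique) simp
    then show ?thesis by simp
  qed
  show ?case
  proof (rule Ck_SucI)
    show "(conv \<rho> f has_derivative (\<lambda>h. conv (\<lambda>z. frechet_derivative \<rho> (at z) h) f x)) (at x)" for x
      by (rule has_derivative_conv[OF D Ck_imp_continuous[OF sm] Suc.prems(2) f])
    show "Ck n (\<lambda>x. conv (\<lambda>z. frechet_derivative \<rho> (at z) v) f x)" for v
      using Suc.IH[of "\<lambda>z. frechet_derivative \<rho> (at z) v"] sm D0 by blast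
  qed
qed

section \<open>Mollifiers and test functions\<close>

definition mollifier :: "real \<Rightarrow> ('a::euclidean_space \<Rightarrow> real) \<Rightarrow> bool"
where
  "mollifier \<delta> \<rho> \<longleftrightarrow> smooth \<rho> \<and> (\<forall>z. 0 \<le> \<rho> z) \<and> (\<forall>z. \<delta> \<le> norm z \<longrightarrow> \<rho> z = 0) \<and>
     integrable lborel \<rho> \<and> integral\<^sup>L lborel \<rho> = 1"

lemma mollifier_exists: "\<delta> > 0 \<Longrightarrow> \<exists>\<rho>::'a::euclidean_space \<Rightarrow> real. mollifier \<delta> \<rho>"
  unfolding mollifier_def by (rule smooth_kernel_exists) auto

lemma integrable_conv:
  fixes \<rho> f :: "'a::euclidean_space \<Rightarrow> real"
  assumes \<rho>: "mollifier \<delta> \<rho>" and f: "integrable lborel f"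
  shows "integrable lborel (\<lambda>y. f y * \<rho> (x - y))"
proof -
  have cont: "continuous_on UNIV \<rho>"
    using \<rho> smooth_imp_continuous unfolding mollifier_def by blast
  have "compact (\<rho> ` cball 0 \<delta>)"
    by (intro compact_continuous_image compact_cball continuous_on_subset[OF cont]) auto
  then obtain c where c: "\<And>x. x \<in> cball 0 \<delta> \<Longrightarrow> \<bar>\<rho> x\<bar> \<le> c"
    by (force dest!: compact_imp_bounded simp: bounded_iff)
  have \<rho>0: "\<rho> x = 0" if "\<delta> \<le> norm x" for x using \<rho> that by (auto simp: mollifier_def)
  have bnd: "\<bar>\<rho> x\<bar> \<le> max c 0" for x
    using c[of x] \<rho>0[of x] by (cases "norm x \<le> \<delta>") auto
  have [measurable]: "\<rho> \<in> borel_measurable borel" by (rule borel_measurable_continuous_onI[OF cont])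
  note [measurable] = borel_measurable_integrable[OF f, simplified]
  show ?thesis
    by (rule Bochner_Integration.integrable_bound[of _ "\<lambda>y. max c 0 * f y"])
       (use f in \<open>auto simp: abs_mult mult.commute intro!: AE_I2 mult_left_mono order_trans[OF bnd]\<close>)
qed

text \<open>
  The convolution is an average of values of \<open>f\<close> on the ball of radius \<open>\<delta>\<close>. Bounds,
  uniform closeness to \<open>f\<close> and vanishing off a neighbourhood of the support are all instances of this.
\<close>

lemma conv_mollifier_close:
  fixes \<rho> f :: "'a::euclidean_space \<Rightarrow> real"
  assumes \<rho>: "mollifier \<delta> \<rho>" and f: "integrable lborel f"
    and bnd: "\<And>y. norm (y - x) < \<delta> \<Longrightarrow> \<bar>f y - c\<bar> \<le> e"
  shows "\<bar>conv \<rho> f x - c\<bar> \<le> e"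
proof -
  have \<rho>i: "integrable lborel \<rho>" and \<rho>1: "integral\<^sup>L lborel \<rho> = 1" and \<rho>nn: "\<And>z. 0 \<le> \<rho> z"
    and \<rho>0: "\<And>z. \<delta> \<le> norm z \<Longrightarrow> \<rho> z = 0"
    using \<rho> unfolding mollifier_def by auto
  have i: "integrable lborel (\<lambda>y. \<rho> (x - y))" by (rule integrable_reflect[OF \<rho>i])
  have 1: "(LBINT y. \<rho> (x - y)) = 1"
    using integral_reflect[of \<rho> x] \<rho>i \<rho>1 by (auto dest: borel_measurable_integrable)
  have j: "integrable lborel (\<lambda>y. f y * \<rho> (x - y))" by (rule integrable_conv[OF \<rho> f])
  have "conv \<rho> f x - c = (LBINT y. f y * \<rho> (x - y)) - (LBINT y. c * \<rho> (x - y))"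
    using 1 by (simp add: conv_def)
  also have "\<dots> = (LBINT y. f y * \<rho> (x - y) - c * \<rho> (x - y))"
    using i j by (subst Bochner_Integration.integral_diff) auto
  also have "\<bar>\<dots>\<bar> \<le> (LBINT y. \<bar>f y * \<rho> (x - y) - c * \<rho> (x - y)\<bar>)"
    by (rule integral_abs_bound)
  also have "\<dots> \<le> (LBINT y. e * \<rho> (x - y))"
  proof (rule integral_mono)
    fix y
    show "\<bar>f y * \<rho> (x - y) - c * \<rho> (x - y)\<bar> \<le> e * \<rho> (x - y)"
    proof (cases "norm (y - x) < \<delta>")
      case True
      have "\<bar>f y * \<rho> (x - y) - c * \<rho> (x - y)\<bar> = \<bar>f y - c\<bar> * \<rho> (x - y)"
        using \<rho>nn[of "x - y"] by (simp add: abs_mult flip: left_diff_distrib)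
      then show ?thesis using bnd[OF True] \<rho>nn by (simp add: mult_right_mono)
    qed (simp add: \<rho>0 norm_minus_commute)
  qed (use i j in auto)
  also have "\<dots> = e" using 1 by simp
  finally show ?thesis .
qed

lemma conv_translate:
  fixes \<rho> f :: "'a::euclidean_space \<Rightarrow> real"
  assumes [measurable]: "\<rho> \<in> borel_measurable borel" "f \<in> borel_measurable borel"
  shows "conv \<rho> f (x + h) = conv \<rho> (\<lambda>y. f (h + y)) x"
proof -
  have "conv \<rho> f (x + h) = (LBINT y. f (h + y) * \<rho> (x + h - (h + y)))"
    unfolding conv_def by (rule integral_translate[symmetric]) measurable
  then show ?thesis by (simp add: conv_def algebra_simps)
qed

text \<open>
  The difference quotients of the convolution are averages of the difference quotients of \<open>f\<close>, which
  compares its derivative with \<open>l\<close> even where \<open>f\<close> itself is not differentiable.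
\<close>

lemma conv_derivative_close:
  fixes \<rho> f :: "'a::euclidean_space \<Rightarrow> real"
  assumes \<rho>: "mollifier \<delta> \<rho>" and f: "integrable lborel f" and l: "linear l" and "r > 0"
    and bnd: "\<And>y h. norm (y - x) < \<delta> \<Longrightarrow> norm h < r \<Longrightarrow> \<bar>f (h + y) - f y - l h\<bar> \<le> C * norm h"
    and D: "(conv \<rho> f has_derivative D) (at x)"
  shows "\<bar>D h - l h\<bar> \<le> C * norm h"
proof (rule has_derivative_bound_near_linear[OF D l \<open>r > 0\<close>])
  fix h :: 'a assume h: "norm h < r"
  have m: "\<rho> \<in> borel_measurable borel" "f \<in> borel_measurable borel"
    using \<rho> f unfolding mollifier_def by (auto dest: borel_measurable_integrable)
  have "conv \<rho> f (x + h) - conv \<rho> f x = conv \<rho> (\<lambda>y. f (h + y) - f y) x"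
    unfolding conv_translate[OF m]
    unfolding conv_def left_diff_distrib
    by (rule Bochner_Integration.integral_diff[symmetric])
       (intro integrable_conv[OF \<rho>] integrable_translate f)+
  then show "\<bar>conv \<rho> f (x + h) - conv \<rho> f x - l h\<bar> \<le> C * norm h"
    using conv_mollifier_close[OF \<rho>, of "\<lambda>y. f (h + y) - f y" x "l h" "C * norm h"] f
      integrable_translate[OF f] bnd[OF _ h] by auto
qed

lemma mollifier_supp: "mollifier \<delta> \<rho> \<Longrightarrow> \<delta> < norm z \<Longrightarrow> \<rho> z = 0"
  by (auto simp: mollifier_def)

lemma mollifier_smooth: "mollifier \<delta> \<rho> \<Longrightarrow> smooth \<rho>"
  by (auto simp: mollifier_def)

lemma smooth_conv: "mollifier \<delta> \<rho> \<Longrightarrow> integrable lborel f \<Longrightarrow> Ck n (conv \<rho> f)"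
  by (rule Ck_conv[OF mollifier_smooth]) (auto intro: mollifier_supp)

lemma compact_cball_nbhd:
  fixes K :: "'a::euclidean_space set"
  assumes "compact K"
  shows "compact {x. \<exists>y\<in>K. dist x y \<le> \<delta>}"
proof -
  have "{x. \<exists>y\<in>K. dist x y \<le> \<delta>} = {x + y |x y. x \<in> K \<and> y \<in> cball 0 \<delta>}"
  proof (intro subset_antisym subsetI)
    fix x assume "x \<in> {x. \<exists>y\<in>K. dist x y \<le> \<delta>}"
    then obtain y where "y \<in> K" "dist x y \<le> \<delta>" by blast
    then have "x = y + (x - y) \<and> y \<in> K \<and> x - y \<in> cball 0 \<delta>" by (simp add: dist_norm norm_minus_commute)
    then show "x \<in> {x + y |x y. x \<in> K \<and> y \<in> cball 0 \<delta>}" by blast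
  qed (force simp: dist_norm)
  then show ?thesis using compact_sums[OF assms compact_cball[of 0 \<delta>]] by (simp only:)
qed

text \<open>
  Mollify the indicator function of the closed \<open>\<delta>/2\<close>-neighbourhood of \<open>K\<close> at scale \<open>\<delta>/2\<close>.
\<close>

lemma smooth_plateau:
  fixes K :: "'a::euclidean_space set"
  assumes "compact K" "\<delta> > 0"
  obtains \<phi> :: "'a \<Rightarrow> real" where "smooth \<phi>" "\<And>x. 0 \<le> \<phi> x" "\<And>x. \<phi> x \<le> 1"
    "\<And>x. x \<in> K \<Longrightarrow> \<phi> x = 1" "\<And>x. (\<And>y. y \<in> K \<Longrightarrow> \<delta> < dist x y) \<Longrightarrow> \<phi> x = 0"
proof -
  define A where "A = {x. \<exists>y\<in>K. dist x y \<le> \<delta>/2}"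
  have A: "compact A" unfolding A_def by (rule compact_cball_nbhd[OF assms(1)])
  obtain \<rho> :: "'a \<Rightarrow> real" where \<rho>: "mollifier (\<delta>/2) \<rho>" using mollifier_exists[of "\<delta>/2"] assms by auto
  define f where "f = (indicator A :: 'a \<Rightarrow> real)"
  have f: "integrable lborel f"
    unfolding f_def using A by (auto intro!: integrable_real_indicator borel_compact emeasure_compact_finite)
  have f01: "\<bar>f y - 1/2\<bar> \<le> 1/2" for y by (auto simp: f_def indicator_def)
  have b: "\<bar>conv \<rho> f x - 1/2\<bar> \<le> 1/2" for x
    by (rule conv_mollifier_close[OF \<rho> f]) (rule f01)
  show thesis
  proof
    show "smooth (conv \<rho> f)" using smooth_conv[OF \<rho> f] by blast
    show "0 \<le> conv \<rho> f x" "conv \<rho> f x \<le> 1" for x using b[of x] by (auto simp: abs_if split: if_splits)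
    show "conv \<rho> f x = 1" if "x \<in> K" for x
    proof -
      have "\<bar>conv \<rho> f x - 1\<bar> \<le> 0"
      proof (rule conv_mollifier_close[OF \<rho> f])
        fix y assume "norm (y - x) < \<delta>/2"
        then have "y \<in> A" using that unfolding A_def by (auto simp: dist_norm intro!: bexI[of _ x])
        then show "\<bar>f y - 1\<bar> \<le> 0" by (simp add: f_def)
      qed
      then show ?thesis by simp
    qed
    show "conv \<rho> f x = 0" if far: "\<And>y. y \<in> K \<Longrightarrow> \<delta> < dist x y" for x
    proof -
      have "\<bar>conv \<rho> f x - 0\<bar> \<le> 0"
      proof (rule conv_mollifier_close[OF \<rho> f])
        fix y assume y: "norm (y - x) < \<delta>/2"
        have "y \<notin> A"
        proof
          assume "y \<in> A"
          then obtain z where z: "z \<in> K" "dist y z \<le> \<delta>/2" by (auto simp: A_def)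
          have "dist x z \<le> dist x y + dist y z" by (rule dist_triangle)
          with y z far[OF z(1)] show False by (simp add: dist_norm norm_minus_commute)
        qed
        then show "\<bar>f y - 0\<bar> \<le> 0" by (simp add: f_def)
      qed
      then show ?thesis by simp
    qed
  qed
qed

lemma test_functionI:
  assumes "smooth \<phi>" "compact C" "C \<subseteq> \<Omega>" "\<And>x. x \<notin> C \<Longrightarrow> \<phi> x = 0"
  shows "test_function \<Omega> \<phi>"
proof -
  have *: "closure {x. \<phi> x \<noteq> 0} \<subseteq> C"
    by (rule closure_minimal) (use assms in \<open>auto intro: compact_imp_closed\<close>)
  have "compact (closure {x. \<phi> x \<noteq> 0})"
    using bounded_subset[OF compact_imp_bounded[OF assms(2)] *] closed_closure
    by (simp only: compact_eq_bounded_closed) blast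
  with * show ?thesis
    using assms unfolding test_function_def smooth_upto_def by auto
qed

lemma test_functionD:
  assumes "test_function \<Omega> \<phi>"
  shows "smooth \<phi>" "\<exists>C. compact C \<and> C \<subseteq> \<Omega> \<and> (\<forall>x. x \<notin> C \<longrightarrow> \<phi> x = 0)"
proof -
  show "smooth \<phi>" using assms unfolding test_function_def smooth_upto_def by auto
  show "\<exists>C. compact C \<and> C \<subseteq> \<Omega> \<and> (\<forall>x. x \<notin> C \<longrightarrow> \<phi> x = 0)"
    using assms closure_subset[of "{x. \<phi> x \<noteq> 0}"]
    unfolding test_function_def by (intro exI[of _ "closure {x. \<phi> x \<noteq> 0}"]) blast
qed

lemma compact_open_nbhd:
  fixes K \<Omega> :: "'a::euclidean_space set"
  assumes "compact K" "open \<Omega>" "K \<subseteq> \<Omega>"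
  obtains \<delta> where "\<delta> > 0" "{x. \<exists>y\<in>K. dist x y \<le> \<delta>} \<subseteq> \<Omega>"
proof -
  obtain d where d: "d > 0" "\<forall>x\<in>K. \<forall>y\<in>- \<Omega>. d \<le> dist x y"
    using separate_compact_closed[of K "- \<Omega>"] assms by auto
  show thesis
  proof
    show "d/2 > 0" using d by simp
    show "{x. \<exists>y\<in>K. dist x y \<le> d/2} \<subseteq> \<Omega>"
    proof clarify
      fix x y assume y: "y \<in> K" "dist x y \<le> d/2"
      show "x \<in> \<Omega>"
      proof (rule ccontr)
        assume "x \<notin> \<Omega>"
        then have "d \<le> dist y x" using d y by auto
        with y d(1) show False by (simp add: dist_commute)
      qed
    qed
  qed
qed

section \<open>The fundamental lemma of the calculus of variations\<close>

text \<open>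
  For moving integrals between a domain and a compact part of it that carries the integrand.
\<close>

lemma integral_lebesgue_on_cong:
  fixes f :: "'a::euclidean_space \<Rightarrow> real"
  assumes "A \<in> sets lebesgue" "B \<in> sets lebesgue"
    and "\<And>x. x \<in> A \<Longrightarrow> x \<notin> B \<Longrightarrow> f x = 0" "\<And>x. x \<in> B \<Longrightarrow> x \<notin> A \<Longrightarrow> g x = 0"
    and "\<And>x. x \<in> A \<Longrightarrow> x \<in> B \<Longrightarrow> f x = g x"
  shows "(LINT x|lebesgue_on A. f x) = (LINT x|lebesgue_on B. g x)"
    and "integrable (lebesgue_on A) f \<longleftrightarrow> integrable (lebesgue_on B) g"
proof -
  have *: "(\<lambda>x. indicator A x *\<^sub>R f x) = (\<lambda>x. indicator B x *\<^sub>R g x)"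
    using assms by (auto simp: indicator_def)
  show "(LINT x|lebesgue_on A. f x) = (LINT x|lebesgue_on B. g x)"
    using assms(1,2) by (simp add: integral_restrict_space * del: real_scaleR_def)
  show "integrable (lebesgue_on A) f \<longleftrightarrow> integrable (lebesgue_on B) g"
    using assms(1,2) by (simp add: integrable_restrict_space * del: real_scaleR_def)
qed

lemma integral_lebesgue_on_eq_lborel:
  fixes f :: "'a::euclidean_space \<Rightarrow> real"
  assumes "A \<in> sets lebesgue" "\<And>x. x \<notin> A \<Longrightarrow> g x = 0" "\<And>x. x \<in> A \<Longrightarrow> f x = g x"
    and [measurable]: "g \<in> borel_measurable borel"
  shows "(LINT x|lebesgue_on A. f x) = (LBINT x. g x)"
    and "integrable (lebesgue_on A) f \<longleftrightarrow> integrable lborel g"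
proof -
  have *: "(\<lambda>x. indicator A x *\<^sub>R f x) = g"
    using assms by (auto simp: indicator_def)
  show "(LINT x|lebesgue_on A. f x) = (LBINT x. g x)"
    using assms(1) by (simp add: integral_restrict_space * integral_completion del: real_scaleR_def)
  show "integrable (lebesgue_on A) f \<longleftrightarrow> integrable lborel g"
    using assms(1) by (simp add: integrable_restrict_space * integrable_completion del: real_scaleR_def)
qed

lemma lebesgue_on_measurable:
  "f \<in> borel_measurable borel \<Longrightarrow> f \<in> borel_measurable (lebesgue_on \<Omega>)"
  by (intro measurable_restrict_space1 measurable_completion) auto

lemmas continuous_lebesgue_on_measurable = lebesgue_on_measurable[OF borel_measurable_continuous_onI]

lemma integrable_inner_bounded:
  fixes f g :: "'a \<Rightarrow> 'b::euclidean_space"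
  assumes f: "integrable M f" and g: "g \<in> borel_measurable M" and c: "AE x in M. norm (g x) \<le> c"
  shows "integrable M (\<lambda>x. f x \<bullet> g x)" "integrable M (\<lambda>x. g x \<bullet> f x)"
proof -
  note [measurable] = borel_measurable_integrable[OF f] g
  show "integrable M (\<lambda>x. f x \<bullet> g x)"
  proof (rule Bochner_Integration.integrable_bound[of _ "\<lambda>x. c *\<^sub>R f x"])
    show "AE x in M. norm (f x \<bullet> g x) \<le> norm (c *\<^sub>R f x)"
      using c
    proof eventually_elim
      case (elim x)
      have "norm (f x \<bullet> g x) \<le> norm (f x) * norm (g x)" using Cauchy_Schwarz_ineq2[of "f x" "g x"] by simp
      also have "\<dots> \<le> norm (f x) * \<bar>c\<bar>" using elim by (intro mult_left_mono) auto
      finally show ?case by (simp add: mult.commute)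
    qed
  qed (use f in auto)
  then show "integrable M (\<lambda>x. g x \<bullet> f x)" by (simp add: inner_commute)
qed

lemma continuous_compact_support_bounded:
  fixes f :: "'a::topological_space \<Rightarrow> real"
  assumes "continuous_on UNIV f" "compact C" "\<And>x. x \<notin> C \<Longrightarrow> f x = 0"
  shows "\<exists>c\<ge>0. \<forall>x. \<bar>f x\<bar> \<le> c"
proof -
  obtain c where c: "\<And>x. x \<in> C \<Longrightarrow> \<bar>f x\<bar> \<le> c"
    using compact_imp_bounded[OF compact_continuous_image[OF continuous_on_subset[OF assms(1)] assms(2)]]
    by (auto simp: bounded_iff)
  have "\<bar>f x\<bar> \<le> \<bar>c\<bar>" for x using c[of x] assms(3)[of x] by (cases "x \<in> C") auto
  then show ?thesis by (intro exI[of _ "\<bar>c\<bar>"]) auto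
qed

text \<open>
  Plateau functions that shrink to the indicator function of a compact set \<open>K\<close> give \<open>\<integral>\<^sub>K f = 0\<close>. If
  \<open>f > 0\<close> on \<open>K\<close>, then \<open>K\<close> is therefore null. Up to a null set, the set where \<open>f\<close> is positive is a
  countable union of such compact sets.
\<close>

lemma fundamental_lemma:
  fixes f :: "real^'d \<Rightarrow> real"
  assumes \<Omega>: "open \<Omega>" and f: "locally_integrable \<Omega> f"
    and zero: "\<And>\<phi>. test_function \<Omega> \<phi> \<Longrightarrow> (LINT x|lebesgue_on \<Omega>. f x * \<phi> x) = 0"
  shows "AE x in lebesgue_on \<Omega>. f x = 0"
proof -
  have A: "(LINT x|lebesgue_on K. f x) = 0" if K: "compact K" "K \<subseteq> \<Omega>" for K
  proof -
    obtain d where d: "d > 0" "{x. \<exists>y\<in>K. dist x y \<le> d} \<subseteq> \<Omega>"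
      using compact_open_nbhd[OF K(1) \<Omega> K(2)] .
    define Q where "Q = {x. \<exists>y\<in>K. dist x y \<le> d}"
    have Q: "compact Q" "Q \<subseteq> \<Omega>" using d compact_cball_nbhd[OF K(1)] by (auto simp: Q_def)
    have KQ: "K \<subseteq> Q" using d(1) by (force simp: Q_def)
    have "\<exists>\<phi>::real^'d \<Rightarrow> real. smooth \<phi> \<and> (\<forall>x. 0 \<le> \<phi> x) \<and> (\<forall>x. \<phi> x \<le> 1) \<and> (\<forall>x\<in>K. \<phi> x = 1) \<and>
       (\<forall>x. (\<forall>y\<in>K. d / Suc n < dist x y) \<longrightarrow> \<phi> x = 0)" for n
      by (rule smooth_plateau[OF K(1), of "d / Suc n"]) (use d in auto)
    then obtain \<phi> :: "nat \<Rightarrow> real^'d \<Rightarrow> real" where \<phi>: "\<And>n. smooth (\<phi> n)" "\<And>n x. 0 \<le> \<phi> n x" "\<And>n x. \<phi> n x \<le> 1"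
      "\<And>n x. x \<in> K \<Longrightarrow> \<phi> n x = 1" "\<And>n x. (\<forall>y\<in>K. d / Suc n < dist x y) \<Longrightarrow> \<phi> n x = 0"
      by metis
    have \<phi>0: "\<phi> n x = 0" if "x \<notin> Q" for n x
    proof (rule \<phi>(5), intro ballI)
      fix y assume "y \<in> K"
      then have "d < dist x y" using that by (auto simp: Q_def)
      moreover have "d / Suc n \<le> d" using d(1) by (simp add: divide_simps)
      ultimately show "d / Suc n < dist x y" by linarith
    qed
    have 0: "(LINT x|lebesgue_on Q. f x * \<phi> n x) = 0" for n
    proof -
      have "(LINT x|lebesgue_on \<Omega>. f x * \<phi> n x) = (LINT x|lebesgue_on Q. f x * \<phi> n x)"
        by (rule integral_lebesgue_on_cong) (use Q \<phi>0 \<Omega> in \<open>auto intro: fmeasurableD[OF lmeasurable_compact]\<close>)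
      moreover have "test_function \<Omega> (\<phi> n)" by (rule test_functionI[OF _ Q]) (use \<phi> \<phi>0 in auto)
      ultimately show ?thesis using zero by simp
    qed
    have fQ: "integrable (lebesgue_on Q) f" using f Q by (auto simp: locally_integrable_def)
    have [measurable]: "\<phi> n \<in> borel_measurable (lebesgue_on Q)" for n
      by (rule continuous_lebesgue_on_measurable[OF smooth_imp_continuous[OF \<phi>(1)]])
    note [measurable] = borel_measurable_integrable[OF fQ]
    have "(\<lambda>n. LINT x|lebesgue_on Q. f x * \<phi> n x) \<longlonglongrightarrow> (LINT x|lebesgue_on Q. f x * indicator K x)"
    proof (rule integral_dominated_convergence[where w="\<lambda>x. \<bar>f x\<bar>"])
      have "K \<in> sets lebesgue" using K(1) by (auto intro: fmeasurableD[OF lmeasurable_compact])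
      then have [measurable]: "(indicator K :: _ \<Rightarrow> real) \<in> borel_measurable (lebesgue_on Q)"
        by (intro measurable_restrict_space1) auto
      show "(\<lambda>x. f x * indicator K x) \<in> borel_measurable (lebesgue_on Q)" by measurable
      show "AE x in lebesgue_on Q. (\<lambda>n. f x * \<phi> n x) \<longlonglongrightarrow> f x * indicator K x"
      proof (intro AE_I2 tendsto_mult tendsto_const)
        fix x
        show "(\<lambda>n. \<phi> n x) \<longlonglongrightarrow> indicator K x"
        proof (cases "x \<in> K")
          case False
          then obtain e where e: "e > 0" "\<And>y. y \<in> K \<Longrightarrow> e \<le> dist x y"
            using separate_point_closed[OF compact_imp_closed[OF K(1)]] by blast
          have "(\<lambda>n. d * inverse (real (Suc n))) \<longlonglongrightarrow> d * 0"
            by (intro tendsto_intros LIMSEQ_inverse_real_of_nat)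
          then have "\<forall>\<^sub>F n in sequentially. d * inverse (real (Suc n)) < e"
            using e(1) by (auto intro: order_tendstoD)
          then have "\<forall>\<^sub>F n in sequentially. \<phi> n x = 0"
          proof eventually_elim
            case (elim n)
            then show ?case using e(2) by (intro \<phi>(5)) (force simp: divide_inverse)
          qed
          then show ?thesis using False by (auto intro: tendsto_eventually)
        qed (simp add: \<phi>)
      qed
      show "AE x in lebesgue_on Q. norm (f x * \<phi> n x) \<le> \<bar>f x\<bar>" for n
        using \<phi>(2,3)[of n] by (intro AE_I2) (auto simp: abs_mult intro: mult_left_le)
    qed (use fQ in auto)
    then have "(LINT x|lebesgue_on Q. f x * indicator K x) = 0" using 0 by (simp add: LIMSEQ_const_iff)
    moreover have "(LINT x|lebesgue_on Q. f x * indicator K x) = (LINT x|lebesgue_on K. f x)"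
      by (rule integral_lebesgue_on_cong) (use Q K KQ in \<open>auto intro: fmeasurableD[OF lmeasurable_compact]\<close>)
    ultimately show ?thesis by simp
  qed
  \<comment> \<open>The sign \<open>s\<close> treats the positive and the negative part at once.\<close>
  have pos: "negligible {x\<in>Q. s * f x > 0}" if Q: "compact Q" "Q \<subseteq> \<Omega>" for Q s
  proof -
    have "integrable (lebesgue_on Q) f" using f Q by (auto simp: locally_integrable_def)
    note [measurable] = borel_measurable_integrable[OF this]
    have "{x \<in> space (lebesgue_on Q). s * f x > 0} \<in> sets (lebesgue_on Q)" by measurable
    then have "{x \<in> Q. s * f x > 0} \<in> sets lebesgue"
      using Q fmeasurableD[OF lmeasurable_compact[OF Q(1)]] by (auto simp: sets_restrict_space_iff)
    then obtain C T where CT: "fsigma C" "negligible T" "C \<union> T = {x \<in> Q. s * f x > 0}" "disjnt C T"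
      by (rule lebesgue_set_almost_fsigma) (rule that; simp add: negligible_iff_null_sets)
    from CT(1) obtain F :: "nat \<Rightarrow> (real^'d) set" where CF: "C = (\<Union>n. F n)" and F: "\<And>n. closed (F n)"
      by (rule fsigma.cases) (rule that; simp)
    have "negligible (F n)" for n
    proof -
      have Fn: "F n \<subseteq> {x \<in> Q. s * f x > 0}" using CF CT by auto
      then have K: "compact (F n)" "F n \<subseteq> \<Omega>" using F Q closed_Int_compact[OF F Q(1), of n]
        by (auto simp: Int_absorb2 subset_iff)
      have int: "integrable (lebesgue_on (F n)) f" using f K by (auto simp: locally_integrable_def)
      have "(LINT x|lebesgue_on (F n). s * f x) = 0" using A[OF K] by simp
      moreover have "AE x in lebesgue_on (F n). 0 \<le> s * f x"
        using Fn by (intro AE_I2) (auto simp: less_imp_le subset_iff)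
      ultimately have "AE x in lebesgue_on (F n). s * f x = 0"
        using int by (subst (asm) integral_nonneg_eq_0_iff_AE) auto
      then have "AE x in lebesgue. x \<in> F n \<longrightarrow> s * f x = 0"
        using F by (subst (asm) AE_restrict_space_iff) auto
      then have "AE x in lebesgue. x \<notin> F n"
        by eventually_elim (use Fn in auto)
      then show ?thesis using F by (subst (asm) AE_iff_null_sets[symmetric]) (auto simp: negligible_iff_null_sets)
    qed
    then have "negligible (\<Union>n. F n)" by (intro negligible_Union_nat) auto
    then show ?thesis using negligible_Un[OF _ CT(2)] CT(3) CF by (metis (no_types))
  qed
  obtain Q :: "nat \<Rightarrow> (real^'d) set" where Q: "\<And>n. compact (Q n)" "\<And>n. Q n \<subseteq> \<Omega>" "\<Omega> = (\<Union>n. Q n)"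
    by (rule open_Union_compact_subsets[OF \<Omega>]) (rule that; force)
  have "negligible (\<Union>n. {x\<in>Q n. 1 * f x > 0} \<union> {x\<in>Q n. (-1) * f x > 0})"
    using pos[OF Q(1,2)] by (intro negligible_Union_nat) (blast intro: negligible_Un)
  moreover have "{x\<in>\<Omega>. f x \<noteq> 0} \<subseteq> (\<Union>n. {x\<in>Q n. 1 * f x > 0} \<union> {x\<in>Q n. (-1) * f x > 0})"
    unfolding Q(3) by force
  ultimately have "negligible {x\<in>\<Omega>. f x \<noteq> 0}" using negligible_subset by blast
  then have "{x\<in>\<Omega>. f x \<noteq> 0} \<in> null_sets lebesgue" by (simp add: negligible_iff_null_sets)
  from AE_not_in[OF this] have "AE x in lebesgue. x \<in> \<Omega> \<longrightarrow> f x = 0"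
    by eventually_elim auto
  then show ?thesis using \<Omega>
    by (subst AE_restrict_space_iff) auto
qed

section \<open>Compactly supported Lipschitz and continuously differentiable functions\<close>

text \<open>
  The integral of \<open>\<psi> (t + x)\<close> over \<open>x\<close> does not depend on \<open>t\<close>; differentiate it under the integral
  sign at \<open>t = 0\<close>. This is integration by parts for Lipschitz functions.
\<close>

lemma
  fixes \<psi> :: "'a::euclidean_space \<Rightarrow> real"
  assumes lip: "\<And>x y. \<bar>\<psi> x - \<psi> y\<bar> \<le> L * norm (x - y)" and supp: "\<And>x. R < norm x \<Longrightarrow> \<psi> x = 0"
    and [measurable]: "g \<in> borel_measurable borel"
    and D: "AE x in lborel. (\<psi> has_derivative (\<lambda>h. g x \<bullet> h)) (at x)"
  shows integrable_derivative_compact_support: "integrable lborel (\<lambda>x. g x \<bullet> h)"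
    and integral_derivative_compact_support: "(LBINT x. g x \<bullet> h) = 0"
proof -
  have cont: "continuous_on UNIV \<psi>"
  proof (rule continuous_on_iff[THEN iffD2], intro ballI allI impI)
    fix x :: 'a and e :: real assume "e > 0"
    have "dist (\<psi> y) (\<psi> x) < e" if "dist y x < e / (\<bar>L\<bar> + 1)" for y
    proof -
      have "\<bar>\<psi> y - \<psi> x\<bar> \<le> \<bar>L\<bar> * norm (y - x)"
        by (rule order_trans[OF lip]) (intro mult_right_mono, auto)
      also have "\<dots> \<le> (\<bar>L\<bar> + 1) * norm (y - x)" by (intro mult_right_mono) auto
      also have "\<dots> < e" using that by (simp add: dist_norm field_simps)
      finally show ?thesis by (simp add: dist_norm)
    qed
    then show "\<exists>d>0. \<forall>y\<in>UNIV. dist y x < d \<longrightarrow> dist (\<psi> y) (\<psi> x) < e"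
      using \<open>e > 0\<close> by (intro exI[of _ "e / (\<bar>L\<bar> + 1)"]) auto
  qed
  have [measurable]: "\<psi> \<in> borel_measurable borel" by (rule borel_measurable_continuous_onI[OF cont])
  have int: "integrable lborel \<psi>"
  proof -
    have "integrable lborel (\<lambda>x. indicator (cball 0 R) x *\<^sub>R \<psi> x)"
      using borel_integrable_compact[OF compact_cball, of 0 R \<psi>] continuous_on_subset[OF cont]
      by (auto simp: set_integrable_def)
    moreover have "(\<lambda>x. indicator (cball 0 R) x *\<^sub>R \<psi> x) = \<psi>"
      using supp by (force simp: indicator_def)
    ultimately show ?thesis by simp
  qed
  let ?F = "\<lambda>t x. \<psi> (t + x)" and ?B = "\<lambda>x. \<bar>L\<bar> * indicator (cball 0 (R + 1)) x"
  have F: "integrable lborel (?F (0 + t))" for t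
    using integrable_translate[OF int, of t] by simp
  have D': "AE x in lborel. ((\<lambda>t. ?F t x) has_derivative (\<lambda>h. g x \<bullet> h)) (at 0)"
    using D
  proof eventually_elim
    case (elim x)
    show ?case
      by (rule has_derivative_compose[of "\<lambda>t. t + x" "\<lambda>h. h" 0 UNIV \<psi>])
         (use elim in \<open>auto intro!: derivative_eq_intros\<close>)
  qed
  have lip': "AE x in lborel. \<bar>?F (0 + t) x - ?F 0 x\<bar> \<le> ?B x * norm t" if "norm t < 1" for t
  proof (intro AE_I2)
    fix x
    show "\<bar>?F (0 + t) x - ?F 0 x\<bar> \<le> ?B x * norm t"
    proof (cases "norm x \<le> R + 1")
      case True
      have "\<bar>\<psi> (t + x) - \<psi> x\<bar> \<le> \<bar>L\<bar> * norm t"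
        by (rule order_trans[OF lip]) (auto intro!: mult_right_mono)
      then show ?thesis using True by simp
    next
      case False
      then have "R < norm x" "R < norm (t + x)"
        using that norm_triangle_ineq2[of x "-t"] by (auto simp: add.commute)
      then show ?thesis using supp by simp
    qed
  qed
  have B: "integrable lborel ?B"
    by (intro integrable_mult_right integrable_real_indicator emeasure_compact_finite) auto
  note * = integrable_parametric_derivative[of 1 lborel ?F 0 "\<lambda>x h. g x \<bullet> h" ?B, OF _ F D' _ lip' B]
    has_derivative_parametric_integral[of 1 lborel ?F 0 "\<lambda>x h. g x \<bullet> h" ?B, OF _ F D' _ lip' B]
  show "integrable lborel (\<lambda>x. g x \<bullet> h)" by (rule *(1)) auto
  have "((\<lambda>t. LBINT x. \<psi> (t + x)) has_derivative (\<lambda>h. LBINT x. g x \<bullet> h)) (at 0)"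
    by (rule *(2)) auto
  moreover have "(\<lambda>t. LBINT x. \<psi> (t + x)) = (\<lambda>t. LBINT x. \<psi> x)"
    by (simp add: integral_translate)
  ultimately have "((\<lambda>t. LBINT x. \<psi> x) has_derivative (\<lambda>h. LBINT x. g x \<bullet> h)) (at 0)"
    by simp
  then have "(\<lambda>h. LBINT x. g x \<bullet> h) = (\<lambda>h. 0)"
    by (rule has_derivative_unique) simp
  then show "(LBINT x. g x \<bullet> h) = 0" by metis
qed

text \<open>
  The gradient is carried along as an argument, so that the notion makes sense in any Euclidean space
  and compares directly with that of Lipschitz test functions below.
\<close>

definition C1_test :: "'a::euclidean_space set \<Rightarrow> ('a \<Rightarrow> real) \<Rightarrow> ('a \<Rightarrow> 'a) \<Rightarrow> bool"
where
  "C1_test \<Omega> \<psi> g \<longleftrightarrow> (\<forall>x. (\<psi> has_derivative (\<lambda>h. g x \<bullet> h)) (at x)) \<and> continuous_on UNIV g \<and>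
     (\<exists>C. compact C \<and> C \<subseteq> \<Omega> \<and> (\<forall>x. x \<notin> C \<longrightarrow> \<psi> x = 0))"

lemma gradient_zero_outside_support:
  fixes \<psi> :: "'a::euclidean_space \<Rightarrow> real"
  assumes D: "(\<psi> has_derivative (\<lambda>h. g x \<bullet> h)) (at x)" and "closed C" "x \<notin> C"
    and supp: "\<And>x. x \<notin> C \<Longrightarrow> \<psi> x = 0"
  shows "g x = 0"
proof -
  have "((\<lambda>x. 0) has_derivative (\<lambda>h. g x \<bullet> h)) (at x)"
    using assms by (intro has_derivative_transform_within_open[OF D, where s="- C"]) auto
  then have "(\<lambda>h. g x \<bullet> h) = (\<lambda>h. 0)" by (rule has_derivative_unique) simp
  then show ?thesis using inner_right_cancel_fun[of "g x" 0] by simp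
qed

lemma C1_testD:
  assumes "C1_test \<Omega> \<psi> g"
  shows "\<And>x. (\<psi> has_derivative (\<lambda>h. g x \<bullet> h)) (at x)" "continuous_on UNIV g"
    "\<exists>C. compact C \<and> C \<subseteq> \<Omega> \<and> (\<forall>x. x \<notin> C \<longrightarrow> \<psi> x = 0 \<and> g x = 0)"
proof -
  show D: "(\<psi> has_derivative (\<lambda>h. g x \<bullet> h)) (at x)" for x
    using assms unfolding C1_test_def by blast
  show "continuous_on UNIV g" using assms unfolding C1_test_def by blast
  obtain C where C: "compact C" "C \<subseteq> \<Omega>" "\<And>x. x \<notin> C \<Longrightarrow> \<psi> x = 0"
    using assms unfolding C1_test_def by blast
  have "g x = 0" if "x \<notin> C" for x
    by (rule gradient_zero_outside_support[where \<psi>=\<psi> and C=C])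
       (use D C that compact_imp_closed in auto)
  with C show "\<exists>C. compact C \<and> C \<subseteq> \<Omega> \<and> (\<forall>x. x \<notin> C \<longrightarrow> \<psi> x = 0 \<and> g x = 0)" by blast
qed

lemma C1_test_bounds:
  fixes \<psi> :: "'a::euclidean_space \<Rightarrow> real"
  assumes "C1_test \<Omega> \<psi> g"
  obtains L R where "L \<ge> 0" "\<And>x. norm (g x) \<le> L" "\<And>x y. \<bar>\<psi> x - \<psi> y\<bar> \<le> L * norm (x - y)"
    "\<And>x. R < norm x \<Longrightarrow> \<psi> x = 0"
proof -
  note T = C1_testD[OF assms]
  obtain C where C: "compact C" "\<And>x. x \<notin> C \<Longrightarrow> \<psi> x = 0" using T(3) by blast
  then obtain R where R: "\<And>x. x \<in> C \<Longrightarrow> norm x \<le> R" 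
    using compact_imp_bounded bounded_iff by metis
  have supp: "\<psi> x = 0" if "R < norm x" for x using C R that by (meson not_less)
  obtain L where L: "L \<ge> 0" "\<And>x h. \<bar>g x \<bullet> h\<bar> \<le> L * norm h" "\<And>x y. \<bar>\<psi> x - \<psi> y\<bar> \<le> L * norm (x - y)"
    using C1_compact_support_bounds[OF T(1) _ supp] continuous_on_inner[OF T(2) continuous_on_const] by metis
  have "norm (g x) \<le> L" for x by (rule norm_le_if_inner_le[OF L(2,1)])
  with L supp that show thesis by metis
qed

lemma C1_test_integral:
  fixes \<psi> :: "'a::euclidean_space \<Rightarrow> real"
  assumes T: "C1_test \<Omega> \<psi> g" and \<Omega>: "\<Omega> \<in> sets lebesgue"
  shows "integrable (lebesgue_on \<Omega>) (\<lambda>x. g x \<bullet> h)" "(LINT x|lebesgue_on \<Omega>. g x \<bullet> h) = 0"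
proof -
  obtain L R where L: "L \<ge> 0" "\<And>x. norm (g x) \<le> L" "\<And>x y. \<bar>\<psi> x - \<psi> y\<bar> \<le> L * norm (x - y)"
    "\<And>x. R < norm x \<Longrightarrow> \<psi> x = 0" by (rule C1_test_bounds[OF T]) (rule that; blast)
  note D = C1_testD[OF T]
  have g0: "g x = 0" if "x \<notin> \<Omega>" for x using D(3) that by blast
  have [measurable]: "g \<in> borel_measurable borel" by (rule borel_measurable_continuous_onI[OF D(2)])
  note * = integrable_derivative_compact_support[OF L(3,4), where g=g and h=h]
    integral_derivative_compact_support[OF L(3,4), where g=g and h=h]
  show "integrable (lebesgue_on \<Omega>) (\<lambda>x. g x \<bullet> h)"
    by (subst integral_lebesgue_on_eq_lborel(2)[of \<Omega> "\<lambda>x. g x \<bullet> h"]) (use \<Omega> g0 * D in auto)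
  show "(LINT x|lebesgue_on \<Omega>. g x \<bullet> h) = 0"
    by (subst integral_lebesgue_on_eq_lborel(1)[of \<Omega> "\<lambda>x. g x \<bullet> h"]) (use \<Omega> g0 * D in auto)
qed

lemma grad_inner: "(f has_derivative D) (at x) \<Longrightarrow> grad f x \<bullet> h = D h"
proof -
  assume D: "(f has_derivative D) (at x)"
  have lin: "linear D" by (rule has_derivative_linear[OF D])
  have "D h = D (\<Sum>i\<in>UNIV. h $ i *s axis i 1)" by (simp only: basis_expansion)
  also have "\<dots> = (\<Sum>i\<in>UNIV. h $ i * D (axis i 1))"
    by (simp add: linear_sum[OF lin] linear_cmul[OF lin] scalar_mult_eq_scaleR)
  finally show ?thesis
    using frechet_derivative_at[OF D] by (simp add: grad_def inner_vec_def mult.commute)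
qed

lemma smooth_has_grad: "smooth \<phi> \<Longrightarrow> (\<phi> has_derivative (\<lambda>h. grad \<phi> x \<bullet> h)) (at x)"
proof -
  assume "smooth \<phi>"
  then have "Ck (Suc 0) \<phi>" by blast
  then have "(\<phi> has_derivative frechet_derivative \<phi> (at x)) (at x)"
    by (simp flip: frechet_derivative_works)
  then show ?thesis by (simp add: grad_inner)
qed

lemma continuous_on_grad: "smooth \<phi> \<Longrightarrow> continuous_on UNIV (grad \<phi>)"
proof -
  assume "smooth \<phi>"
  then have "Ck (Suc 0) \<phi>" by blast
  then have "Ck 0 (\<lambda>x. frechet_derivative \<phi> (at x) v)" for v by simp
  then have "continuous_on UNIV (\<lambda>x. frechet_derivative \<phi> (at x) v)" for v by (simp only: Ck_0)
  then show ?thesis unfolding grad_def by (intro continuous_on_vec_lambda) auto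
qed

lemma test_function_C1_test: "test_function \<Omega> \<phi> \<Longrightarrow> C1_test \<Omega> \<phi> (grad \<phi>)"
  unfolding C1_test_def using test_functionD smooth_has_grad continuous_on_grad by blast

text \<open>
  A test function cuts off a function that is \<open>C\<^sup>1\<close> on the domain only: the product is \<open>C\<^sup>1\<close> on the
  domain and vanishes off the support, and these two open sets cover the space.
\<close>

lemma C1_test_times:
  fixes v :: "'a::euclidean_space \<Rightarrow> real"
  assumes \<Omega>: "open \<Omega>" and v: "\<And>x. x \<in> \<Omega> \<Longrightarrow> (v has_derivative (\<lambda>h. w x \<bullet> h)) (at x)"
    and w: "continuous_on \<Omega> w" and T: "C1_test \<Omega> \<phi> g"
  shows "C1_test \<Omega> (\<lambda>x. if x \<in> \<Omega> then \<phi> x * v x else 0) (\<lambda>x. if x \<in> \<Omega> then \<phi> x *\<^sub>R w x + v x *\<^sub>R g x else 0)"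
proof -
  note D = C1_testD[OF T]
  obtain C where C: "compact C" "C \<subseteq> \<Omega>" "\<And>x. x \<notin> C \<Longrightarrow> \<phi> x = 0" and g0: "\<And>x. x \<notin> C \<Longrightarrow> g x = 0"
    using D(3) by blast
  let ?\<psi> = "\<lambda>x. if x \<in> \<Omega> then \<phi> x * v x else 0"
  let ?g = "\<lambda>x. if x \<in> \<Omega> then \<phi> x *\<^sub>R w x + v x *\<^sub>R g x else 0"
  have oC: "open (- C)" using C(1) by (simp add: compact_imp_closed open_Compl)
  have "(?\<psi> has_derivative (\<lambda>h. ?g x \<bullet> h)) (at x)" for x
  proof (cases "x \<in> \<Omega>")
    case True
    have "((\<lambda>x. \<phi> x * v x) has_derivative (\<lambda>h. ?g x \<bullet> h)) (at x)"
      using has_derivative_mult[OF D(1)[of x] v[OF True]] True by (simp add: inner_add_left algebra_simps)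
    then show ?thesis
      by (rule has_derivative_transform_within_open[where s=\<Omega>]) (use \<Omega> True in auto)
  next
    case False
    then have "x \<in> - C" using C by blast
    have "((\<lambda>x. 0) has_derivative (\<lambda>h. ?g x \<bullet> h)) (at x)" using False by simp
    then show ?thesis
      by (rule has_derivative_transform_within_open[where s="- C"]) (use oC \<open>x \<in> - C\<close> C in auto)
  qed
  moreover have "continuous_on UNIV ?g"
  proof -
    have vc: "continuous_on \<Omega> v"
      by (intro continuous_at_imp_continuous_on ballI has_derivative_continuous[OF v])
    have pc: "continuous_on \<Omega> \<phi>"
      by (intro continuous_at_imp_continuous_on ballI has_derivative_continuous[OF D(1)])
    have "continuous_on \<Omega> (\<lambda>x. \<phi> x *\<^sub>R w x + v x *\<^sub>R g x)"
      by (intro continuous_intros pc vc w continuous_on_subset[OF D(2)]) auto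
    then have 1: "continuous_on \<Omega> ?g" by (rule continuous_on_eq) simp
    have 2: "continuous_on (- C) ?g"
      by (rule continuous_on_eq[OF continuous_on_const[of _ 0]]) (use C g0 in auto)
    have "UNIV = \<Omega> \<union> - C" using C by blast
    then show ?thesis using continuous_on_open_Un[OF \<Omega> oC 1 2] by simp
  qed
  ultimately show ?thesis unfolding C1_test_def using C by auto
qed

section \<open>Classical gradients are weak gradients\<close>

lemma borel_measurable_lebesgue_on_AE:
  fixes f g :: "'a::euclidean_space \<Rightarrow> 'b::euclidean_space"
  assumes S: "S \<in> sets lebesgue" and f: "f \<in> borel_measurable (lebesgue_on S)"
    and eq: "AE x in lebesgue_on S. f x = g x"
  shows "g \<in> borel_measurable (lebesgue_on S)"
proof -
  have "AE x in lebesgue. x \<in> S \<longrightarrow> f x = g x"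
    using eq S by (subst (asm) AE_restrict_space_iff) auto
  then have "AE x in lebesgue. indicator S x *\<^sub>R f x = indicator S x *\<^sub>R g x"
    by eventually_elim (auto simp: indicator_def)
  moreover have "(\<lambda>x. indicator S x *\<^sub>R f x) \<in> borel_measurable lebesgue"
    using f S by (simp add: borel_measurable_restrict_space_iff)
  ultimately have "(\<lambda>x. indicator S x *\<^sub>R g x) \<in> borel_measurable lebesgue"
    by (rule borel_measurable_AE[rotated])
  then show ?thesis using S by (simp add: borel_measurable_restrict_space_iff)
qed

lemma locally_integrable_AE_continuous:
  fixes f g :: "real^'d \<Rightarrow> 'b::euclidean_space"
  assumes \<Omega>: "open \<Omega>" and g: "continuous_on \<Omega> g" and eq: "AE x in lebesgue_on \<Omega>. g x = f x"
  shows "locally_integrable \<Omega> f"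
  unfolding locally_integrable_def
proof (intro allI impI, elim conjE)
  fix K assume K: "compact K" "K \<subseteq> \<Omega>"
  have Kl: "K \<in> sets lebesgue" using K by (auto intro: fmeasurableD[OF lmeasurable_compact])
  have gK: "integrable (lebesgue_on K) g"
    using borel_integrable_compact[OF K(1), of g] continuous_on_subset[OF g K(2)] Kl
    by (auto simp: set_integrable_def integrable_restrict_space integrable_completion
         intro: borel_measurable_continuous_on_indicator borel_compact[OF K(1)])
  have "AE x in lebesgue. x \<in> \<Omega> \<longrightarrow> g x = f x"
    using eq \<Omega> by (subst (asm) AE_restrict_space_iff) auto
  then have AEK: "AE x in lebesgue_on K. g x = f x"
    using K Kl by (subst AE_restrict_space_iff) (auto elim!: eventually_mono)
  have "f \<in> borel_measurable (lebesgue_on K)"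
    by (rule borel_measurable_lebesgue_on_AE[OF Kl borel_measurable_integrable[OF gK] AEK])
  then show "integrable (lebesgue_on K) f"
    using gK AEK by (subst integrable_cong_AE[symmetric, of g]) auto
qed

text \<open>
  Integration by parts against a test function shows that the classical gradient of \<open>v\<close> is a weak
  gradient of \<open>u\<close>. The operator \<open>wgrad\<close> picks some weak gradient; by the fundamental lemma any two agree
  almost everywhere.
\<close>

lemma
  fixes u v :: "real^'d \<Rightarrow> real^'m" and w :: "real^'d \<Rightarrow> 'm \<Rightarrow> real^'d"
  assumes \<Omega>: "open \<Omega>" and eq: "AE x in lebesgue_on \<Omega>. v x = u x"
    and v: "\<And>x a. x \<in> \<Omega> \<Longrightarrow> ((\<lambda>x. v x $ a) has_derivative (\<lambda>h. w x a \<bullet> h)) (at x)"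
    and w: "\<And>a. continuous_on \<Omega> (\<lambda>x. w x a)"
  shows classical_imp_weak_gradient: "has_weak_gradient \<Omega> u (\<lambda>x. \<chi> a. w x a)"
    and wgrad_classical: "AE x in lebesgue_on \<Omega>. wgrad \<Omega> u x = (\<chi> a. w x a)"
proof -
  let ?P = "\<lambda>x. \<chi> a. w x a"
  have vc: "continuous_on \<Omega> v"
  proof -
    have "continuous_on \<Omega> (\<lambda>x. \<chi> a. v x $ a)"
      by (intro continuous_on_vec_lambda continuous_at_imp_continuous_on ballI has_derivative_continuous[OF v])
    then show ?thesis by simp
  qed
  have Pc: "continuous_on \<Omega> ?P" by (intro continuous_on_vec_lambda w)
  have lu: "locally_integrable \<Omega> u" by (rule locally_integrable_AE_continuous[OF \<Omega> vc eq])
  have lP: "locally_integrable \<Omega> ?P" by (rule locally_integrable_AE_continuous[OF \<Omega> Pc]) simp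
  have cut: "integrable (lebesgue_on \<Omega>) (\<lambda>x. f x * \<phi> x)"
    if f: "locally_integrable \<Omega> f" and \<phi>: "continuous_on UNIV \<phi>" "compact C" "C \<subseteq> \<Omega>" "\<And>x. x \<notin> C \<Longrightarrow> \<phi> x = 0"
    for f :: "real^'d \<Rightarrow> real" and \<phi> C
  proof -
    have fC: "integrable (lebesgue_on C) f" using f \<phi> by (auto simp: locally_integrable_def)
    obtain c where c: "\<And>x. \<bar>\<phi> x\<bar> \<le> c"
      using continuous_compact_support_bounded[OF \<phi>(1,2,4)] by blast
    have "integrable (lebesgue_on C) (\<lambda>x. f x * \<phi> x)"
      using integrable_inner_bounded(1)[OF fC continuous_lebesgue_on_measurable[OF \<phi>(1)], of c] c by simp
    then show ?thesis
      by (subst integral_lebesgue_on_cong(2)[of \<Omega> C])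
         (use \<Omega> \<phi> in \<open>auto intro: fmeasurableD[OF lmeasurable_compact]\<close>)
  qed
  have comp: "locally_integrable \<Omega> (\<lambda>x. f x $ a)" if "locally_integrable \<Omega> f" for f :: "real^'d \<Rightarrow> 'b::euclidean_space^'n" and a
    using that unfolding locally_integrable_def
    by (auto intro: integrable_bounded_linear[OF bounded_linear_vec_nth])
  have ibp: "(LINT x|lebesgue_on \<Omega>. u x $ a * grad \<phi> x $ k) = - (LINT x|lebesgue_on \<Omega>. ?P x $ a $ k * \<phi> x)"
    if \<phi>: "test_function \<Omega> \<phi>" for \<phi> a k
  proof -
    note sm = test_functionD(1)[OF \<phi>]
    note T = test_function_C1_test[OF \<phi>]
    obtain C where C: "compact C" "C \<subseteq> \<Omega>" "\<And>x. x \<notin> C \<Longrightarrow> \<phi> x = 0" and g0: "\<And>x. x \<notin> C \<Longrightarrow> grad \<phi> x = 0"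
      using C1_testD(3)[OF T] by blast
    have i1: "integrable (lebesgue_on \<Omega>) (\<lambda>x. u x $ a * grad \<phi> x $ k)"
      by (rule cut[OF comp[OF lu] _ C(1,2)]) (use g0 continuous_on_grad[OF sm] in \<open>auto intro!: continuous_on_component\<close>)
    have i2: "integrable (lebesgue_on \<Omega>) (\<lambda>x. ?P x $ a $ k * \<phi> x)"
      by (rule cut[OF comp[OF comp[OF lP]] _ C(1,2)]) (use C smooth_imp_continuous[OF sm] in auto)
    have "(LINT x|lebesgue_on \<Omega>. (if x \<in> \<Omega> then \<phi> x *\<^sub>R w x a + v x $ a *\<^sub>R grad \<phi> x else 0) \<bullet> axis k 1) = 0"
      by (rule C1_test_integral(2)[OF C1_test_times[OF \<Omega> v w T]]) (use \<Omega> in auto)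
    also have "(LINT x|lebesgue_on \<Omega>. (if x \<in> \<Omega> then \<phi> x *\<^sub>R w x a + v x $ a *\<^sub>R grad \<phi> x else 0) \<bullet> axis k 1)
       = (LINT x|lebesgue_on \<Omega>. ?P x $ a $ k * \<phi> x + u x $ a * grad \<phi> x $ k)"
    proof (rule integral_cong_AE)
      show "(\<lambda>x. ?P x $ a $ k * \<phi> x + u x $ a * grad \<phi> x $ k) \<in> borel_measurable (lebesgue_on \<Omega>)"
        using i1 i2 by (intro borel_measurable_integrable Bochner_Integration.integrable_add)
      show "(\<lambda>x. (if x \<in> \<Omega> then \<phi> x *\<^sub>R w x a + v x $ a *\<^sub>R grad \<phi> x else 0) \<bullet> axis k 1) \<in> borel_measurable (lebesgue_on \<Omega>)"
        by (rule borel_measurable_integrable[OF C1_test_integral(1)[OF C1_test_times[OF \<Omega> v w T]]]) (use \<Omega> in auto)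
      have "AE x in lebesgue_on \<Omega>. x \<in> \<Omega>" by (intro AE_I2) auto
      with eq show "AE x in lebesgue_on \<Omega>. (if x \<in> \<Omega> then \<phi> x *\<^sub>R w x a + v x $ a *\<^sub>R grad \<phi> x else 0) \<bullet> axis k 1
          = ?P x $ a $ k * \<phi> x + u x $ a * grad \<phi> x $ k"
        by eventually_elim (simp add: inner_axis algebra_simps)
    qed
    also have "\<dots> = (LINT x|lebesgue_on \<Omega>. ?P x $ a $ k * \<phi> x) + (LINT x|lebesgue_on \<Omega>. u x $ a * grad \<phi> x $ k)"
      by (rule Bochner_Integration.integral_add[OF i2 i1])
    finally show ?thesis by simp
  qed
  show P: "has_weak_gradient \<Omega> u ?P"
    unfolding has_weak_gradient_def using lu lP ibp by blast
  have W: "has_weak_gradient \<Omega> u (wgrad \<Omega> u)" unfolding wgrad_def by (rule someI[of "has_weak_gradient \<Omega> u"]) (rule P)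
  have lW: "locally_integrable \<Omega> (wgrad \<Omega> u)" using W by (simp add: has_weak_gradient_def)
  have "AE x in lebesgue_on \<Omega>. wgrad \<Omega> u x $ a $ k - ?P x $ a $ k = 0" for a k
  proof (rule fundamental_lemma[OF \<Omega>])
    show "locally_integrable \<Omega> (\<lambda>x. wgrad \<Omega> u x $ a $ k - ?P x $ a $ k)"
      using comp[OF comp[OF lW], of a k] comp[OF comp[OF lP], of a k] unfolding locally_integrable_def by auto
    fix \<phi> assume \<phi>: "test_function \<Omega> \<phi>"
    obtain C where C: "compact C" "C \<subseteq> \<Omega>" "\<And>x. x \<notin> C \<Longrightarrow> \<phi> x = 0" using test_functionD(2)[OF \<phi>] by blast
    note sm = test_functionD(1)[OF \<phi>]
    have i2: "integrable (lebesgue_on \<Omega>) (\<lambda>x. ?P x $ a $ k * \<phi> x)"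
      by (rule cut[OF comp[OF comp[OF lP]] _ C(1,2)]) (use C smooth_imp_continuous[OF sm] in auto)
    have i3: "integrable (lebesgue_on \<Omega>) (\<lambda>x. wgrad \<Omega> u x $ a $ k * \<phi> x)"
      by (rule cut[OF comp[OF comp[OF lW]] _ C(1,2)]) (use C smooth_imp_continuous[OF sm] in auto)
    have "(LINT x|lebesgue_on \<Omega>. wgrad \<Omega> u x $ a $ k * \<phi> x) = (LINT x|lebesgue_on \<Omega>. ?P x $ a $ k * \<phi> x)"
    proof -
      have "(LINT x|lebesgue_on \<Omega>. u x $ a * grad \<phi> x $ k) = - (LINT x|lebesgue_on \<Omega>. wgrad \<Omega> u x $ a $ k * \<phi> x)"
        using W \<phi> unfolding has_weak_gradient_def by blast
      then show ?thesis using ibp[OF \<phi>, of a k] by simp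
    qed
    then show "(LINT x|lebesgue_on \<Omega>. (wgrad \<Omega> u x $ a $ k - ?P x $ a $ k) * \<phi> x) = 0"
      unfolding left_diff_distrib using Bochner_Integration.integral_diff[OF i3 i2] by simp
  qed
  then have "AE x in lebesgue_on \<Omega>. \<forall>a k. wgrad \<Omega> u x $ a $ k - ?P x $ a $ k = 0"
    by (simp add: AE_all_countable)
  then show "AE x in lebesgue_on \<Omega>. wgrad \<Omega> u x = ?P x"
    by eventually_elim (simp add: vec_eq_iff)
qed

section \<open>Distributional divergences tested with less smooth functions\<close>

lemma uniformly_continuous_compact_support:
  fixes g :: "'a::euclidean_space \<Rightarrow> 'b::real_normed_vector"
  assumes g: "continuous_on UNIV g" and supp: "\<And>x. R < norm x \<Longrightarrow> g x = 0" and "e > 0"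
  obtains d where "d > 0" "\<And>x y. norm (x - y) < d \<Longrightarrow> norm (g x - g y) < e"
proof -
  have "uniformly_continuous_on (cball 0 (R + 1)) g"
    by (intro compact_uniformly_continuous continuous_on_subset[OF g]) auto
  then obtain d where d: "d > 0" "\<And>x y. x \<in> cball 0 (R + 1) \<Longrightarrow> y \<in> cball 0 (R + 1) \<Longrightarrow> dist y x < d \<Longrightarrow> dist (g y) (g x) < e"
    using \<open>e > 0\<close> unfolding uniformly_continuous_on_def by metis
  show thesis
  proof
    show "min d 1 > 0" using d by simp
    fix x y :: 'a assume xy: "norm (x - y) < min d 1"
    show "norm (g x - g y) < e"
    proof (cases "x \<in> cball 0 (R + 1) \<and> y \<in> cball 0 (R + 1)")
      case True
      then show ?thesis using d(2)[of y x] xy by (auto simp: dist_norm)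
    next
      case False
      have "norm (x - y) < 1" using xy by simp
      then have "R < norm x" "R < norm y"
        using False norm_triangle_ineq2[of x y] norm_triangle_ineq2[of y x] by (auto simp: norm_minus_commute)
      then show ?thesis using supp \<open>e > 0\<close> by simp
    qed
  qed
qed

lemma integrable_continuous_compact_support:
  fixes \<psi> :: "'a::euclidean_space \<Rightarrow> real"
  assumes "continuous_on UNIV \<psi>" "compact C" "\<And>x. x \<notin> C \<Longrightarrow> \<psi> x = 0"
  shows "integrable lborel \<psi>"
proof -
  have "integrable lborel (\<lambda>x. indicator C x *\<^sub>R \<psi> x)"
    using borel_integrable_compact[OF assms(2), of \<psi>] continuous_on_subset[OF assms(1)]
    by (auto simp: set_integrable_def)
  moreover have "(\<lambda>x. indicator C x *\<^sub>R \<psi> x) = \<psi>"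
    using assms by (force simp: indicator_def)
  ultimately show ?thesis by simp
qed

lemma lipschitz_imp_continuous:
  fixes \<psi> :: "'a::real_normed_vector \<Rightarrow> real"
  assumes "\<And>x y. \<bar>\<psi> x - \<psi> y\<bar> \<le> L * norm (x - y)" "L \<ge> 0"
  shows "continuous_on UNIV \<psi>"
proof -
  have "L-lipschitz_on UNIV \<psi>" using assms by (auto simp: lipschitz_on_def dist_norm)
  then show ?thesis by (rule lipschitz_on_continuous_on)
qed

lemma test_function_conv:
  fixes \<psi> :: "real^'d \<Rightarrow> real"
  assumes \<rho>: "mollifier \<delta> \<rho>" and int: "integrable lborel \<psi>"
    and C: "compact C" "\<And>x. x \<notin> C \<Longrightarrow> \<psi> x = 0" and sub: "{x. \<exists>y\<in>C. dist x y \<le> \<delta>} \<subseteq> \<Omega>"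
  shows "test_function \<Omega> (conv \<rho> \<psi>)"
proof (rule test_functionI[OF _ compact_cball_nbhd[OF C(1)] sub])
  show "smooth (conv \<rho> \<psi>)" using smooth_conv[OF \<rho> int] by blast
  fix x assume x: "x \<notin> {x. \<exists>y\<in>C. dist x y \<le> \<delta>}"
  have "\<bar>conv \<rho> \<psi> x - 0\<bar> \<le> 0"
  proof (rule conv_mollifier_close[OF \<rho> int])
    fix y assume "norm (y - x) < \<delta>"
    then have "y \<notin> C" using x by (force simp: dist_norm norm_minus_commute)
    then show "\<bar>\<psi> y - 0\<bar> \<le> 0" using C by simp
  qed
  then show "conv \<rho> \<psi> x = 0" by simp
qed

text \<open>
  One construction serves two purposes: the last clause transfers any local comparison of the
  difference quotients of \<open>\<psi>\<close> with a linear map to the gradient of the approximation. With the zero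
  map it bounds the gradient by the Lipschitz constant, with the gradient of \<open>\<psi>\<close> it yields
  convergence in \<open>C\<^sup>1\<close>.
\<close>

lemma mollified_test_function:
  fixes \<psi> :: "real^'d \<Rightarrow> real"
  assumes \<Omega>: "open \<Omega>" and lip: "\<And>x y. \<bar>\<psi> x - \<psi> y\<bar> \<le> L * norm (x - y)" "L \<ge> 0"
    and C: "compact C" "C \<subseteq> \<Omega>" "\<And>x. x \<notin> C \<Longrightarrow> \<psi> x = 0" and "e > 0" "d > 0"
  shows "\<exists>\<phi>. test_function \<Omega> \<phi> \<and> (\<forall>x. \<bar>\<phi> x - \<psi> x\<bar> \<le> e) \<and>
    (\<forall>x l K. linear l \<longrightarrow> (\<forall>y k. norm (y - x) < d \<longrightarrow> norm k < d \<longrightarrow> \<bar>\<psi> (k + y) - \<psi> y - l k\<bar> \<le> K * norm k) \<longrightarrow>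
       (\<forall>h. \<bar>grad \<phi> x \<bullet> h - l h\<bar> \<le> K * norm h))"
proof -
  have cont: "continuous_on UNIV \<psi>" by (rule lipschitz_imp_continuous[OF lip])
  have int: "integrable lborel \<psi>" by (rule integrable_continuous_compact_support[OF cont C(1,3)])
  obtain \<delta>0 where \<delta>0: "\<delta>0 > 0" "{x. \<exists>y\<in>C. dist x y \<le> \<delta>0} \<subseteq> \<Omega>"
    using compact_open_nbhd[OF C(1) \<Omega> C(2)] .
  define \<delta> where "\<delta> = Min {\<delta>0, e / (L + 1), d}"
  have \<delta>: "\<delta> > 0" "\<delta> \<le> \<delta>0" "L * \<delta> \<le> e" "\<delta> \<le> d"
  proof -
    show "\<delta> > 0" using \<delta>0 lip(2) \<open>e > 0\<close> \<open>d > 0\<close> by (auto simp: \<delta>_def)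
    show "\<delta> \<le> \<delta>0" "\<delta> \<le> d" unfolding \<delta>_def by (rule Min_le; simp)+
    have "L * \<delta> \<le> L * (e / (L + 1))" by (intro mult_left_mono lip) (simp add: \<delta>_def)
    also have "\<dots> \<le> e" using lip(2) \<open>e > 0\<close> by (simp add: field_simps)
    finally show "L * \<delta> \<le> e" .
  qed
  obtain \<rho> :: "real^'d \<Rightarrow> real" where \<rho>: "mollifier \<delta> \<rho>" using mollifier_exists[OF \<delta>(1)] by blast
  have T: "test_function \<Omega> (conv \<rho> \<psi>)"
    by (rule test_function_conv[OF \<rho> int C(1,3)]) (use \<delta>0(2) \<delta>(2) in force)+
  show ?thesis
  proof (intro exI[of _ "conv \<rho> \<psi>"] conjI allI impI)
    show "test_function \<Omega> (conv \<rho> \<psi>)" by (rule T)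
    show "\<bar>conv \<rho> \<psi> x - \<psi> x\<bar> \<le> e" for x
    proof (rule conv_mollifier_close[OF \<rho> int])
      fix y assume y: "norm (y - x) < \<delta>"
      have "\<bar>\<psi> y - \<psi> x\<bar> \<le> L * norm (y - x)" by (rule lip)
      also have "\<dots> \<le> L * \<delta>" using y lip(2) by (intro mult_left_mono) auto
      finally show "\<bar>\<psi> y - \<psi> x\<bar> \<le> e" using \<delta>(3) by simp
    qed
    fix x h :: "real^'d" and l K
    assume l: "linear l" and near: "\<forall>y k. norm (y - x) < d \<longrightarrow> norm k < d \<longrightarrow> \<bar>\<psi> (k + y) - \<psi> y - l k\<bar> \<le> K * norm k"
    show "\<bar>grad (conv \<rho> \<psi>) x \<bullet> h - l h\<bar> \<le> K * norm h"
      by (rule conv_derivative_close[OF \<rho> int l \<open>d > 0\<close> _ smooth_has_grad[OF test_functionD(1)[OF T]]])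
         (use near \<delta>(4) in auto)
  qed
qed

lemma lipschitz_test_approx:
  fixes \<psi> :: "real^'d \<Rightarrow> real"
  assumes \<Omega>: "open \<Omega>" and lip: "\<And>x y. \<bar>\<psi> x - \<psi> y\<bar> \<le> L * norm (x - y)" "L \<ge> 0"
    and C: "compact C" "C \<subseteq> \<Omega>" "\<And>x. x \<notin> C \<Longrightarrow> \<psi> x = 0" and "e > 0"
  shows "\<exists>\<phi>. test_function \<Omega> \<phi> \<and> (\<forall>x. \<bar>\<phi> x - \<psi> x\<bar> \<le> e) \<and> (\<forall>x. norm (grad \<phi> x) \<le> L)"
proof -
  obtain \<phi> where \<phi>: "test_function \<Omega> \<phi>" "\<forall>x. \<bar>\<phi> x - \<psi> x\<bar> \<le> e" and
    gr: "\<forall>x l K. linear l \<longrightarrow> (\<forall>y k. norm (y - x) < 1 \<longrightarrow> norm k < 1 \<longrightarrow> \<bar>\<psi> (k + y) - \<psi> y - l k\<bar> \<le> K * norm k) \<longrightarrow>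
       (\<forall>h. \<bar>grad \<phi> x \<bullet> h - l h\<bar> \<le> K * norm h)"
    using mollified_test_function[OF \<Omega> lip C \<open>e > 0\<close> zero_less_one] by auto
  have "norm (grad \<phi> x) \<le> L" for x
  proof (rule norm_le_if_inner_le[OF _ lip(2)])
    fix h
    have "\<bar>\<psi> (k + y) - \<psi> y - 0\<bar> \<le> L * norm k" for y k using lip(1)[of "k + y" y] by simp
    then show "\<bar>grad \<phi> x \<bullet> h\<bar> \<le> L * norm h"
      using gr[rule_format, of "\<lambda>h. 0" x L h] by (simp add: linear_zero)
  qed
  with \<phi> show ?thesis by blast
qed

lemma C1_test_approx:
  fixes \<psi> :: "real^'d \<Rightarrow> real"
  assumes \<Omega>: "open \<Omega>" and T: "C1_test \<Omega> \<psi> g" and "e > 0"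
  shows "\<exists>\<phi>. test_function \<Omega> \<phi> \<and> (\<forall>x. \<bar>\<phi> x - \<psi> x\<bar> \<le> e) \<and> (\<forall>x. norm (grad \<phi> x - g x) \<le> e)"
proof -
  note D = C1_testD[OF T]
  obtain C where C: "compact C" "C \<subseteq> \<Omega>" "\<And>x. x \<notin> C \<Longrightarrow> \<psi> x = 0" and g0: "\<And>x. x \<notin> C \<Longrightarrow> g x = 0"
    using D(3) by blast
  obtain L R where L: "L \<ge> 0" "\<And>x. norm (g x) \<le> L" "\<And>x y. \<bar>\<psi> x - \<psi> y\<bar> \<le> L * norm (x - y)"
    "\<And>x. R < norm x \<Longrightarrow> \<psi> x = 0" by (rule C1_test_bounds[OF T]) (rule that; blast)
  obtain R' where R': "\<And>x. x \<in> C \<Longrightarrow> norm x \<le> R'" 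
    using compact_imp_bounded[OF C(1)] bounded_iff by metis
  have "g x = 0" if "R' < norm x" for x using g0[of x] R'[of x] that by auto
  then obtain d where d: "d > 0" "\<And>x y. norm (x - y) < d \<Longrightarrow> norm (g x - g y) < e"
    using uniformly_continuous_compact_support[where g=g and R=R' and e=e, OF D(2)] \<open>e > 0\<close> by metis
  have near: "\<bar>\<psi> (k + y) - \<psi> y - g x \<bullet> k\<bar> \<le> e * norm k" if y: "norm (y - x) < d / 2" and k: "norm k < d / 2" for x y k
  proof -
    have "norm ((\<psi> (k + y) - g x \<bullet> (k + y)) - (\<psi> y - g x \<bullet> y)) \<le> e * norm (k + y - y)"
    proof (rule differentiable_bound[where S="ball x d" and f'="\<lambda>z k. g z \<bullet> k - g x \<bullet> k"])
      show "((\<lambda>z. \<psi> z - g x \<bullet> z) has_derivative (\<lambda>k. g z \<bullet> k - g x \<bullet> k)) (at z within ball x d)" for z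
        by (auto intro!: derivative_eq_intros has_derivative_at_withinI[OF D(1)])
      show "onorm (\<lambda>k. g z \<bullet> k - g x \<bullet> k) \<le> e" if "z \<in> ball x d" for z
      proof (rule onorm_le)
        fix k
        have "norm (g z \<bullet> k - g x \<bullet> k) \<le> norm (g z - g x) * norm k"
          using Cauchy_Schwarz_ineq2[of "g z - g x" k] by (simp add: inner_diff_left)
        also have "\<dots> \<le> e * norm k"
          using d(2)[of z x] that by (intro mult_right_mono) (auto simp: dist_norm norm_minus_commute)
        finally show "norm (g z \<bullet> k - g x \<bullet> k) \<le> e * norm k" .
      qed
      have "norm (x - y) < d / 2" using y by (simp add: norm_minus_commute)
      moreover have "norm (x - (k + y)) \<le> norm (x - y) + norm k"
        using norm_triangle_ineq4[of "x - y" k] by (simp add: algebra_simps)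
      ultimately show "k + y \<in> ball x d" "y \<in> ball x d" using k d(1) by (auto simp: dist_norm)
    qed auto
    then show ?thesis by (simp add: inner_add_right algebra_simps)
  qed
  have "d / 2 > 0" using d(1) by simp
  from mollified_test_function[OF \<Omega> L(3,1) C \<open>e > 0\<close> this]
  obtain \<phi> where \<phi>: "test_function \<Omega> \<phi>" "\<forall>x. \<bar>\<phi> x - \<psi> x\<bar> \<le> e" and
    gr: "\<forall>x l K. linear l \<longrightarrow> (\<forall>y k. norm (y - x) < d / 2 \<longrightarrow> norm k < d / 2 \<longrightarrow> \<bar>\<psi> (k + y) - \<psi> y - l k\<bar> \<le> K * norm k) \<longrightarrow>
       (\<forall>h. \<bar>grad \<phi> x \<bullet> h - l h\<bar> \<le> K * norm h)" by auto
  have "norm (grad \<phi> x - g x) \<le> e" for x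
  proof (rule norm_le_if_inner_le)
    show "\<bar>(grad \<phi> x - g x) \<bullet> h\<bar> \<le> e * norm h" for h
      unfolding inner_diff_left
      by (rule gr[rule_format, of "\<lambda>h. g x \<bullet> h"])
         (use near bounded_linear.linear[OF bounded_linear_inner_right] in auto)
  qed (use \<open>e > 0\<close> in simp)
  with \<phi> show ?thesis by blast
qed

text \<open>
  Test functions approximate \<open>\<psi>\<close> in \<open>C\<^sup>1\<close>, uniformly, which is enough for an integrable flux \<open>j\<close>.
\<close>

lemma distr_div_C1_test:
  fixes j :: "real^'d \<Rightarrow> real^'d" and r :: "real^'d \<Rightarrow> real"
  assumes \<Omega>: "open \<Omega>" and j: "integrable (lebesgue_on \<Omega>) j" and r: "integrable (lebesgue_on \<Omega>) r"
    and div: "\<And>\<phi>. test_function \<Omega> \<phi> \<Longrightarrow> - (LINT x|lebesgue_on \<Omega>. j x \<bullet> grad \<phi> x) = (LINT x|lebesgue_on \<Omega>. \<phi> x * r x)"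
    and T: "C1_test \<Omega> \<psi> g"
  shows "- (LINT x|lebesgue_on \<Omega>. j x \<bullet> g x) = (LINT x|lebesgue_on \<Omega>. \<psi> x * r x)"
    and "integrable (lebesgue_on \<Omega>) (\<lambda>x. j x \<bullet> g x)" "integrable (lebesgue_on \<Omega>) (\<lambda>x. \<psi> x * r x)"
proof -
  have int: "integrable (lebesgue_on \<Omega>) (\<lambda>x. j x \<bullet> g x) \<and> integrable (lebesgue_on \<Omega>) (\<lambda>x. \<psi> x * r x)"
    if T: "C1_test \<Omega> \<psi> g" for \<psi> g
  proof -
    note D = C1_testD[OF T]
    obtain L R where L: "L \<ge> 0" "\<And>x. norm (g x) \<le> L" "\<And>x y. \<bar>\<psi> x - \<psi> y\<bar> \<le> L * norm (x - y)"
      "\<And>x. R < norm x \<Longrightarrow> \<psi> x = 0" by (rule C1_test_bounds[OF T]) (rule that; blast)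
    have \<psi>c: "continuous_on UNIV \<psi>" by (rule lipschitz_imp_continuous[OF L(3,1)])
    obtain c where c: "\<And>x. \<bar>\<psi> x\<bar> \<le> c"
      using continuous_compact_support_bounded[OF \<psi>c] D(3) by metis
    show ?thesis
      using integrable_inner_bounded(1)[OF j continuous_lebesgue_on_measurable[OF D(2)], of L]
        integrable_inner_bounded(2)[OF r continuous_lebesgue_on_measurable[OF \<psi>c], of c] L(2) c by simp
  qed
  from int[OF T] show i: "integrable (lebesgue_on \<Omega>) (\<lambda>x. j x \<bullet> g x)" "integrable (lebesgue_on \<Omega>) (\<lambda>x. \<psi> x * r x)"
    by auto
  let ?A = "- (LINT x|lebesgue_on \<Omega>. j x \<bullet> g x) - (LINT x|lebesgue_on \<Omega>. \<psi> x * r x)"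
  let ?K = "(LINT x|lebesgue_on \<Omega>. norm (j x)) + (LINT x|lebesgue_on \<Omega>. norm (r x))"
  have est: "\<bar>?A\<bar> \<le> e * ?K" if "e > 0" for e
  proof -
    obtain \<phi> where \<phi>: "test_function \<Omega> \<phi>" "\<And>x. \<bar>\<phi> x - \<psi> x\<bar> \<le> e" "\<And>x. norm (grad \<phi> x - g x) \<le> e"
      using C1_test_approx[OF \<Omega> T \<open>e > 0\<close>] by blast
    note i' = int[OF test_function_C1_test[OF \<phi>(1)]]
    have "?A = ((LINT x|lebesgue_on \<Omega>. j x \<bullet> grad \<phi> x) - (LINT x|lebesgue_on \<Omega>. j x \<bullet> g x)) +
       ((LINT x|lebesgue_on \<Omega>. \<phi> x * r x) - (LINT x|lebesgue_on \<Omega>. \<psi> x * r x))"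
      using div[OF \<phi>(1)] by simp
    also have "(LINT x|lebesgue_on \<Omega>. j x \<bullet> grad \<phi> x) - (LINT x|lebesgue_on \<Omega>. j x \<bullet> g x)
        = (LINT x|lebesgue_on \<Omega>. j x \<bullet> grad \<phi> x - j x \<bullet> g x)"
      using i i' by (subst Bochner_Integration.integral_diff) auto
    also have "(LINT x|lebesgue_on \<Omega>. \<phi> x * r x) - (LINT x|lebesgue_on \<Omega>. \<psi> x * r x)
        = (LINT x|lebesgue_on \<Omega>. \<phi> x * r x - \<psi> x * r x)"
      using i i' by (subst Bochner_Integration.integral_diff) auto
    also have "\<bar>(LINT x|lebesgue_on \<Omega>. j x \<bullet> grad \<phi> x - j x \<bullet> g x) + (LINT x|lebesgue_on \<Omega>. \<phi> x * r x - \<psi> x * r x)\<bar>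
       \<le> (LINT x|lebesgue_on \<Omega>. e * norm (j x)) + (LINT x|lebesgue_on \<Omega>. e * norm (r x))"
    proof (rule order_trans[OF abs_triangle_ineq add_mono])
      show "\<bar>LINT x|lebesgue_on \<Omega>. j x \<bullet> grad \<phi> x - j x \<bullet> g x\<bar> \<le> (LINT x|lebesgue_on \<Omega>. e * norm (j x))"
      proof (rule order_trans[OF integral_abs_bound integral_mono])
        fix x
        have "\<bar>j x \<bullet> grad \<phi> x - j x \<bullet> g x\<bar> \<le> norm (j x) * norm (grad \<phi> x - g x)"
          using Cauchy_Schwarz_ineq2[of "j x" "grad \<phi> x - g x"] by (simp add: inner_diff_right)
        also have "\<dots> \<le> e * norm (j x)" using mult_left_mono[OF \<phi>(3)[of x], of "norm (j x)"] by (simp add: mult.commute)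
        finally show "\<bar>j x \<bullet> grad \<phi> x - j x \<bullet> g x\<bar> \<le> e * norm (j x)" .
      qed (use i i' j in auto)
      show "\<bar>LINT x|lebesgue_on \<Omega>. \<phi> x * r x - \<psi> x * r x\<bar> \<le> (LINT x|lebesgue_on \<Omega>. e * norm (r x))"
      proof (rule order_trans[OF integral_abs_bound integral_mono])
        fix x
        have "\<bar>\<phi> x * r x - \<psi> x * r x\<bar> = \<bar>\<phi> x - \<psi> x\<bar> * norm (r x)"
          by (simp add: abs_mult flip: left_diff_distrib)
        also have "\<dots> \<le> e * norm (r x)" using \<phi>(2)[of x] by (simp add: mult_right_mono)
        finally show "\<bar>\<phi> x * r x - \<psi> x * r x\<bar> \<le> e * norm (r x)" .
      qed (use i i' r in auto)
    qed
    also have "\<dots> = e * ?K" by (simp add: distrib_left)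
    finally show ?thesis .
  qed
  define K where "K = ?K"
  have K0: "K \<ge> 0" unfolding K_def by (intro add_nonneg_nonneg integral_nonneg_AE) auto
  have "\<bar>?A\<bar> \<le> 0 + e" if "e > 0" for e
  proof -
    have "\<bar>?A\<bar> \<le> e / (K + 1) * K" unfolding K_def by (rule est) (use K0 that in \<open>auto simp flip: K_def real_norm_def\<close>)
    also have "\<dots> \<le> e" using K0 that by (simp add: divide_simps mult_left_mono)
    finally show ?thesis by simp
  qed
  then have "\<bar>?A\<bar> \<le> 0" by (rule field_le_epsilon)
  then show "- (LINT x|lebesgue_on \<Omega>. j x \<bullet> g x) = (LINT x|lebesgue_on \<Omega>. \<psi> x * r x)" by simp
qed

lemma smooth_approx_continuous:
  fixes f :: "real^'d \<Rightarrow> real"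
  assumes f: "continuous_on UNIV f" and K: "compact K" and "e > 0"
  obtains Q where "C1_test UNIV Q (grad Q)" "\<And>x. x \<in> K \<Longrightarrow> \<bar>Q x - f x\<bar> \<le> e"
proof -
  have "\<exists>\<kappa>::real^'d \<Rightarrow> real. smooth \<kappa> \<and> (\<forall>x\<in>K. \<kappa> x = 1) \<and> (\<forall>x. (\<forall>y\<in>K. 1 < dist x y) \<longrightarrow> \<kappa> x = 0)"
    by (rule smooth_plateau[OF K zero_less_one]) auto
  then obtain \<kappa> :: "real^'d \<Rightarrow> real" where \<kappa>: "smooth \<kappa>" "\<And>x. x \<in> K \<Longrightarrow> \<kappa> x = 1"
    "\<And>x. (\<forall>y\<in>K. 1 < dist x y) \<Longrightarrow> \<kappa> x = 0" by blast
  define C where "C = {x. \<exists>y\<in>K. dist x y \<le> 1}"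
  have C: "compact C" unfolding C_def by (rule compact_cball_nbhd[OF K])
  have \<kappa>0: "\<kappa> x = 0" if "x \<notin> C" for x
    using that by (intro \<kappa>(3)) (force simp: C_def)
  obtain R where R: "\<And>x. x \<in> C \<Longrightarrow> norm x \<le> R" 
    using compact_imp_bounded[OF C(1)] bounded_iff by metis
  have fc: "continuous_on UNIV (\<lambda>x. f x * \<kappa> x)"
    by (intro continuous_intros f smooth_imp_continuous[OF \<kappa>(1)])
  have supp: "f x * \<kappa> x = 0" if "R < norm x" for x
    using \<kappa>0[of x] R[of x] that by auto
  obtain d where d: "d > 0" "\<And>x y. norm (x - y) < d \<Longrightarrow> norm (f x * \<kappa> x - f y * \<kappa> y) < e"
    using uniformly_continuous_compact_support[OF fc supp \<open>e > 0\<close>] by metis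
  have int: "integrable lborel (\<lambda>x. f x * \<kappa> x)"
    by (rule integrable_continuous_compact_support[OF fc C]) (simp add: \<kappa>0)
  obtain \<rho> :: "real^'d \<Rightarrow> real" where \<rho>: "mollifier d \<rho>" using mollifier_exists[OF d(1)] by blast
  have T: "test_function UNIV (conv \<rho> (\<lambda>x. f x * \<kappa> x))"
    by (rule test_function_conv[OF \<rho> int C]) (auto simp: \<kappa>0)
  show thesis
  proof
    show "C1_test UNIV (conv \<rho> (\<lambda>x. f x * \<kappa> x)) (grad (conv \<rho> (\<lambda>x. f x * \<kappa> x)))"
      by (rule test_function_C1_test[OF T])
    show "\<bar>conv \<rho> (\<lambda>x. f x * \<kappa> x) x - f x\<bar> \<le> e" if "x \<in> K" for x
    proof (rule conv_mollifier_close[OF \<rho> int])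
      fix y assume "norm (y - x) < d"
      then show "\<bar>f y * \<kappa> y - f x\<bar> \<le> e" using d(2)[of y x] \<kappa>(2)[OF that] by simp
    qed
  qed
qed

text \<open>
  The almost everywhere defined gradient is part of the data, since its existence is supplied by the
  concrete functions to which the notion is applied. It is required to vanish off the support, so
  that integrals over the domain and over the space agree.
\<close>

definition lipschitz_test :: "real \<Rightarrow> 'a::euclidean_space set \<Rightarrow> ('a \<Rightarrow> real) \<Rightarrow> ('a \<Rightarrow> 'a) \<Rightarrow> bool"
where
  "lipschitz_test L \<Omega> \<psi> g \<longleftrightarrow> 0 \<le> L \<and> (\<forall>x y. \<bar>\<psi> x - \<psi> y\<bar> \<le> L * norm (x - y)) \<and>
     g \<in> borel_measurable borel \<and> (AE x in lborel. (\<psi> has_derivative (\<lambda>h. g x \<bullet> h)) (at x)) \<and>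
     (\<exists>C. compact C \<and> C \<subseteq> \<Omega> \<and> (\<forall>x. x \<notin> C \<longrightarrow> \<psi> x = 0 \<and> g x = 0))"

lemma lipschitz_testD:
  assumes "lipschitz_test L \<Omega> \<psi> g"
  shows "0 \<le> L" "\<And>x y. \<bar>\<psi> x - \<psi> y\<bar> \<le> L * norm (x - y)" "g \<in> borel_measurable borel"
    "AE x in lborel. (\<psi> has_derivative (\<lambda>h. g x \<bullet> h)) (at x)"
    "\<exists>C. compact C \<and> C \<subseteq> \<Omega> \<and> (\<forall>x. x \<notin> C \<longrightarrow> \<psi> x = 0 \<and> g x = 0)"
  using assms unfolding lipschitz_test_def by auto

lemma C1_test_lipschitz_test:
  assumes T: "C1_test \<Omega> \<psi> g"
  obtains L where "lipschitz_test L \<Omega> \<psi> g"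
proof -
  note D = C1_testD[OF T]
  obtain L R where L: "L \<ge> 0" "\<And>x. norm (g x) \<le> L" "\<And>x y. \<bar>\<psi> x - \<psi> y\<bar> \<le> L * norm (x - y)"
    "\<And>x. R < norm x \<Longrightarrow> \<psi> x = 0" by (rule C1_test_bounds[OF T]) (rule that; blast)
  have "g \<in> borel_measurable borel" by (rule borel_measurable_continuous_onI[OF D(2)])
  then have "lipschitz_test L \<Omega> \<psi> g"
    unfolding lipschitz_test_def using L D by auto
  then show thesis by (rule that)
qed

lemma lipschitz_test_bounded:
  assumes T: "lipschitz_test L \<Omega> \<psi> g"
  shows "\<exists>c. c \<ge> 0 \<and> (\<forall>x. \<bar>\<psi> x\<bar> \<le> c)" "AE x in lborel. norm (g x) \<le> L" "continuous_on UNIV \<psi>"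
proof -
  note D = lipschitz_testD[OF T]
  show c: "continuous_on UNIV \<psi>" by (rule lipschitz_imp_continuous[OF D(2,1)])
  show "\<exists>c. c \<ge> 0 \<and> (\<forall>x. \<bar>\<psi> x\<bar> \<le> c)"
    using continuous_compact_support_bounded[OF c] D(5) by metis
  show "AE x in lborel. norm (g x) \<le> L"
    using D(4) by eventually_elim (rule lipschitz_gradient_bound[OF _ D(2,1)])
qed

lemma AE_lborel_imp_lebesgue_on:
  assumes "AE x in lborel. P x" "\<Omega> \<in> sets lebesgue"
  shows "AE x in lebesgue_on \<Omega>. P x"
  using assms AE_completion[OF assms(1)] by (subst AE_restrict_space_iff) (auto elim: eventually_mono)

lemma lipschitz_test_integrable:
  fixes f :: "'a::euclidean_space \<Rightarrow> real"
  assumes T: "lipschitz_test L \<Omega>' \<psi> g" and \<Omega>: "\<Omega> \<in> sets lebesgue" and f: "continuous_on UNIV f"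
  shows "integrable (lebesgue_on \<Omega>) (\<lambda>x. f x * (g x \<bullet> h))" "integrable (lebesgue_on \<Omega>) (\<lambda>x. f x * \<psi> x)"
proof -
  note D = lipschitz_testD[OF T]
  obtain c where c: "c \<ge> 0" "\<And>x. \<bar>\<psi> x\<bar> \<le> c" using lipschitz_test_bounded(1)[OF T] by blast
  obtain C where C: "compact C" "\<And>x. x \<notin> C \<Longrightarrow> \<psi> x = 0 \<and> g x = 0" using D(5) by blast
  have Cl: "C \<in> lmeasurable" using C(1) by (rule lmeasurable_compact)
  have ind: "integrable (lebesgue_on \<Omega>) (\<lambda>x. b * indicator C x :: real)" for b
  proof -
    have "(\<lambda>x. indicator \<Omega> x *\<^sub>R (b * indicator C x)) = (\<lambda>x. b * indicator (C \<inter> \<Omega>) x :: real)"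
      by (auto simp: indicator_def)
    moreover have "C \<inter> \<Omega> \<in> lmeasurable" by (rule fmeasurable_Int_fmeasurable[OF Cl \<Omega>])
    then have "integrable lebesgue (\<lambda>x. b * indicator (C \<inter> \<Omega>) x :: real)"
      by (intro integrable_mult_right integrable_real_indicator) (auto simp: fmeasurable_def)
    moreover have "integrable (lebesgue_on \<Omega>) (\<lambda>x. b * indicator C x :: real)
        \<longleftrightarrow> integrable lebesgue (\<lambda>x. indicator \<Omega> x *\<^sub>R (b * indicator C x :: real))"
      by (rule integrable_restrict_space) (use \<Omega> in auto)
    ultimately show ?thesis by (simp only:)
  qed
  obtain k where k: "\<And>x. x \<in> C \<Longrightarrow> \<bar>f x\<bar> \<le> k"
    using compact_imp_bounded[OF compact_continuous_image[OF continuous_on_subset[OF f] C(1)]]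
    by (auto simp: bounded_iff)
  note [measurable] = lebesgue_on_measurable[OF D(3)] continuous_lebesgue_on_measurable[OF f]
    continuous_lebesgue_on_measurable[OF lipschitz_test_bounded(3)[OF T]]
  show "integrable (lebesgue_on \<Omega>) (\<lambda>x. f x * (g x \<bullet> h))"
  proof (rule Bochner_Integration.integrable_bound[OF ind[of "k * (L * norm h)"]])
    show "AE x in lebesgue_on \<Omega>. norm (f x * (g x \<bullet> h)) \<le> norm (k * (L * norm h) * indicator C x)"
      using AE_lborel_imp_lebesgue_on[OF lipschitz_test_bounded(2)[OF T] \<Omega>]
    proof eventually_elim
      case (elim x)
      show ?case
      proof (cases "x \<in> C")
        case True
        have "\<bar>f x\<bar> * \<bar>g x \<bullet> h\<bar> \<le> k * (L * norm h)"
          by (intro mult_mono k True order_trans[OF Cauchy_Schwarz_ineq2] mult_right_mono elim)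
             (use k[OF True] in auto)
        also have "\<dots> \<le> \<bar>k\<bar> * (\<bar>L\<bar> * norm h)" using D(1) by (intro mult_mono) auto
        finally show ?thesis using True by (simp add: abs_mult)
      qed (use C in auto)
    qed
  qed auto
  show "integrable (lebesgue_on \<Omega>) (\<lambda>x. f x * \<psi> x)"
  proof (rule Bochner_Integration.integrable_bound[OF ind[of "k * c"]])
    show "AE x in lebesgue_on \<Omega>. norm (f x * \<psi> x) \<le> norm (k * c * indicator C x)"
    proof (intro AE_I2)
      fix x
      show "norm (f x * \<psi> x) \<le> norm (k * c * indicator C x)"
      proof (cases "x \<in> C")
        case True
        have "\<bar>f x\<bar> * \<bar>\<psi> x\<bar> \<le> k * c"
          by (intro mult_mono k True c) (use k[OF True] in auto)
        also have "\<dots> \<le> \<bar>k\<bar> * \<bar>c\<bar>" using c(1) by (intro mult_mono) auto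
        finally show ?thesis using True by (simp add: abs_mult)
      qed (use C in auto)
    qed
  qed auto
qed

text \<open>
  The product \<open>Q \<psi>\<close> is again Lipschitz with compact support, and the integral of its derivative
  vanishes.
\<close>

lemma lipschitz_test_by_parts:
  fixes Q :: "'a::euclidean_space \<Rightarrow> real"
  assumes T: "lipschitz_test L \<Omega> \<psi> g" and \<Omega>: "\<Omega> \<in> sets lebesgue" and Q: "C1_test UNIV Q G"
  shows "(LINT x|lebesgue_on \<Omega>. Q x * (g x \<bullet> h)) = - (LINT x|lebesgue_on \<Omega>. (G x \<bullet> h) * \<psi> x)"
    and "integrable (lebesgue_on \<Omega>) (\<lambda>x. Q x * (g x \<bullet> h))"
    and "integrable (lebesgue_on \<Omega>) (\<lambda>x. (G x \<bullet> h) * \<psi> x)"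
proof -
  note D = lipschitz_testD[OF T]
  obtain C where C: "compact C" "C \<subseteq> \<Omega>" "\<And>x. x \<notin> C \<Longrightarrow> \<psi> x = 0 \<and> g x = 0" using D(5) by blast
  obtain R where R: "\<And>x. x \<in> C \<Longrightarrow> norm x \<le> R" 
    using compact_imp_bounded[OF C(1)] bounded_iff by metis
  obtain M where QL: "lipschitz_test M UNIV Q G" by (rule C1_test_lipschitz_test[OF Q])
  note DQ = lipschitz_testD[OF QL]
  note Gc = C1_testD(2)[OF Q]
  have Qc: "continuous_on UNIV Q" by (rule lipschitz_test_bounded(3)[OF QL])
  obtain c where c: "c \<ge> 0" "\<And>x. \<bar>\<psi> x\<bar> \<le> c" using lipschitz_test_bounded(1)[OF T] by blast
  obtain k where k: "k \<ge> 0" "\<And>x. \<bar>Q x\<bar> \<le> k" using lipschitz_test_bounded(1)[OF QL] by blast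
  have Ghc: "continuous_on UNIV (\<lambda>x. G x \<bullet> h)" by (intro continuous_intros Gc)
  show i: "integrable (lebesgue_on \<Omega>) (\<lambda>x. Q x * (g x \<bullet> h))" "integrable (lebesgue_on \<Omega>) (\<lambda>x. (G x \<bullet> h) * \<psi> x)"
    using lipschitz_test_integrable[OF T \<Omega> Qc] lipschitz_test_integrable[OF T \<Omega> Ghc] by auto
  note [measurable] = D(3) borel_measurable_continuous_onI[OF Gc] borel_measurable_continuous_onI[OF Qc]
    borel_measurable_continuous_onI[OF lipschitz_test_bounded(3)[OF T]]
  have "(LBINT x. (Q x *\<^sub>R g x + \<psi> x *\<^sub>R G x) \<bullet> h) = 0"
  proof (rule integral_derivative_compact_support[where \<psi>="\<lambda>x. Q x * \<psi> x" and R=R])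
    show "\<bar>Q x * \<psi> x - Q y * \<psi> y\<bar> \<le> (k * L + c * M) * norm (x - y)" for x y
    proof -
      have "Q x * \<psi> x - Q y * \<psi> y = Q x * (\<psi> x - \<psi> y) + \<psi> y * (Q x - Q y)" by (simp add: algebra_simps)
      also have "\<bar>\<dots>\<bar> \<le> \<bar>Q x\<bar> * \<bar>\<psi> x - \<psi> y\<bar> + \<bar>\<psi> y\<bar> * \<bar>Q x - Q y\<bar>"
        using abs_triangle_ineq by (simp flip: abs_mult)
      also have "\<dots> \<le> k * (L * norm (x - y)) + c * (M * norm (x - y))"
        by (intro add_mono mult_mono k c D(2) DQ(2)) auto
      finally show ?thesis by (simp add: algebra_simps)
    qed
    show "Q x * \<psi> x = 0" if "R < norm x" for x using R[of x] C(3)[of x] that by auto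
    show "AE x in lborel. ((\<lambda>x. Q x * \<psi> x) has_derivative (\<lambda>h. (Q x *\<^sub>R g x + \<psi> x *\<^sub>R G x) \<bullet> h)) (at x)"
      using D(4)
    proof eventually_elim
      case (elim x)
      show ?case using has_derivative_mult[OF C1_testD(1)[OF Q] elim]
        by (simp add: inner_add_left mult.commute)
    qed
  qed simp
  moreover have "(LINT x|lebesgue_on \<Omega>. Q x * (g x \<bullet> h) + (G x \<bullet> h) * \<psi> x) = (LBINT x. (Q x *\<^sub>R g x + \<psi> x *\<^sub>R G x) \<bullet> h)"
  proof (rule integral_lebesgue_on_eq_lborel(1)[OF \<Omega>])
    show "(Q x *\<^sub>R g x + \<psi> x *\<^sub>R G x) \<bullet> h = 0" if "x \<notin> \<Omega>" for x
    proof -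
      have "x \<notin> C" using that C(2) by blast
      then show ?thesis using C(3) by simp
    qed
  qed (auto simp: inner_add_left)
  ultimately show "(LINT x|lebesgue_on \<Omega>. Q x * (g x \<bullet> h)) = - (LINT x|lebesgue_on \<Omega>. (G x \<bullet> h) * \<psi> x)"
    using i by simp
qed

text \<open>
  The gradients of the approximations are only bounded and need not converge uniformly, so the
  continuity of \<open>f\<close> has to help: replace \<open>f\<close> by a smooth \<open>Q\<close>, at a uniformly small cost because the
  gradients are bounded by \<open>L\<close>, and integrate by parts, so that only the uniform convergence of
  \<open>\<phi> n\<close> to \<open>\<psi>\<close> matters.
\<close>

lemma lipschitz_test_tendsto:
  fixes f :: "real^'d \<Rightarrow> real"
  assumes \<Omega>: "\<Omega> \<in> lmeasurable" "bounded \<Omega>" and f: "continuous_on UNIV f"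
    and T: "lipschitz_test L \<Omega> \<psi> g"
    and \<phi>: "\<And>n. test_function \<Omega> (\<phi> n)" "\<And>n x. \<bar>\<phi> n x - \<psi> x\<bar> \<le> inverse (Suc n)"
      "\<And>n x. norm (grad (\<phi> n) x) \<le> L"
  shows "(\<lambda>n. LINT x|lebesgue_on \<Omega>. f x * (grad (\<phi> n) x \<bullet> h)) \<longlonglongrightarrow> (LINT x|lebesgue_on \<Omega>. f x * (g x \<bullet> h))"
proof (rule LIMSEQ_I)
  fix \<epsilon> :: real assume \<epsilon>: "\<epsilon> > 0"
  have \<Omega>l: "\<Omega> \<in> sets lebesgue" using \<Omega>(1) by auto
  have fin: "finite_measure (lebesgue_on \<Omega>)" using \<Omega>(1) by (simp add: finite_measure_lebesgue_on)
  define m where "m = measure (lebesgue_on \<Omega>) (space (lebesgue_on \<Omega>))"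
  have m0: "m \<ge> 0" by (simp add: m_def)
  have L0: "L \<ge> 0" using lipschitz_testD(1)[OF T] .
  define B where "B = 2 * L * norm h * m + 1"
  have B: "B > 0" using L0 m0 by (auto simp: B_def intro!: add_nonneg_pos)
  obtain Q where Q: "C1_test UNIV Q (grad Q)" "\<And>x. x \<in> closure \<Omega> \<Longrightarrow> \<bar>Q x - f x\<bar> \<le> \<epsilon> / 2 / B"
    by (rule smooth_approx_continuous[OF f, of "closure \<Omega>" "\<epsilon> / 2 / B"])
       (use \<Omega> \<epsilon> B in \<open>auto simp: compact_closure\<close>)
  define I where "I = (LINT x|lebesgue_on \<Omega>. \<bar>grad Q x \<bullet> h\<bar>)"
  have I0: "I \<ge> 0" by (auto simp: I_def)
  have Gi: "integrable (lebesgue_on \<Omega>) (\<lambda>x. grad Q x \<bullet> h)"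
    by (rule C1_test_lipschitz_test[OF Q(1)])
       (use lipschitz_test_integrable(1)[OF _ \<Omega>l continuous_on_const, of _ UNIV Q "grad Q" 1 h] in auto)
  have "(\<lambda>n. inverse (real (Suc n)) * I) \<longlonglongrightarrow> 0 * I"
    by (intro tendsto_intros LIMSEQ_inverse_real_of_nat)
  then obtain N where N: "\<And>n. n \<ge> N \<Longrightarrow> inverse (real (Suc n)) * I < \<epsilon> / 2"
    using \<epsilon> order_tendstoD(2)[of "\<lambda>n. inverse (real (Suc n)) * I" "0 * I" sequentially "\<epsilon> / 2"]
    unfolding eventually_sequentially by auto
  show "\<exists>no. \<forall>n\<ge>no. norm ((LINT x|lebesgue_on \<Omega>. f x * (grad (\<phi> n) x \<bullet> h)) - (LINT x|lebesgue_on \<Omega>. f x * (g x \<bullet> h))) < \<epsilon>"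
  proof (intro exI[of _ N] allI impI)
    fix n assume n: "n \<ge> N"
    note T' = test_function_C1_test[OF \<phi>(1)[of n]]
    obtain L' where T'': "lipschitz_test L' \<Omega> (\<phi> n) (grad (\<phi> n))" by (rule C1_test_lipschitz_test[OF T'])
    note i1 = lipschitz_test_integrable(1)[OF T \<Omega>l f, of h] lipschitz_test_integrable(1)[OF T'' \<Omega>l f, of h]
    note p1 = lipschitz_test_by_parts[OF T \<Omega>l Q(1), of h]
    note p2 = lipschitz_test_by_parts[OF T'' \<Omega>l Q(1), of h]
    let ?d = "\<lambda>x. grad (\<phi> n) x \<bullet> h - g x \<bullet> h"
    have i2: "integrable (lebesgue_on \<Omega>) (\<lambda>x. (f x - Q x) * ?d x)"
      using Bochner_Integration.integrable_diff[OF Bochner_Integration.integrable_diff[OF i1(2) i1(1)]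
         Bochner_Integration.integrable_diff[OF p2(2) p1(2)]]
      by (rule Bochner_Integration.integrable_cong[THEN iffD1, rotated 2]) (auto simp: algebra_simps)
    have i3: "integrable (lebesgue_on \<Omega>) (\<lambda>x. (grad Q x \<bullet> h) * (\<phi> n x - \<psi> x))"
      using Bochner_Integration.integrable_diff[OF p2(3) p1(3)]
      by (rule Bochner_Integration.integrable_cong[THEN iffD1, rotated 2]) (auto simp: algebra_simps)
    have eq: "(LINT x|lebesgue_on \<Omega>. f x * (grad (\<phi> n) x \<bullet> h)) - (LINT x|lebesgue_on \<Omega>. f x * (g x \<bullet> h))
       = (LINT x|lebesgue_on \<Omega>. (f x - Q x) * ?d x) - (LINT x|lebesgue_on \<Omega>. (grad Q x \<bullet> h) * (\<phi> n x - \<psi> x))"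
    proof -
      have "(LINT x|lebesgue_on \<Omega>. (f x - Q x) * ?d x) =
        (LINT x|lebesgue_on \<Omega>. (f x * (grad (\<phi> n) x \<bullet> h) - f x * (g x \<bullet> h)) - (Q x * (grad (\<phi> n) x \<bullet> h) - Q x * (g x \<bullet> h)))"
        by (intro Bochner_Integration.integral_cong) (auto simp: algebra_simps)
      also have "\<dots> = ((LINT x|lebesgue_on \<Omega>. f x * (grad (\<phi> n) x \<bullet> h)) - (LINT x|lebesgue_on \<Omega>. f x * (g x \<bullet> h)))
          - ((LINT x|lebesgue_on \<Omega>. Q x * (grad (\<phi> n) x \<bullet> h)) - (LINT x|lebesgue_on \<Omega>. Q x * (g x \<bullet> h)))"
        using i1 p1(2) p2(2) by (simp add: Bochner_Integration.integral_diff)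
      also have "(LINT x|lebesgue_on \<Omega>. Q x * (grad (\<phi> n) x \<bullet> h)) - (LINT x|lebesgue_on \<Omega>. Q x * (g x \<bullet> h))
         = - (LINT x|lebesgue_on \<Omega>. (grad Q x \<bullet> h) * (\<phi> n x - \<psi> x))"
        unfolding p1(1) p2(1) right_diff_distrib
        using Bochner_Integration.integral_diff[OF p2(3) p1(3)] by simp
      finally show ?thesis by simp
    qed
    have 1: "norm ((LINT x|lebesgue_on \<Omega>. f x * (grad (\<phi> n) x \<bullet> h)) - (LINT x|lebesgue_on \<Omega>. f x * (g x \<bullet> h))) \<le>
       (LINT x|lebesgue_on \<Omega>. \<epsilon> / 2 / B * (2 * L * norm h)) + (LINT x|lebesgue_on \<Omega>. inverse (Suc n) * \<bar>grad Q x \<bullet> h\<bar>)"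
      unfolding eq
    proof (rule order_trans[OF norm_triangle_ineq4 add_mono])
      have "norm (LINT x|lebesgue_on \<Omega>. (f x - Q x) * ?d x) \<le> (LINT x|lebesgue_on \<Omega>. norm ((f x - Q x) * ?d x))"
        by (rule integral_norm_bound)
      also have "\<dots> \<le> (LINT x|lebesgue_on \<Omega>. \<epsilon> / 2 / B * (2 * L * norm h))"
      proof (rule integral_mono_AE)
        have "AE x in lebesgue_on \<Omega>. x \<in> \<Omega>" by (intro AE_I2) auto
        with AE_lborel_imp_lebesgue_on[OF lipschitz_test_bounded(2)[OF T] \<Omega>l]
        show "AE x in lebesgue_on \<Omega>. norm ((f x - Q x) * ?d x) \<le> \<epsilon> / 2 / B * (2 * L * norm h)"
        proof eventually_elim
          case (elim x)
          have "\<bar>f x - Q x\<bar> \<le> \<epsilon> / 2 / B" using Q(2)[of x] elim(2) closure_subset by (auto simp: abs_minus_commute)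
          moreover have "\<bar>?d x\<bar> \<le> 2 * L * norm h"
          proof -
            have "\<bar>?d x\<bar> \<le> norm (grad (\<phi> n) x - g x) * norm h"
              using Cauchy_Schwarz_ineq2[of "grad (\<phi> n) x - g x" h] by (simp add: inner_diff_left)
            also have "\<dots> \<le> (2 * L) * norm h"
              using norm_triangle_ineq4[of "grad (\<phi> n) x" "g x"] \<phi>(3)[of n x] elim(1)
              by (intro mult_right_mono) auto
            finally show ?thesis .
          qed
          ultimately show ?case unfolding real_norm_def abs_mult
            by (intro mult_mono) (use \<epsilon> B in auto)
        qed
      qed (use i2 fin in \<open>auto intro: finite_measure.integrable_const\<close>)
      finally show "norm (LINT x|lebesgue_on \<Omega>. (f x - Q x) * ?d x) \<le> (LINT x|lebesgue_on \<Omega>. \<epsilon> / 2 / B * (2 * L * norm h))" .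
      have "norm (LINT x|lebesgue_on \<Omega>. (grad Q x \<bullet> h) * (\<phi> n x - \<psi> x)) \<le> (LINT x|lebesgue_on \<Omega>. norm ((grad Q x \<bullet> h) * (\<phi> n x - \<psi> x)))"
        by (rule integral_norm_bound)
      also have "\<dots> \<le> (LINT x|lebesgue_on \<Omega>. inverse (Suc n) * \<bar>grad Q x \<bullet> h\<bar>)"
      proof (rule integral_mono)
        show "norm ((grad Q x \<bullet> h) * (\<phi> n x - \<psi> x)) \<le> inverse (Suc n) * \<bar>grad Q x \<bullet> h\<bar>" for x
          using mult_left_mono[OF \<phi>(2)[of n x], of "\<bar>grad Q x \<bullet> h\<bar>"] by (simp add: abs_mult mult.commute)
      qed (use i3 Gi in auto)
      finally show "norm (LINT x|lebesgue_on \<Omega>. (grad Q x \<bullet> h) * (\<phi> n x - \<psi> x)) \<le> (LINT x|lebesgue_on \<Omega>. inverse (Suc n) * \<bar>grad Q x \<bullet> h\<bar>)" .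
    qed
    have 2: "(LINT x|lebesgue_on \<Omega>. \<epsilon> / 2 / B * (2 * L * norm h)) \<le> \<epsilon> / 2"
    proof -
      have "2 * L * norm h * m \<le> B" by (simp add: B_def)
      then have "\<epsilon> / 2 / B * (2 * L * norm h * m) \<le> \<epsilon> / 2 / B * B" using \<epsilon> B by (intro mult_left_mono) auto
      moreover have "(LINT x|lebesgue_on \<Omega>. \<epsilon> / 2 / B * (2 * L * norm h)) = \<epsilon> / 2 / B * (2 * L * norm h * m)"
        by (simp only: lebesgue_integral_const real_scaleR_def m_def mult_ac)
      moreover have "\<epsilon> / 2 / B * B = \<epsilon> / 2" using B by simp
      ultimately show ?thesis by (simp only:)
    qed
    have 3: "(LINT x|lebesgue_on \<Omega>. inverse (Suc n) * \<bar>grad Q x \<bullet> h\<bar>) = inverse (real (Suc n)) * I"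
      by (simp add: I_def)
    show "norm ((LINT x|lebesgue_on \<Omega>. f x * (grad (\<phi> n) x \<bullet> h)) - (LINT x|lebesgue_on \<Omega>. f x * (g x \<bullet> h))) < \<epsilon>"
      using 1 2 N[OF n] unfolding 3 by linarith
  qed
qed

lemma distr_div_lipschitz_test:
  fixes q :: "real^'d \<Rightarrow> real^'d" and r :: "real^'d \<Rightarrow> real"
  assumes \<Omega>: "open \<Omega>" "bounded \<Omega>" and q: "continuous_on UNIV q" and r: "integrable (lebesgue_on \<Omega>) r"
    and div: "\<And>\<phi>. test_function \<Omega> \<phi> \<Longrightarrow> - (LINT x|lebesgue_on \<Omega>. q x \<bullet> grad \<phi> x) = (LINT x|lebesgue_on \<Omega>. \<phi> x * r x)"
    and T: "lipschitz_test L \<Omega> \<psi> g"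
  shows "- (LINT x|lebesgue_on \<Omega>. q x \<bullet> g x) = (LINT x|lebesgue_on \<Omega>. \<psi> x * r x)"
proof -
  have \<Omega>m: "\<Omega> \<in> lmeasurable" using \<Omega> by (simp add: lmeasurable_open)
  then have \<Omega>l: "\<Omega> \<in> sets lebesgue" by auto
  note D = lipschitz_testD[OF T]
  obtain C where C: "compact C" "C \<subseteq> \<Omega>" "\<And>x. x \<notin> C \<Longrightarrow> \<psi> x = 0 \<and> g x = 0" using D(5) by blast
  have "\<exists>\<phi>. test_function \<Omega> \<phi> \<and> (\<forall>x. \<bar>\<phi> x - \<psi> x\<bar> \<le> inverse (Suc n)) \<and> (\<forall>x. norm (grad \<phi> x) \<le> L)" for n
    by (rule lipschitz_test_approx[OF \<Omega>(1) D(2,1) C(1,2), of "inverse (Suc n)"]) (use C(3) in auto)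
  then obtain \<phi> where \<phi>: "\<And>n. test_function \<Omega> (\<phi> n)" "\<And>n x. \<bar>\<phi> n x - \<psi> x\<bar> \<le> inverse (Suc n)"
      "\<And>n x. norm (grad (\<phi> n) x) \<le> L" by metis
  have qc: "continuous_on UNIV (\<lambda>x. q x $ k)" for k by (intro continuous_on_component q)
  have split: "(LINT x|lebesgue_on \<Omega>. q x \<bullet> g x) = (\<Sum>k\<in>UNIV. LINT x|lebesgue_on \<Omega>. q x $ k * (g x \<bullet> axis k 1))"
    if "lipschitz_test L \<Omega> \<psi> g" for L \<psi> g
    unfolding inner_vec_def[of "q _" "g _"]
    by (subst Bochner_Integration.integral_sum) (use lipschitz_test_integrable(1)[OF that \<Omega>l qc, of _ "axis _ 1"] in \<open>auto simp: inner_axis\<close>)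
  have 1: "(\<lambda>n. LINT x|lebesgue_on \<Omega>. q x \<bullet> grad (\<phi> n) x) \<longlonglongrightarrow> (LINT x|lebesgue_on \<Omega>. q x \<bullet> g x)"
  proof -
    have "(\<lambda>n. \<Sum>k\<in>UNIV. LINT x|lebesgue_on \<Omega>. q x $ k * (grad (\<phi> n) x \<bullet> axis k 1)) \<longlonglongrightarrow>
       (\<Sum>k\<in>UNIV. LINT x|lebesgue_on \<Omega>. q x $ k * (g x \<bullet> axis k 1))"
      by (intro tendsto_sum lipschitz_test_tendsto[OF \<Omega>m \<Omega>(2) qc T \<phi>])
    moreover have "(LINT x|lebesgue_on \<Omega>. q x \<bullet> grad (\<phi> n) x) = (\<Sum>k\<in>UNIV. LINT x|lebesgue_on \<Omega>. q x $ k * (grad (\<phi> n) x \<bullet> axis k 1))" for n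
    proof -
      obtain L' where "lipschitz_test L' \<Omega> (\<phi> n) (grad (\<phi> n))"
        by (rule C1_test_lipschitz_test[OF test_function_C1_test[OF \<phi>(1)[of n]]])
      then show ?thesis by (rule split)
    qed
    ultimately show ?thesis by (simp only: split[OF T])
  qed
  obtain c where c: "c \<ge> 0" "\<And>x. \<bar>\<psi> x\<bar> \<le> c" using lipschitz_test_bounded(1)[OF T] by blast
  have b: "\<bar>\<phi> n x\<bar> \<le> c + 1" for n x
  proof -
    have "inverse (real (Suc n)) \<le> 1" by (simp add: field_simps)
    then show ?thesis using c(2)[of x] \<phi>(2)[of n x] by linarith
  qed
  have 2: "(\<lambda>n. LINT x|lebesgue_on \<Omega>. \<phi> n x * r x) \<longlonglongrightarrow> (LINT x|lebesgue_on \<Omega>. \<psi> x * r x)"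
  proof (rule integral_dominated_convergence[where w="\<lambda>x. (c + 1) * \<bar>r x\<bar>"])
    note [measurable] = borel_measurable_integrable[OF r]
      continuous_lebesgue_on_measurable[OF smooth_imp_continuous[OF test_functionD(1)[OF \<phi>(1)]]]
      continuous_lebesgue_on_measurable[OF lipschitz_test_bounded(3)[OF T]]
    show "integrable (lebesgue_on \<Omega>) (\<lambda>x. (c + 1) * \<bar>r x\<bar>)" using r by simp
    show "AE x in lebesgue_on \<Omega>. norm (\<phi> n x * r x) \<le> (c + 1) * \<bar>r x\<bar>" for n
      using b by (intro AE_I2) (simp add: abs_mult mult_right_mono)
    show "AE x in lebesgue_on \<Omega>. (\<lambda>n. \<phi> n x * r x) \<longlonglongrightarrow> \<psi> x * r x"
    proof (intro AE_I2 tendsto_mult tendsto_const)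
      fix x
      have "(\<lambda>n. \<phi> n x - \<psi> x) \<longlonglongrightarrow> 0"
        by (rule Lim_null_comparison[OF _ LIMSEQ_inverse_real_of_nat]) (use \<phi>(2) in auto)
      then show "(\<lambda>n. \<phi> n x) \<longlonglongrightarrow> \<psi> x" by (simp add: LIM_zero_iff)
    qed
    show "(\<lambda>x. \<psi> x * r x) \<in> borel_measurable (lebesgue_on \<Omega>)" by measurable
    show "(\<lambda>x. \<phi> n x * r x) \<in> borel_measurable (lebesgue_on \<Omega>)" for n by measurable
  qed
  have "(\<lambda>n. - (LINT x|lebesgue_on \<Omega>. q x \<bullet> grad (\<phi> n) x)) \<longlonglongrightarrow> - (LINT x|lebesgue_on \<Omega>. q x \<bullet> g x)"
    by (intro tendsto_minus 1)
  then have "(\<lambda>n. LINT x|lebesgue_on \<Omega>. \<phi> n x * r x) \<longlonglongrightarrow> - (LINT x|lebesgue_on \<Omega>. q x \<bullet> g x)"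
    by (simp only: div[OF \<phi>(1)])
  then show ?thesis using 2 LIMSEQ_unique by blast
qed

section \<open>The layer profile and slicing along a direction\<close>

abbreviation pos_part :: "real \<Rightarrow> real" where "pos_part s \<equiv> max 0 s"

text \<open>
  A \<open>C\<^sup>1\<close> transition from \<open>0\<close> at \<open>s = 0\<close> to \<open>1\<close> at \<open>s = 2\<close>: the
  antiderivative of the tent function of mass one. Being \<open>C\<^sup>1\<close>, it can be composed with a function
  that is differentiable almost everywhere only.
\<close>

definition step :: "real \<Rightarrow> real" where
  "step s = ((pos_part s)\<^sup>2 - 2 * (pos_part (s - 1))\<^sup>2 + (pos_part (s - 2))\<^sup>2) / 2"

definition tent :: "real \<Rightarrow> real" where
  "tent s = pos_part s - 2 * pos_part (s - 1) + pos_part (s - 2)"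

lemma DERIV_pos_part_square: "((\<lambda>s. (pos_part s)\<^sup>2 / 2) has_real_derivative pos_part s) (at s)"
proof -
  consider "s > 0" | "s < 0" | "s = 0" by linarith
  then show ?thesis
  proof cases
    case 1
    have ev: "\<forall>\<^sub>F x in nhds s. (pos_part x)\<^sup>2 / 2 = x\<^sup>2 / 2"
      by (rule eventually_nhds_in_open[of "{0<..}", THEN eventually_mono]) (use 1 in auto)
    have d: "((\<lambda>s. s\<^sup>2 / 2) has_real_derivative pos_part s) (at s)"
      using 1 by (auto intro!: derivative_eq_intros)
    show ?thesis by (rule DERIV_cong_ev[OF refl ev refl, THEN iffD2, OF d])
  next
    case 2
    have ev: "\<forall>\<^sub>F x in nhds s. (pos_part x)\<^sup>2 / 2 = 0"
      by (rule eventually_nhds_in_open[of "{..<0}", THEN eventually_mono]) (use 2 in auto)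
    have d: "((\<lambda>s. 0) has_real_derivative pos_part s) (at s)"
      using 2 by auto
    show ?thesis by (rule DERIV_cong_ev[OF refl ev refl, THEN iffD2, OF d])
  next
    case 3
    have "((\<lambda>y. ((pos_part y)\<^sup>2 / 2) / y) \<longlongrightarrow> 0) (at 0)"
    proof (rule Lim_null_comparison)
      show "\<forall>\<^sub>F y in at 0. norm (((pos_part y)\<^sup>2 / 2) / y) \<le> \<bar>y\<bar>"
        by (intro always_eventually allI) (auto simp: max_def power2_eq_square divide_simps)
      show "((\<lambda>y::real. \<bar>y\<bar>) \<longlongrightarrow> 0) (at 0)" by (auto intro!: tendsto_eq_intros)
    qed
    then show ?thesis using 3 by (simp add: has_field_derivative_iff)
  qed
qed

lemma DERIV_step: "(step has_real_derivative tent s) (at s)"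
proof -
  have *: "((\<lambda>s. (pos_part (s - c))\<^sup>2 / 2) has_real_derivative pos_part (s - c)) (at s)" for c
    using DERIV_pos_part_square[of "s + - c"] unfolding DERIV_shift by simp
  have "((\<lambda>s. (pos_part (s - 0))\<^sup>2 / 2 - 2 * ((pos_part (s - 1))\<^sup>2 / 2) + (pos_part (s - 2))\<^sup>2 / 2)
     has_real_derivative pos_part (s - 0) - 2 * pos_part (s - 1) + pos_part (s - 2)) (at s)"
    by (intro DERIV_add DERIV_diff DERIV_cmult *)
  moreover have "step = (\<lambda>s. (pos_part (s - 0))\<^sup>2 / 2 - 2 * ((pos_part (s - 1))\<^sup>2 / 2) + (pos_part (s - 2))\<^sup>2 / 2)"
    by (auto simp: step_def fun_eq_iff field_simps)
  ultimately show ?thesis by (simp add: tent_def)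
qed

lemma tent_bounds: "0 \<le> tent s" "tent s \<le> 1" "s \<le> 0 \<Longrightarrow> tent s = 0" "2 \<le> s \<Longrightarrow> tent s = 0"
  by (auto simp: tent_def max_def)

lemma step_simps: "s \<le> 0 \<Longrightarrow> step s = 0" "2 \<le> s \<Longrightarrow> step s = 1"
  by (auto simp: step_def max_def power2_eq_square field_simps)

lemma step_lipschitz: "\<bar>step s - step t\<bar> \<le> \<bar>s - t\<bar>"
proof -
  have "norm (step s - step t) \<le> 1 * norm (s - t)"
    by (rule field_differentiable_bound[of UNIV _ tent])
       (auto intro: has_field_derivative_at_within DERIV_step simp: abs_of_nonneg[OF tent_bounds(1)] tent_bounds(2))
  then show ?thesis by simp
qed

lemma step_mono: "s \<le> t \<Longrightarrow> step s \<le> step t"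
  by (rule DERIV_nonneg_imp_nondecreasing) (use DERIV_step tent_bounds in blast)+

lemma step_bounds: "0 \<le> step s" "step s \<le> 1"
  using step_mono[of "min s 0" s] step_mono[of s "max s 2"] step_simps(1)[of "min s 0"] step_simps(2)[of "max s 2"] by auto

lemma continuous_step: "continuous_on UNIV step"
  by (intro continuous_at_imp_continuous_on ballI DERIV_isCont[OF DERIV_step])

lemma continuous_tent: "continuous_on UNIV tent"
  unfolding tent_def by (intro continuous_intros)

lemma integral_tent: "integrable lborel tent" "(LBINT s. tent s) = 1"
proof -
  have "tent s * indicator {0..2} s = tent s" for s
    using tent_bounds(3,4)[of s] by (cases "s \<in> {0..2}") (auto simp: not_le)
  then have eq: "(\<lambda>s. tent s * indicator {0..2} s) = tent" by (rule ext)
  have "has_bochner_integral lborel (\<lambda>s. tent s * indicator {0..2} s) (step 2 - step 0)"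
    by (rule has_bochner_integral_FTC_Icc_nonneg)
       (auto intro: DERIV_step tent_bounds(1) borel_measurable_continuous_onI[OF continuous_tent])
  then have "has_bochner_integral lborel tent 1"
    unfolding eq using step_simps by simp
  then show "integrable lborel tent" "(LBINT s. tent s) = 1"
    by (auto simp: has_bochner_integral_iff)
qed

abbreviation slab :: "'a::euclidean_space \<Rightarrow> 'a set" where "slab \<nu> \<equiv> {x. 0 < x \<bullet> \<nu> \<and> x \<bullet> \<nu> < 1}"

text \<open>
  The lines in direction \<open>\<nu>\<close> through the points of a slab of thickness one cover the space, every
  point being met by a parameter interval of length one. Integration over the slab and along the
  lines therefore yields Lebesgue measure, also if the origin \<open>a x\<close> of the parameter varies with the
  line. This replaces rotated coordinates.
\<close>

lemma slab_distr:
  fixes \<nu> :: "'a::euclidean_space"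
  assumes \<nu>: "norm \<nu> = 1" and [measurable]: "a \<in> borel_measurable borel" and \<epsilon>: "\<epsilon> > 0"
  defines "M \<equiv> density (lborel \<Otimes>\<^sub>M lborel) (\<lambda>(x, s::real). ennreal (\<epsilon> * indicator (slab \<nu>) x))"
  shows "distr M borel (\<lambda>(x, s). x + (a x - \<epsilon> * s) *\<^sub>R \<nu>) = lborel"
proof (rule measure_eqI)
  fix A assume "A \<in> sets (distr M borel (\<lambda>(x, s). x + (a x - \<epsilon> * s) *\<^sub>R \<nu>))"
  then have [measurable]: "A \<in> sets borel" by simp
  have [measurable]: "slab \<nu> \<in> sets borel" by measurable
  have T[measurable]: "(\<lambda>(x, s). x + (a x - \<epsilon> * s) *\<^sub>R \<nu>) \<in> borel_measurable (lborel \<Otimes>\<^sub>M (lborel :: real measure))"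
    by measurable
  have "emeasure (distr M borel (\<lambda>(x, s). x + (a x - \<epsilon> * s) *\<^sub>R \<nu>)) A
     = (\<integral>\<^sup>+z. indicator A z \<partial>distr M borel (\<lambda>(x, s). x + (a x - \<epsilon> * s) *\<^sub>R \<nu>))"
    by (rule nn_integral_indicator[symmetric]) simp
  also have "\<dots> = (\<integral>\<^sup>+z. indicator A (case z of (x, s) \<Rightarrow> x + (a x - \<epsilon> * s) *\<^sub>R \<nu>) \<partial>M)"
    by (rule nn_integral_distr) (auto simp: M_def)
  also have "\<dots> = (\<integral>\<^sup>+z. (case z of (x, s) \<Rightarrow> ennreal (\<epsilon> * indicator (slab \<nu>) x)) * indicator A (case z of (x, s) \<Rightarrow> x + (a x - \<epsilon> * s) *\<^sub>R \<nu>) \<partial>(lborel \<Otimes>\<^sub>M lborel))"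
    unfolding M_def by (rule nn_integral_density) measurable
  also have "\<dots> = (\<integral>\<^sup>+x. \<integral>\<^sup>+s. ennreal (\<epsilon> * indicator (slab \<nu>) x) * indicator A (x + (a x - \<epsilon> * s) *\<^sub>R \<nu>) \<partial>lborel \<partial>lborel)"
    by (subst lborel.nn_integral_fst[symmetric]) (auto simp: split_beta')
  also have "\<dots> = (\<integral>\<^sup>+x. \<integral>\<^sup>+t. indicator (slab \<nu>) x * indicator A (x + t *\<^sub>R \<nu>) \<partial>lborel \<partial>lborel)"
  proof (rule nn_integral_cong)
    fix x :: 'a
    have "(\<integral>\<^sup>+t. indicator (slab \<nu>) x * indicator A (x + t *\<^sub>R \<nu>) \<partial>lborel)
       = ennreal \<bar>- \<epsilon>\<bar> * (\<integral>\<^sup>+s. indicator (slab \<nu>) x * indicator A (x + (a x + (- \<epsilon>) * s) *\<^sub>R \<nu>) \<partial>lborel)"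
      by (rule nn_integral_real_affine) (use \<epsilon> in auto)
    also have "\<dots> = (\<integral>\<^sup>+s. ennreal \<epsilon> * (indicator (slab \<nu>) x * indicator A (x + (a x - \<epsilon> * s) *\<^sub>R \<nu>)) \<partial>lborel)"
      using \<epsilon> by (subst nn_integral_cmult) auto
    also have "\<dots> = (\<integral>\<^sup>+s. ennreal (\<epsilon> * indicator (slab \<nu>) x) * indicator A (x + (a x - \<epsilon> * s) *\<^sub>R \<nu>) \<partial>lborel)"
      using \<epsilon> by (intro nn_integral_cong) (auto simp: indicator_def)
    finally show "(\<integral>\<^sup>+s. ennreal (\<epsilon> * indicator (slab \<nu>) x) * indicator A (x + (a x - \<epsilon> * s) *\<^sub>R \<nu>) \<partial>lborel)
        = (\<integral>\<^sup>+t. indicator (slab \<nu>) x * indicator A (x + t *\<^sub>R \<nu>) \<partial>lborel)" by simp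
  qed
  also have "\<dots> = (\<integral>\<^sup>+t. \<integral>\<^sup>+x. indicator (slab \<nu>) x * indicator A (x + t *\<^sub>R \<nu>) \<partial>lborel \<partial>lborel)"
    by (rule lborel_pair.Fubini') measurable
  also have "\<dots> = (\<integral>\<^sup>+t. \<integral>\<^sup>+y. indicator (slab \<nu>) (y - t *\<^sub>R \<nu>) * indicator A y \<partial>lborel \<partial>lborel)"
  proof (rule nn_integral_cong)
    fix t :: real
    have "(\<integral>\<^sup>+y. indicator (slab \<nu>) (y - t *\<^sub>R \<nu>) * indicator A y \<partial>lborel)
       = (\<integral>\<^sup>+y. indicator (slab \<nu>) (y - t *\<^sub>R \<nu>) * indicator A y \<partial>distr lborel borel ((+) (t *\<^sub>R \<nu>)))"
      by (simp only: lborel_distr_plus)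
    also have "\<dots> = (\<integral>\<^sup>+x. indicator (slab \<nu>) ((t *\<^sub>R \<nu> + x) - t *\<^sub>R \<nu>) * indicator A (t *\<^sub>R \<nu> + x) \<partial>lborel)"
      by (rule nn_integral_distr) auto
    finally show "(\<integral>\<^sup>+x. indicator (slab \<nu>) x * indicator A (x + t *\<^sub>R \<nu>) \<partial>lborel)
       = (\<integral>\<^sup>+y. indicator (slab \<nu>) (y - t *\<^sub>R \<nu>) * indicator A y \<partial>lborel)"
      by (simp add: add.commute)
  qed
  also have "\<dots> = (\<integral>\<^sup>+y. \<integral>\<^sup>+t. indicator (slab \<nu>) (y - t *\<^sub>R \<nu>) * indicator A y \<partial>lborel \<partial>lborel)"
    by (rule lborel_pair.Fubini'[symmetric]) measurable
  also have "\<dots> = (\<integral>\<^sup>+y. indicator A y \<partial>lborel)"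
  proof (rule nn_integral_cong)
    fix y :: 'a
    have "\<nu> \<bullet> \<nu> = 1" using \<nu> by (simp add: dot_square_norm)
    then have "(\<lambda>t. indicator (slab \<nu>) (y - t *\<^sub>R \<nu>) * indicator A y :: ennreal) = (\<lambda>t. indicator A y * indicator {y \<bullet> \<nu> - 1 <..< y \<bullet> \<nu>} t)"
      by (auto simp: indicator_def inner_diff_left fun_eq_iff)
    then show "(\<integral>\<^sup>+t. indicator (slab \<nu>) (y - t *\<^sub>R \<nu>) * indicator A y \<partial>lborel) = indicator A y"
      by (simp add: nn_integral_cmult)
  qed
  also have "\<dots> = emeasure lborel A" by simp
  finally show "emeasure (distr M borel (\<lambda>(x, s). x + (a x - \<epsilon> * s) *\<^sub>R \<nu>)) A = emeasure lborel A" .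
qed simp

lemma
  fixes \<nu> :: "'a::euclidean_space"
  assumes \<nu>: "norm \<nu> = 1" and [measurable]: "a \<in> borel_measurable borel" and \<epsilon>: "\<epsilon> > 0"
  shows slab_integral: "f \<in> borel_measurable borel \<Longrightarrow> (LBINT y. f y) = 
     (LINT z|(lborel \<Otimes>\<^sub>M (lborel :: real measure)). (\<epsilon> * indicator (slab \<nu>) (fst z)) * f (fst z + (a (fst z) - \<epsilon> * snd z) *\<^sub>R \<nu>) :: real)"
    and slab_AE: "(AE y in lborel. P y) \<Longrightarrow>
      (AE z in lborel \<Otimes>\<^sub>M (lborel :: real measure). fst z \<in> slab \<nu> \<longrightarrow> P (fst z + (a (fst z) - \<epsilon> * snd z) *\<^sub>R \<nu>))"
proof -
  let ?M = "density (lborel \<Otimes>\<^sub>M lborel) (\<lambda>(x, s::real). ennreal (\<epsilon> * indicator (slab \<nu>) x))"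
  let ?T = "\<lambda>(x, s). x + (a x - \<epsilon> * s) *\<^sub>R \<nu>"
  note D = slab_distr[OF assms(1,2) \<epsilon>]
  have [measurable]: "slab \<nu> \<in> sets borel" by measurable
  have T: "?T \<in> measurable ?M borel" by simp
  show "(LBINT y. f y) = 
     (LINT z|(lborel \<Otimes>\<^sub>M (lborel :: real measure)). (\<epsilon> * indicator (slab \<nu>) (fst z)) * f (fst z + (a (fst z) - \<epsilon> * snd z) *\<^sub>R \<nu>) :: real)"
    if [measurable]: "f \<in> borel_measurable borel"
  proof -
    have "(LBINT y. f y) = (LINT z|?M. f (?T z))"
      by (subst D[symmetric], rule integral_distr[OF T]) simp
    also have "?M = density (lborel \<Otimes>\<^sub>M lborel) (\<lambda>z. ennreal (\<epsilon> * indicator (slab \<nu>) (fst z)))"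
      by (simp add: split_beta')
    also have "(LINT z|\<dots>. f (?T z)) = (LINT z|(lborel \<Otimes>\<^sub>M lborel). (\<epsilon> * indicator (slab \<nu>) (fst z)) *\<^sub>R f (?T z))"
      by (rule integral_density) (use \<epsilon> in auto)
    finally show ?thesis by (simp add: split_beta')
  qed
  show "AE z in lborel \<Otimes>\<^sub>M (lborel :: real measure). fst z \<in> slab \<nu> \<longrightarrow> P (fst z + (a (fst z) - \<epsilon> * snd z) *\<^sub>R \<nu>)"
    if "AE y in lborel. P y"
  proof -
    have "AE y in distr ?M borel ?T. P y" using that by (simp only: D)
    then have "AE z in ?M. P (?T z)" by (rule AE_distrD[OF T])
    then have "AE z in lborel \<Otimes>\<^sub>M lborel. 0 < (case z of (x, s::real) \<Rightarrow> ennreal (\<epsilon> * indicator (slab \<nu>) x)) \<longrightarrow> P (?T z)"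
      by (subst (asm) AE_density) auto
    then show ?thesis
      by (rule eventually_mono) (use \<epsilon> in \<open>auto simp: split_beta'\<close>)
  qed
qed

section \<open>The divergence theorem near a boundary point\<close>

text \<open>
  The field \<open>q\<close> is taken to be continuous on the whole space; a field that is continuous on the
  closure of the domain is extended to such a field when the locale is instantiated.
\<close>

locale flux_domain =
  fixes \<Omega> :: "(real^'d) set" and n :: "real^'d \<Rightarrow> real^'d" and S :: "(real^'d) measure"
    and q :: "real^'d \<Rightarrow> real^'d" and r :: "real^'d \<Rightarrow> real"
  assumes \<Omega>: "open \<Omega>" "bounded \<Omega>" and normal: "outward_unit_normal \<Omega> n" and surface: "surface_measure \<Omega> S"
    and q: "continuous_on UNIV q" and r: "integrable (lebesgue_on \<Omega>) r"
    and div: "\<And>\<phi>. test_function \<Omega> \<phi> \<Longrightarrow> - (LINT x|lebesgue_on \<Omega>. q x \<bullet> grad \<phi> x) = (LINT x|lebesgue_on \<Omega>. \<phi> x * r x)"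

text \<open>
  The surface measure and the normal each come with an almost everywhere gradient of \<open>g\<close>. Here one
  gradient \<open>Dg\<close> serves both, which is possible because any two agree almost everywhere.
\<close>

locale boundary_chart = flux_domain \<Omega> n S q r 
  for \<Omega> :: "(real^'d) set" and n S q r +
  fixes N :: "(real^'d) set" and \<nu> :: "real^'d" and g :: "real^'d \<Rightarrow> real" and L0 :: real and Dg
  assumes N: "open N" and \<nu>: "norm \<nu> = 1" and L0: "L0 \<ge> 0" "\<And>x y. \<bar>g x - g y\<bar> \<le> L0 * norm (x - y)"
    and inv: "\<And>x t. g (x + t *\<^sub>R \<nu>) = g x" and mem: "\<And>x. x \<in> N \<Longrightarrow> x \<in> \<Omega> \<longleftrightarrow> x \<bullet> \<nu> < g x"
    and Dgm[measurable]: "Dg \<in> borel_measurable borel"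
    and Dg: "AE x in lborel. (g has_derivative (\<lambda>h. Dg x \<bullet> h)) (at x)"
    and emS: "\<And>B. B \<in> sets borel \<Longrightarrow> B \<subseteq> N \<inter> frontier \<Omega> \<Longrightarrow>
              emeasure S B =
                (\<integral>\<^sup>+x. ennreal (indicator (slab \<nu>) x *
                               indicator B (graph_point \<nu> g x) *
                               sqrt (1 + (norm (Dg x))\<^sup>2)) \<partial>lborel)"
    and nDg: "AE x in lborel. graph_point \<nu> g x \<in> N \<longrightarrow>
              n (graph_point \<nu> g x) = (1 / sqrt (1 + (norm (Dg x))\<^sup>2)) *\<^sub>R (\<nu> - Dg x)"

lemma (in flux_domain) boundary_chartI:
  assumes "lipschitz_chart \<Omega> N \<nu> g"
  shows "\<exists>L0 Dg. boundary_chart \<Omega> n S q r N \<nu> g L0 Dg"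
proof -
  obtain L0 where L0: "L0-lipschitz_on UNIV g" using assms by (auto simp: lipschitz_chart_def)
  obtain D1 where D1: "ae_gradient g D1"
    "AE x in lborel. graph_point \<nu> g x \<in> N \<longrightarrow>
              n (graph_point \<nu> g x) = (1 / sqrt (1 + (norm (D1 x))\<^sup>2)) *\<^sub>R (\<nu> - D1 x)"
    using normal assms unfolding outward_unit_normal_def by blast
  obtain D2 where D2: "ae_gradient g D2"
    "\<forall>B\<in>sets borel. B \<subseteq> N \<inter> frontier \<Omega> \<longrightarrow>
              emeasure S B =
                (\<integral>\<^sup>+x. ennreal (indicator (slab \<nu>) x *
                               indicator B (graph_point \<nu> g x) *
                               sqrt (1 + (norm (D2 x))\<^sup>2)) \<partial>lborel)"
    using surface assms unfolding surface_measure_def by blast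
  have D1': "AE x in lborel. (g has_derivative (\<lambda>h. D1 x \<bullet> h)) (at x)" using D1(1) unfolding ae_gradient_def by blast
  have D2': "AE x in lborel. (g has_derivative (\<lambda>h. D2 x \<bullet> h)) (at x)" using D2(1) unfolding ae_gradient_def by blast
  have "AE x in lborel. D1 x = D2 x"
    using D1' D2'
  proof eventually_elim
    case (elim x)
    then have "(\<lambda>h. D1 x \<bullet> h) = (\<lambda>h. D2 x \<bullet> h)" by (rule has_derivative_unique)
    then show ?case by (rule inner_right_cancel_fun)
  qed
  with D1(2) have nD2: "AE x in lborel. graph_point \<nu> g x \<in> N \<longrightarrow>
              n (graph_point \<nu> g x) = (1 / sqrt (1 + (norm (D2 x))\<^sup>2)) *\<^sub>R (\<nu> - D2 x)"
    by eventually_elim simp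
  have mem: "x \<in> \<Omega> \<longleftrightarrow> x \<bullet> \<nu> < g x" if "x \<in> N" for x
  proof -
    have "\<Omega> \<inter> N = {x \<in> N. x \<bullet> \<nu> < g x}" using assms by (simp add: lipschitz_chart_def)
    then show ?thesis using that by blast
  qed
  have "boundary_chart_axioms \<Omega> n S N \<nu> g L0 D2"
  proof
    show "open N" "norm \<nu> = 1" "g (x + t *\<^sub>R \<nu>) = g x" for x t
      using assms by (simp_all add: lipschitz_chart_def)
    show "0 \<le> L0" "\<bar>g x - g y\<bar> \<le> L0 * norm (x - y)" for x y
      using L0 by (auto simp: lipschitz_on_def dist_norm)
    show "D2 \<in> borel_measurable borel" using D2 by (simp add: ae_gradient_def)
  qed (use mem D2' D2(2) nD2 in auto)
  then show ?thesis using flux_domain_axioms boundary_chart.intro by blast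
qed

context boundary_chart
begin

abbreviation gp where "gp \<equiv> graph_point \<nu> g"

text \<open>
  The depth below the graph in direction \<open>\<nu>\<close>: positive exactly in the domain, as long as the point
  lies in the chart.
\<close>

definition height :: "real^'d \<Rightarrow> real" where "height x = g x - x \<bullet> \<nu>"

lemma \<nu>\<nu>: "\<nu> \<bullet> \<nu> = 1" using \<nu> by (simp add: dot_square_norm)

lemma gp_eq: "gp x = x + height x *\<^sub>R \<nu>" by (simp add: graph_point_def height_def)

lemma height_shift: "height (x + t *\<^sub>R \<nu>) = height x - t"
  using \<nu>\<nu> by (simp add: height_def inv inner_add_left)

lemma g_cont: "continuous_on UNIV g" by (rule lipschitz_imp_continuous[OF L0(2,1)])

lemma height_cont: "continuous_on UNIV height"
  unfolding height_def by (intro continuous_intros g_cont)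

lemma gp_cont: "continuous_on UNIV gp"
  unfolding gp_eq[abs_def] by (intro continuous_intros height_cont)

lemmas [measurable] = borel_measurable_continuous_onI[OF height_cont] borel_measurable_continuous_onI[OF gp_cont]
  borel_measurable_continuous_onI[OF q] borel_measurable_continuous_onI[OF continuous_tent]

lemma slab_measurable[measurable]: "slab \<nu> \<in> sets borel" by measurable

lemma height_lipschitz: "\<bar>height x - height y\<bar> \<le> (L0 + 1) * norm (x - y)"
proof -
  have "\<bar>(x - y) \<bullet> \<nu>\<bar> \<le> norm (x - y)" using Cauchy_Schwarz_ineq2[of "x - y" \<nu>] \<nu> by simp
  then show ?thesis using L0(2)[of x y] by (simp add: height_def inner_diff_left distrib_right)
qed

lemma mem_height: "x \<in> N \<Longrightarrow> x \<in> \<Omega> \<longleftrightarrow> height x > 0"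
  using mem by (auto simp: height_def)

lemma Dg_bound: "AE x in lborel. norm (Dg x) \<le> L0"
  using Dg by eventually_elim (rule lipschitz_gradient_bound[OF _ L0(2,1)])

lemma Dg_shift:
  assumes "(g has_derivative (\<lambda>h. Dg x \<bullet> h)) (at x)"
    and "(g has_derivative (\<lambda>h. Dg (x + t *\<^sub>R \<nu>) \<bullet> h)) (at (x + t *\<^sub>R \<nu>))"
  shows "Dg (x + t *\<^sub>R \<nu>) = Dg x"
proof -
  have "((\<lambda>y. g (y + t *\<^sub>R \<nu>)) has_derivative (\<lambda>h. Dg (x + t *\<^sub>R \<nu>) \<bullet> h)) (at x)"
    by (rule has_derivative_compose[of "\<lambda>y. y + t *\<^sub>R \<nu>" "\<lambda>h. h" x UNIV g])
       (auto intro!: derivative_eq_intros assms(2))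
  then have "(g has_derivative (\<lambda>h. Dg (x + t *\<^sub>R \<nu>) \<bullet> h)) (at x)" by (simp add: inv)
  then have "(\<lambda>h. Dg (x + t *\<^sub>R \<nu>) \<bullet> h) = (\<lambda>h. Dg x \<bullet> h)" using assms(1) by (rule has_derivative_unique)
  then show ?thesis by (rule inner_right_cancel_fun)
qed

lemma gp_frontier: "gp x \<in> N \<Longrightarrow> gp x \<in> frontier \<Omega>"
proof -
  assume p: "gp x \<in> N"
  have h0: "height (gp x) = 0" by (simp add: gp_eq height_shift)
  have "gp x \<notin> \<Omega>" using mem_height[OF p] h0 by simp
  moreover have "gp x \<in> closure \<Omega>"
  proof (rule closure_sequential[THEN iffD2])
    obtain e where e: "e > 0" "ball (gp x) e \<subseteq> N" using N p open_contains_ball by blast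
    define s where "s k = gp x + (- (e / 2 * inverse (real (Suc k)))) *\<^sub>R \<nu>" for k
    have "s k \<in> \<Omega>" for k
    proof -
      have "dist (gp x) (s k) = e / 2 * inverse (real (Suc k))" using \<nu> e by (simp add: s_def dist_norm)
      also have "\<dots> < e" using e by (simp add: field_simps) (smt (verit) mult_nonneg_nonneg of_nat_0_le_iff)
      finally have "s k \<in> N" using e by auto
      moreover have "height (s k) > 0" unfolding s_def height_shift h0 using e by simp
      ultimately show ?thesis using mem_height by blast
    qed
    moreover have "s \<longlonglongrightarrow> gp x + (- (e / 2 * 0)) *\<^sub>R \<nu>"
      unfolding s_def by (intro tendsto_intros LIMSEQ_inverse_real_of_nat)
    ultimately show "\<exists>s. (\<forall>k. s k \<in> \<Omega>) \<and> s \<longlonglongrightarrow> gp x" by auto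
  qed
  ultimately show ?thesis using \<Omega>(1) by (simp add: frontier_def interior_open)
qed

text \<open>
  Both sides are integrals with respect to one Borel measure, the part of the surface measure in
  the chart and the image of a weighted Lebesgue measure under the graph map; the defining formula of
  the surface measure says that the two measures agree.
\<close>

lemma surface_integral:
  fixes f :: "real^'d \<Rightarrow> real"
  assumes [measurable]: "f \<in> borel_measurable borel" and f0: "\<And>x. x \<in> frontier \<Omega> \<Longrightarrow> x \<notin> N \<Longrightarrow> f x = 0"
  defines "F \<equiv> \<lambda>x. (indicator (slab \<nu>) x * indicator N (gp x) * sqrt (1 + (norm (Dg x))\<^sup>2)) * f (gp x)"
  shows "(LINT x|S. f x) = (LBINT x. F x)" "integrable S f \<longleftrightarrow> integrable lborel F"
proof -
  have [measurable]: "N \<in> sets borel" using N by simp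
  have fr[measurable]: "frontier \<Omega> \<in> sets borel" by (simp add: frontier_closed borel_closed)
  have setsS: "sets S = sets (restrict_space borel (frontier \<Omega>))" using surface by (simp add: surface_measure_def)
  have spS: "space S = frontier \<Omega>" using sets_eq_imp_space_eq[OF setsS] by (simp add: space_restrict_space)
  let ?A = "N \<inter> frontier \<Omega>"
  have A: "?A \<inter> space S \<in> sets S" by (auto simp: spS setsS sets_restrict_space_iff)
  let ?R = "restrict_space S ?A"
  have spR: "space ?R = ?A" by (auto simp: space_restrict_space spS)
  have id: "(\<lambda>x. x) \<in> measurable ?R borel"
  proof (rule measurableI)
    fix B :: "(real^'d) set" assume [measurable]: "B \<in> sets borel"
    show "(\<lambda>x. x) -` B \<inter> space ?R \<in> sets ?R"
      unfolding spR using A by (auto simp: sets_restrict_space_iff setsS spS Int_absorb2)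
  qed simp
  let ?w = "\<lambda>x. indicator (slab \<nu>) x * indicator N (gp x) * sqrt (1 + (norm (Dg x))\<^sup>2)"
  let ?M = "density lborel (\<lambda>x. ennreal (?w x))"
  have eq: "distr ?R borel (\<lambda>x. x) = distr ?M borel gp"
  proof (rule measure_eqI)
    fix B assume "B \<in> sets (distr ?R borel (\<lambda>x. x))"
    then have [measurable]: "B \<in> sets borel" by simp
    have "emeasure (distr ?R borel (\<lambda>x. x)) B = emeasure ?R (B \<inter> ?A)"
      by (subst emeasure_distr[OF id]) (auto simp: spR)
    also have "\<dots> = emeasure S (B \<inter> ?A)"
      by (rule emeasure_restrict_space) (use A in auto)
    also have "\<dots> = (\<integral>\<^sup>+x. ennreal (indicator (slab \<nu>) x * indicator (B \<inter> ?A) (gp x) *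
                               sqrt (1 + (norm (Dg x))\<^sup>2)) \<partial>lborel)"
      by (rule emS) auto
    also have "\<dots> = (\<integral>\<^sup>+x. ennreal (?w x) * indicator B (gp x) \<partial>lborel)"
      by (rule nn_integral_cong) (use gp_frontier in \<open>auto simp: indicator_def\<close>)
    also have "\<dots> = (\<integral>\<^sup>+x. indicator B (gp x) \<partial>?M)"
      by (subst nn_integral_density) auto
    also have "\<dots> = (\<integral>\<^sup>+x. indicator B x \<partial>distr ?M borel gp)"
      by (rule nn_integral_distr[symmetric]) auto
    also have "\<dots> = emeasure (distr ?M borel gp) B" by (rule nn_integral_indicator) simp
    finally show "emeasure (distr ?R borel (\<lambda>x. x)) B = emeasure (distr ?M borel gp) B" .
  qed simp
  have gpM: "gp \<in> measurable ?M borel" by simp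
  have ind: "indicator ?A x *\<^sub>R f x = f x" if "x \<in> space S" for x
    using f0[of x] that by (auto simp: spS indicator_def)
  have "(LINT x|S. f x) = (LINT x|S. indicator ?A x *\<^sub>R f x)"
    by (rule Bochner_Integration.integral_cong) (use ind in auto)
  also have "\<dots> = (LINT x|?R. f x)" by (rule integral_restrict_space[symmetric, OF A])
  also have "\<dots> = (LINT x|distr ?R borel (\<lambda>x. x). f x)" by (rule integral_distr[symmetric, OF id]) simp
  also have "\<dots> = (LINT x|?M. f (gp x))" unfolding eq by (rule integral_distr[OF gpM]) simp
  also have "\<dots> = (LBINT x. F x)"
    unfolding F_def by (subst integral_density) auto
  finally show "(LINT x|S. f x) = (LBINT x. F x)" .
  have "integrable S f \<longleftrightarrow> integrable S (\<lambda>x. indicator ?A x *\<^sub>R f x)"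
    by (rule Bochner_Integration.integrable_cong) (use ind in auto)
  also have "\<dots> \<longleftrightarrow> integrable ?R f" by (rule integrable_restrict_space[symmetric, OF A])
  also have "\<dots> \<longleftrightarrow> integrable (distr ?R borel (\<lambda>x. x)) f"
    by (subst integrable_distr_eq[OF id]) auto
  also have "\<dots> \<longleftrightarrow> integrable ?M (\<lambda>x. f (gp x))" unfolding eq by (rule integrable_distr_eq[OF gpM]) simp
  also have "\<dots> \<longleftrightarrow> integrable lborel F"
    unfolding F_def by (subst integrable_density) auto
  finally show "integrable S f \<longleftrightarrow> integrable lborel F" .
qed

text \<open>
  Along \<open>\<nu>\<close> a point of the slab is bounded by the thickness, and across \<open>\<nu>\<close> it has the same component
  as \<open>x + t *\<^sub>R \<nu>\<close>. Hence integrands supported in a compact set have a bounded range of base points.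
\<close>

lemma slab_bounded:
  assumes "x \<in> slab \<nu>" "norm (x + t *\<^sub>R \<nu>) \<le> R"
  shows "norm x \<le> 2 * R + 1"
proof -
  let ?p = "x + t *\<^sub>R \<nu>"
  have "x = ?p + (x \<bullet> \<nu> - ?p \<bullet> \<nu>) *\<^sub>R \<nu>" using \<nu>\<nu> by (simp add: inner_add_left)
  then have "norm x \<le> norm ?p + norm ((x \<bullet> \<nu> - ?p \<bullet> \<nu>) *\<^sub>R \<nu>)" by (metis norm_triangle_ineq)
  moreover have "\<bar>x \<bullet> \<nu> - ?p \<bullet> \<nu>\<bar> \<le> 1 + norm ?p"
    using Cauchy_Schwarz_ineq2[of ?p \<nu>] \<nu> assms(1) by auto
  ultimately show ?thesis using assms(2) \<nu> by simp
qed

context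
  fixes \<theta> :: "real^'d \<Rightarrow> real" and C R K
  assumes \<theta>: "smooth \<theta>" and C: "compact C" "C \<subseteq> N" "\<And>x. x \<notin> C \<Longrightarrow> \<theta> x = 0"
    and R: "\<And>x. x \<in> C \<Longrightarrow> norm x \<le> R" and K: "\<And>x. \<bar>\<theta> x\<bar> * norm (q x) \<le> K"
begin

lemma \<theta>_cont: "continuous_on UNIV \<theta>" by (rule smooth_imp_continuous[OF \<theta>])

lemmas [measurable] = borel_measurable_continuous_onI[OF \<theta>_cont]

lemma K0: "K \<ge> 0" using K[of 0] by (meson abs_ge_zero mult_nonneg_nonneg norm_ge_zero order_trans)

lemma integrand_bound:
  assumes "norm (Dg x) \<le> L0"
  shows "\<bar>indicator (slab \<nu>) x * (\<theta> (x + t *\<^sub>R \<nu>) * (q (x + t *\<^sub>R \<nu>) \<bullet> (Dg x - \<nu>)))\<bar>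
      \<le> K * (L0 + 1) * indicator (cball 0 (2 * R + 1)) x"
proof (cases "x \<in> slab \<nu> \<and> x + t *\<^sub>R \<nu> \<in> C")
  case True
  let ?p = "x + t *\<^sub>R \<nu>"
  have "norm (Dg x - \<nu>) \<le> L0 + 1" using norm_triangle_ineq4[of "Dg x" \<nu>] assms \<nu> by linarith
  then have "\<bar>\<theta> ?p\<bar> * \<bar>q ?p \<bullet> (Dg x - \<nu>)\<bar> \<le> \<bar>\<theta> ?p\<bar> * (norm (q ?p) * (L0 + 1))"
    by (intro mult_left_mono order_trans[OF Cauchy_Schwarz_ineq2]) auto
  also have "\<dots> \<le> K * (L0 + 1)"
    using mult_right_mono[OF K[of ?p], of "L0 + 1"] L0 by (simp add: mult.assoc)
  finally show ?thesis using True slab_bounded[of x t R] R[of ?p] by (simp add: abs_mult)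
next
  case False
  then show ?thesis using C(3)[of "x + t *\<^sub>R \<nu>"] K0 L0 by (auto simp: indicator_def)
qed

lemma graph_integrable:
  "integrable lborel (\<lambda>x. indicator (slab \<nu>) x * (\<theta> (gp x) * (q (gp x) \<bullet> (Dg x - \<nu>))))"
proof (rule Bochner_Integration.integrable_bound)
  show "integrable lborel (\<lambda>x::real^'d. K * (L0 + 1) * indicator (cball 0 (2 * R + 1)) x :: real)"
    by (intro integrable_mult_right integrable_real_indicator emeasure_compact_finite) auto
  show "AE x in lborel. norm (indicator (slab \<nu>) x * (\<theta> (gp x) * (q (gp x) \<bullet> (Dg x - \<nu>))))
       \<le> norm (K * (L0 + 1) * indicator (cball 0 (2 * R + 1)) x)"
    using Dg_bound
  proof eventually_elim
    case (elim x)
    show ?case using integrand_bound[OF elim, of "height x"] by (simp add: gp_eq)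
  qed
qed measurable

text \<open>
  The area factor \<open>sqrt (1 + |Dg|\<^sup>2)\<close> cancels the normalization of \<open>n = (\<nu> - Dg) / sqrt (1 + |Dg|\<^sup>2)\<close>.
\<close>

lemma normal_flux:
  shows "integrable S (\<lambda>x. \<theta> x * (q x \<bullet> n x))"
    and "(LINT x|S. \<theta> x * (q x \<bullet> n x)) = - (LBINT x. indicator (slab \<nu>) x * (\<theta> (gp x) * (q (gp x) \<bullet> (Dg x - \<nu>))))"
proof -
  have fr[measurable]: "frontier \<Omega> \<in> sets borel" by (simp add: frontier_closed borel_closed)
  have setsS: "sets S = sets (restrict_space borel (frontier \<Omega>))" using surface by (simp add: surface_measure_def)
  have spS: "space S = frontier \<Omega>" using sets_eq_imp_space_eq[OF setsS] by (simp add: space_restrict_space)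
  define n' where "n' x = indicator (frontier \<Omega>) x *\<^sub>R n x" for x
  have [measurable]: "n' \<in> borel_measurable borel"
    using normal unfolding outward_unit_normal_def n'_def by (simp add: borel_measurable_restrict_space_iff)
  have [measurable]: "N \<in> sets borel" using N by simp
  let ?f = "\<lambda>x. \<theta> x * (q x \<bullet> n' x)"
  have cong: "\<theta> x * (q x \<bullet> n x) = ?f x" if "x \<in> space S" for x using that by (simp add: n'_def spS)
  let ?F = "\<lambda>x. (indicator (slab \<nu>) x * indicator N (gp x) * sqrt (1 + (norm (Dg x))\<^sup>2)) * ?f (gp x)"
  have f0: "?f x = 0" if "x \<notin> N" for x using C that by auto
  have fm: "?f \<in> borel_measurable borel" by measurable
  note SI = surface_integral[OF fm f0]
  let ?G = "\<lambda>x. indicator (slab \<nu>) x * (\<theta> (gp x) * (q (gp x) \<bullet> (Dg x - \<nu>)))"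
  have Fm: "?F \<in> borel_measurable lborel" "?G \<in> borel_measurable lborel" by measurable
  have AE: "AE x in lborel. ?F x = - ?G x"
    using nDg
  proof eventually_elim
    case (elim x)
    show ?case
    proof (cases "gp x \<in> N")
      case True
      have w: "sqrt (1 + (norm (Dg x))\<^sup>2) > 0" by (smt (verit) real_sqrt_gt_zero zero_le_power2)
      have "q (gp x) \<bullet> n' (gp x) = (1 / sqrt (1 + (norm (Dg x))\<^sup>2)) * (q (gp x) \<bullet> (\<nu> - Dg x))"
        using elim True gp_frontier[OF True] by (simp add: n'_def)
      then have W: "sqrt (1 + (norm (Dg x))\<^sup>2) * (q (gp x) \<bullet> n' (gp x)) = q (gp x) \<bullet> (\<nu> - Dg x)"
        using w by simp
      have "?F x = indicator (slab \<nu>) x * \<theta> (gp x) * (sqrt (1 + (norm (Dg x))\<^sup>2) * (q (gp x) \<bullet> n' (gp x)))"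
        using True by simp
      then show ?thesis unfolding W by (simp add: inner_diff_right algebra_simps)
    next
      case False
      then have "\<theta> (gp x) = 0" using C by auto
      then show ?thesis by simp
    qed
  qed
  have "integrable lborel ?F"
    by (subst integrable_cong_AE[where g="\<lambda>x. - ?G x"]) (use AE Fm graph_integrable in auto)
  then have "integrable S ?f" using SI(2) by simp
  then show "integrable S (\<lambda>x. \<theta> x * (q x \<bullet> n x))"
    by (rule Bochner_Integration.integrable_cong[THEN iffD2, rotated 2]) (use cong in auto)
  have "(LINT x|S. \<theta> x * (q x \<bullet> n x)) = (LINT x|S. ?f x)"
    by (rule Bochner_Integration.integral_cong) (use cong in auto)
  also have "\<dots> = (LBINT x. ?F x)" using SI(1) by simp
  also have "\<dots> = (LBINT x. - ?G x)" by (rule integral_cong_AE) (use AE Fm in auto)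
  finally show "(LINT x|S. \<theta> x * (q x \<bullet> n x)) = - (LBINT x. ?G x)" by simp
qed

text \<open>
  In the coordinates of \<open>slab_integral\<close> with origin \<open>height x - \<epsilon> k\<close>, the point with parameter \<open>s\<close> has
  depth \<open>\<epsilon> k (s + 1)\<close>. The profile thus becomes \<open>tent s\<close>, independently of \<open>k\<close>, the factor \<open>1 / \<epsilon> k\<close>
  is absorbed by the change of variables, and \<open>Dg\<close> is constant along the lines. What is left of the
  dependence on \<open>k\<close> is the evaluation of \<open>\<theta>\<close> and \<open>q\<close> at a point that tends to the graph, and dominated
  convergence applies.
\<close>

lemma boundary_layer_limit:
  assumes \<epsilon>: "\<And>k. \<epsilon> k > 0" "\<epsilon> \<longlonglongrightarrow> 0"
  shows "(\<lambda>k. LBINT y. tent (height y / \<epsilon> k - 1) / \<epsilon> k * (\<theta> y * (q y \<bullet> (Dg y - \<nu>))))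
    \<longlonglongrightarrow> (LBINT x. indicator (slab \<nu>) x * (\<theta> (gp x) * (q (gp x) \<bullet> (Dg x - \<nu>))))"
proof -
  let ?P = "lborel \<Otimes>\<^sub>M (lborel :: real measure)"
  define p where "p k z = fst z + (height (fst z) - \<epsilon> k - \<epsilon> k * snd z) *\<^sub>R \<nu>" for k and z :: "(real^'d) \<times> real"
  have pm[measurable]: "p k \<in> borel_measurable ?P" for k unfolding p_def by measurable
  define s where "s k z = tent (snd z) * (indicator (slab \<nu>) (fst z) * (\<theta> (p k z) * (q (p k z) \<bullet> (Dg (fst z) - \<nu>))))" for k z
  define l where "l z = tent (snd z) * (indicator (slab \<nu>) (fst z) * (\<theta> (gp (fst z)) * (q (gp (fst z)) \<bullet> (Dg (fst z) - \<nu>))))" for z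
  have sm[measurable]: "s k \<in> borel_measurable ?P" for k unfolding s_def by measurable
  have lm[measurable]: "l \<in> borel_measurable ?P" unfolding l_def by measurable
  define w where "w z = K * (L0 + 1) * indicator (cball 0 (2 * R + 1) \<times> {0..2}) z" for z :: "(real^'d) \<times> real"
  have w: "integrable ?P w"
  proof -
    have "emeasure ?P (cball (0::real^'d) (2 * R + 1) \<times> {0..2::real}) = emeasure lborel (cball (0::real^'d) (2 * R + 1)) * emeasure lborel {0..2::real}"
      using lborel.emeasure_pair_measure_Times[of "cball (0::real^'d) (2 * R + 1)" lborel "{0..2::real}"] by simp
    also have "\<dots> < \<infinity>"
      using emeasure_compact_finite[of "cball (0::real^'d) (2 * R + 1)"] by (auto simp: ennreal_mult_less_top)
    finally show ?thesis unfolding w_def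
      by (intro integrable_mult_right integrable_real_indicator) auto
  qed
  have DgP: "AE z in ?P. (g has_derivative (\<lambda>h. Dg (fst z) \<bullet> h)) (at (fst z)) \<and> norm (Dg (fst z)) \<le> L0"
  proof -
    have "AE x in lborel. (g has_derivative (\<lambda>h. Dg x \<bullet> h)) (at x) \<and> norm (Dg x) \<le> L0"
      using Dg Dg_bound by eventually_elim simp
    from AE_E[OF this] obtain Z where Z: "{x \<in> space lborel. \<not> ((g has_derivative (\<lambda>h. Dg x \<bullet> h)) (at x) \<and> norm (Dg x) \<le> L0)} \<subseteq> Z"
      "emeasure lborel Z = 0" "Z \<in> sets lborel" by blast
    have "Z \<times> UNIV \<in> null_sets ?P"
      using Z(2,3) lborel.emeasure_pair_measure_Times[of Z lborel UNIV] by (auto simp: null_sets_def)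
    from AE_not_in[OF this] show ?thesis
      by eventually_elim (use Z(1) in \<open>auto simp: space_pair_measure mem_Times_iff\<close>)
  qed
  have sw: "AE z in ?P. norm (s k z) \<le> w z" for k
    using DgP
  proof eventually_elim
    case (elim z)
    have b: "\<bar>indicator (slab \<nu>) (fst z) * (\<theta> (p k z) * (q (p k z) \<bullet> (Dg (fst z) - \<nu>)))\<bar> \<le> K * (L0 + 1) * indicator (cball 0 (2 * R + 1)) (fst z)"
      unfolding p_def by (rule integrand_bound) (use elim in simp)
    show ?case
    proof (cases "snd z \<in> {0..2}")
      case True
      have "norm (s k z) \<le> 1 * (K * (L0 + 1) * indicator (cball 0 (2 * R + 1)) (fst z))"
        unfolding s_def norm_mult[of "tent _"]
        by (intro mult_mono) (use b tent_bounds in auto)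
      then show ?thesis using True by (auto simp: w_def indicator_def mem_Times_iff)
    next
      case False
      then have "tent (snd z) = 0" using tent_bounds(3,4) by force
      then show ?thesis using K0 L0 by (simp add: s_def w_def)
    qed
  qed
  have lim: "AE z in ?P. (\<lambda>k. s k z) \<longlonglongrightarrow> l z"
  proof (intro AE_I2)
    fix z :: "(real^'d) \<times> real"
    have p: "(\<lambda>k. p k z) \<longlonglongrightarrow> fst z + (height (fst z) - 0 - 0 * snd z) *\<^sub>R \<nu>"
      unfolding p_def by (intro tendsto_intros \<epsilon>)
    then have p': "(\<lambda>k. p k z) \<longlonglongrightarrow> gp (fst z)" by (simp add: gp_eq)
    have "(\<lambda>k. \<theta> (p k z)) \<longlonglongrightarrow> \<theta> (gp (fst z))" "(\<lambda>k. q (p k z)) \<longlonglongrightarrow> q (gp (fst z))"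
      using continuous_on_tendsto_compose[OF \<theta>_cont p'] continuous_on_tendsto_compose[OF q p'] by auto
    then show "(\<lambda>k. s k z) \<longlonglongrightarrow> l z" unfolding s_def l_def by (intro tendsto_intros)
  qed
  have main: "(\<lambda>k. LINT z|?P. s k z) \<longlonglongrightarrow> (LINT z|?P. l z)"
    by (rule integral_dominated_convergence[where w=w]) (use w lim sw in auto)
  have li: "integrable ?P l"
    by (rule integrable_dominated_convergence[where w=w and s=s]) (use w lim sw in auto)
  have "(LINT z|?P. l z) = (LBINT x. (LBINT t. l (x, t)))"
    by (rule lborel_pair.integral_fst'[symmetric, OF li])
  also have "\<dots> = (LBINT x. indicator (slab \<nu>) x * (\<theta> (gp x) * (q (gp x) \<bullet> (Dg x - \<nu>))))"
    by (simp add: l_def integral_tent)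
  finally have L: "(LINT z|?P. l z) = (LBINT x. indicator (slab \<nu>) x * (\<theta> (gp x) * (q (gp x) \<bullet> (Dg x - \<nu>))))" .
  have "(LBINT y. tent (height y / \<epsilon> k - 1) / \<epsilon> k * (\<theta> y * (q y \<bullet> (Dg y - \<nu>)))) = (LINT z|?P. s k z)" for k
  proof -
    let ?F = "\<lambda>y. tent (height y / \<epsilon> k - 1) / \<epsilon> k * (\<theta> y * (q y \<bullet> (Dg y - \<nu>)))"
    have Fm: "?F \<in> borel_measurable borel" by measurable
    have am: "(\<lambda>x. height x - \<epsilon> k) \<in> borel_measurable borel" by measurable
    have "(LBINT y. ?F y) = (LINT z|?P. (\<epsilon> k * indicator (slab \<nu>) (fst z)) * ?F (p k z))"
      unfolding p_def by (rule slab_integral[OF \<nu> am \<epsilon>(1) Fm])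
    also have "\<dots> = (LINT z|?P. s k z)"
    proof (rule integral_cong_AE)
      show "(\<lambda>z. (\<epsilon> k * indicator (slab \<nu>) (fst z)) * ?F (p k z)) \<in> borel_measurable ?P"
        using Fm by measurable
      show "AE z in ?P. (\<epsilon> k * indicator (slab \<nu>) (fst z)) * ?F (p k z) = s k z"
        using slab_AE[OF \<nu> am \<epsilon>(1)[of k] Dg] DgP
      proof eventually_elim
        case (elim z)
        show ?case
        proof (cases "fst z \<in> slab \<nu>")
          case True
          have h: "height (p k z) / \<epsilon> k - 1 = snd z"
            unfolding p_def height_shift using \<epsilon>(1)[of k] by (simp add: field_simps)
          have "Dg (p k z) = Dg (fst z)"
            unfolding p_def by (rule Dg_shift) (use elim True in auto)
          then show ?thesis using True \<epsilon>(1)[of k] by (simp add: s_def h)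
        qed (simp add: s_def)
      qed
    qed simp
    finally show ?thesis .
  qed
  with main L show ?thesis by simp
qed
end
end

lemma lborel_integrable_imp_lebesgue_on:
  fixes f :: "'a::euclidean_space \<Rightarrow> real"
  assumes f: "integrable lborel f" and \<Omega>: "\<Omega> \<in> sets lebesgue"
  shows "integrable (lebesgue_on \<Omega>) f"
proof -
  have "f \<in> borel_measurable lborel" using f by auto
  then have "integrable lebesgue f" using f integrable_completion by blast
  then have "integrable lebesgue (\<lambda>x. indicator \<Omega> x *\<^sub>R f x)"
    by (rule integrable_mult_indicator[OF \<Omega>])
  moreover have "integrable (lebesgue_on \<Omega>) f \<longleftrightarrow> integrable lebesgue (\<lambda>x. indicator \<Omega> x *\<^sub>R f x)"
    by (rule integrable_restrict_space) (use \<Omega> in auto)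
  ultimately show ?thesis by simp
qed

context boundary_chart
begin

lemma \<Omega>_lebesgue: "\<Omega> \<in> sets lebesgue" using \<Omega>(1) by auto

text \<open>
  The profile is shifted by one, so that the cut-off function vanishes where the depth is less than
  \<open>\<epsilon>\<close>; its support is then compact in the domain.
\<close>

lemma cutoff_lipschitz_test:
  assumes \<theta>: "smooth \<theta>" and C: "compact C" "C \<subseteq> N" "\<And>x. x \<notin> C \<Longrightarrow> \<theta> x = 0" and \<epsilon>: "\<epsilon> > 0"
  shows "\<exists>L. lipschitz_test L \<Omega> (\<lambda>x. \<theta> x * step (height x / \<epsilon> - 1))
    (\<lambda>x. step (height x / \<epsilon> - 1) *\<^sub>R grad \<theta> x + (tent (height x / \<epsilon> - 1) / \<epsilon> * \<theta> x) *\<^sub>R (Dg x - \<nu>))"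
proof -
  have T: "C1_test N \<theta> (grad \<theta>)"
    unfolding C1_test_def using smooth_has_grad[OF \<theta>] continuous_on_grad[OF \<theta>] C by blast
  obtain L where L: "lipschitz_test L N \<theta> (grad \<theta>)" by (rule C1_test_lipschitz_test[OF T])
  obtain c where c: "c \<ge> 0" "\<And>x. \<bar>\<theta> x\<bar> \<le> c" using lipschitz_test_bounded(1)[OF L] by blast
  note LD = lipschitz_testD[OF L]
  let ?h = "\<lambda>x. height x / \<epsilon> - 1"
  let ?\<psi> = "\<lambda>x. \<theta> x * step (?h x)"
  let ?G = "\<lambda>x. step (?h x) *\<^sub>R grad \<theta> x + (tent (?h x) / \<epsilon> * \<theta> x) *\<^sub>R (Dg x - \<nu>)"
  have grad0: "grad \<theta> x = 0" if "x \<notin> C" for x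
    by (rule gradient_zero_outside_support[where \<psi>=\<theta> and C=C])
       (use smooth_has_grad[OF \<theta>] C that compact_imp_closed in auto)
  note [measurable] = borel_measurable_continuous_onI[OF continuous_step] borel_measurable_continuous_onI[OF continuous_on_grad[OF \<theta>]]
    borel_measurable_continuous_onI[OF smooth_imp_continuous[OF \<theta>]]
  show ?thesis
  proof (intro exI)
    show "lipschitz_test (c * ((L0 + 1) / \<epsilon>) + L) \<Omega> ?\<psi> ?G"
      unfolding lipschitz_test_def
    proof (intro conjI allI)
      show "0 \<le> c * ((L0 + 1) / \<epsilon>) + L" using c L0 \<epsilon> LD(1) by auto
      show "\<bar>?\<psi> x - ?\<psi> y\<bar> \<le> (c * ((L0 + 1) / \<epsilon>) + L) * norm (x - y)" for x y
      proof -
        have "?\<psi> x - ?\<psi> y = \<theta> x * (step (?h x) - step (?h y)) + step (?h y) * (\<theta> x - \<theta> y)"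
          by (simp add: algebra_simps)
        also have "\<bar>\<dots>\<bar> \<le> \<bar>\<theta> x\<bar> * \<bar>step (?h x) - step (?h y)\<bar> + \<bar>step (?h y)\<bar> * \<bar>\<theta> x - \<theta> y\<bar>"
          using abs_triangle_ineq by (simp flip: abs_mult)
        also have "\<dots> \<le> c * ((L0 + 1) / \<epsilon> * norm (x - y)) + 1 * (L * norm (x - y))"
        proof (intro add_mono mult_mono c LD(2))
          have "\<bar>step (?h x) - step (?h y)\<bar> \<le> \<bar>?h x - ?h y\<bar>" by (rule step_lipschitz)
          also have "?h x - ?h y = (height x - height y) / \<epsilon>" by (simp add: diff_divide_distrib)
          also have "\<bar>\<dots>\<bar> = \<bar>height x - height y\<bar> / \<epsilon>" using \<epsilon> by simp
          also have "\<dots> \<le> (L0 + 1) * norm (x - y) / \<epsilon>" using height_lipschitz[of x y] \<epsilon> by (intro divide_right_mono) auto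
          finally show "\<bar>step (?h x) - step (?h y)\<bar> \<le> (L0 + 1) / \<epsilon> * norm (x - y)" by simp
        qed (use step_bounds c in auto)
        finally show ?thesis by (simp add: algebra_simps)
      qed
      show "?G \<in> borel_measurable borel" by measurable
      show "AE x in lborel. (?\<psi> has_derivative (\<lambda>k. ?G x \<bullet> k)) (at x)"
        using Dg
      proof eventually_elim
        case (elim x)
        have "((\<lambda>x. (g x - x \<bullet> \<nu>) * inverse \<epsilon> - 1) has_derivative (\<lambda>k. (Dg x \<bullet> k - k \<bullet> \<nu>) * inverse \<epsilon> - 0)) (at x)"
          by (intro has_derivative_diff has_derivative_mult_left has_derivative_const elim
              bounded_linear_imp_has_derivative bounded_linear_inner_left)
        then have 1: "(?h has_derivative (\<lambda>k. (Dg x \<bullet> k - k \<bullet> \<nu>) / \<epsilon>)) (at x)"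
          by (simp only: height_def divide_inverse diff_zero)
        have 2: "(step has_derivative (\<lambda>k. tent (?h x) * k)) (at (?h x))"
          using DERIV_step by (simp add: has_field_derivative_def)
        have 3: "((\<lambda>x. step (?h x)) has_derivative (\<lambda>k. tent (?h x) * ((Dg x \<bullet> k - k \<bullet> \<nu>) / \<epsilon>))) (at x)"
          by (rule has_derivative_compose[OF 1 2])
        have eq: "(\<lambda>k. \<theta> x * (tent (?h x) * ((Dg x \<bullet> k - k \<bullet> \<nu>) / \<epsilon>)) + (grad \<theta> x \<bullet> k) * step (?h x)) = (\<lambda>k. ?G x \<bullet> k)"
        proof
          fix k
          have "(Dg x - \<nu>) \<bullet> k = Dg x \<bullet> k - k \<bullet> \<nu>" by (simp only: inner_diff_left inner_commute[of \<nu> k])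
          then have "?G x \<bullet> k = step (?h x) * (grad \<theta> x \<bullet> k) + tent (?h x) / \<epsilon> * \<theta> x * (Dg x \<bullet> k - k \<bullet> \<nu>)"
            by (simp only: inner_add_left inner_scaleR_left)
          then show "\<theta> x * (tent (?h x) * ((Dg x \<bullet> k - k \<bullet> \<nu>) / \<epsilon>)) + (grad \<theta> x \<bullet> k) * step (?h x) = ?G x \<bullet> k"
            by (simp only: times_divide_eq_right times_divide_eq_left mult_ac add_ac)
        qed
        show ?case using has_derivative_mult[OF smooth_has_grad[OF \<theta>] 3] by (simp only: eq)
      qed
      show "\<exists>C. compact C \<and> C \<subseteq> \<Omega> \<and> (\<forall>x. x \<notin> C \<longrightarrow> ?\<psi> x = 0 \<and> ?G x = 0)"
      proof (intro exI[of _ "C \<inter> {x. \<epsilon> \<le> height x}"] conjI allI impI)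
        have "closed {x. \<epsilon> \<le> height x}"
          by (intro closed_Collect_le continuous_on_const height_cont)
        then show "compact (C \<inter> {x. \<epsilon> \<le> height x})" using C(1) by (rule compact_Int_closed[rotated])
        show "C \<inter> {x. \<epsilon> \<le> height x} \<subseteq> \<Omega>" using C(2) mem_height \<epsilon> by force
        fix x assume x: "x \<notin> C \<inter> {x. \<epsilon> \<le> height x}"
        have "\<theta> x = 0 \<and> grad \<theta> x = 0 \<or> step (?h x) = 0 \<and> tent (?h x) = 0"
        proof (cases "x \<in> C")
          case True
          then have "?h x \<le> 0" using x \<epsilon> by (simp add: field_simps)
          then show ?thesis using step_simps(1) tent_bounds(3) by blast
        qed (use C grad0 in auto)
        then show "?\<psi> x = 0" "?G x = 0" by auto
      qed
    qed
  qed
qed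

text \<open>
  Test the divergence with the cut-off functions and let the thickness \<open>\<epsilon> k\<close> of the layer tend to \<open>0\<close>.
  Inside the domain the profile tends to \<open>1\<close>; the term in which the derivative falls on the profile
  converges to the boundary integral.
\<close>

lemma chart_divergence:
  assumes \<theta>: "smooth \<theta>" and C: "compact C" "C \<subseteq> N" "\<And>x. x \<notin> C \<Longrightarrow> \<theta> x = 0"
  shows "integrable S (\<lambda>x. \<theta> x * (q x \<bullet> n x))"
    and "(LINT x|lebesgue_on \<Omega>. \<theta> x * r x) + (LINT x|lebesgue_on \<Omega>. q x \<bullet> grad \<theta> x) = (LINT x|S. \<theta> x * (q x \<bullet> n x))"
proof -
  note \<theta>c = smooth_imp_continuous[OF \<theta>]
  obtain R where R: "\<And>x. x \<in> C \<Longrightarrow> norm x \<le> R" 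
    using compact_imp_bounded[OF C(1)] bounded_iff by metis
  have grad0: "grad \<theta> x = 0" if "x \<notin> C" for x
    by (rule gradient_zero_outside_support[where \<psi>=\<theta> and C=C])
       (use smooth_has_grad[OF \<theta>] C that compact_imp_closed in auto)
  have "\<exists>K\<ge>0. \<forall>x. \<bar>\<bar>\<theta> x\<bar> * norm (q x)\<bar> \<le> K"
    by (rule continuous_compact_support_bounded[OF _ C(1)]) (use C in \<open>auto intro!: continuous_intros \<theta>c q\<close>)
  then obtain K where K: "\<And>x. \<bar>\<theta> x\<bar> * norm (q x) \<le> K" by (metis abs_le_D1)
  obtain c where c: "\<And>x. \<bar>\<theta> x\<bar> \<le> c" using continuous_compact_support_bounded[OF \<theta>c C(1,3)] by blast
  show "integrable S (\<lambda>x. \<theta> x * (q x \<bullet> n x))" by (rule normal_flux(1)[OF \<theta> C R K])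
  define \<epsilon> where "\<epsilon> k = inverse (real (Suc k))" for k
  have \<epsilon>: "\<epsilon> k > 0" for k by (simp add: \<epsilon>_def)
  have \<epsilon>0: "\<epsilon> \<longlonglongrightarrow> 0" unfolding \<epsilon>_def by (rule LIMSEQ_inverse_real_of_nat)
  let ?h = "\<lambda>k x. height x / \<epsilon> k - 1"
  let ?F = "\<lambda>k x. tent (?h k x) / \<epsilon> k * (\<theta> x * (q x \<bullet> (Dg x - \<nu>)))"
  let ?A = "\<lambda>k x. step (?h k x) * (q x \<bullet> grad \<theta> x)"
  note [measurable] = borel_measurable_continuous_onI[OF continuous_step] borel_measurable_continuous_onI[OF continuous_on_grad[OF \<theta>]]
    borel_measurable_continuous_onI[OF \<theta>c]
  have Fm: "?F k \<in> borel_measurable borel" for k by measurable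
  have Am: "?A k \<in> borel_measurable borel" for k by measurable
  have F0: "?F k x = 0" if "x \<notin> \<Omega>" for k x
  proof (cases "x \<in> C")
    case True
    then have "height x \<le> 0" using mem_height[of x] C(2) that by force
    then have "?h k x \<le> 0" using \<epsilon>[of k] divide_nonpos_pos[of "height x" "\<epsilon> k"] by linarith
    then show ?thesis using tent_bounds(3) by simp
  qed (use C in auto)
  have Fi: "integrable lborel (?F k)" for k
  proof (rule Bochner_Integration.integrable_bound)
    show "integrable lborel (\<lambda>x::real^'d. 1 / \<epsilon> k * (K * (L0 + 1)) * indicator C x :: real)"
      using C(1) by (intro integrable_mult_right integrable_real_indicator emeasure_compact_finite borel_compact[THEN sets_lborel[THEN equalityD2, THEN subsetD]])
    show "AE x in lborel. norm (?F k x) \<le> norm (1 / \<epsilon> k * (K * (L0 + 1)) * indicator C x)"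
      using Dg_bound
    proof eventually_elim
      case (elim x)
      show ?case
      proof (cases "x \<in> C")
        case True
        have "norm (Dg x - \<nu>) \<le> L0 + 1" using norm_triangle_ineq4[of "Dg x" \<nu>] elim \<nu> by linarith
        then have "\<bar>\<theta> x\<bar> * \<bar>q x \<bullet> (Dg x - \<nu>)\<bar> \<le> \<bar>\<theta> x\<bar> * (norm (q x) * (L0 + 1))"
          by (intro mult_left_mono order_trans[OF Cauchy_Schwarz_ineq2]) auto
        also have "\<dots> \<le> K * (L0 + 1)"
          using mult_right_mono[OF K[of x], of "L0 + 1"] L0 by (simp add: mult.assoc)
        finally have "\<bar>tent (?h k x) / \<epsilon> k\<bar> * \<bar>\<theta> x * (q x \<bullet> (Dg x - \<nu>))\<bar> \<le> 1 / \<epsilon> k * (K * (L0 + 1))"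
          using tent_bounds(1,2)[of "?h k x"] \<epsilon>[of k]
          by (intro mult_mono) (auto simp: abs_mult divide_right_mono)
        also have "\<dots> \<le> norm (1 / \<epsilon> k * (K * (L0 + 1)))" unfolding real_norm_def by (rule abs_ge_self)
        finally show ?thesis using True by (simp add: abs_mult)
      qed (use C in simp)
    qed
  qed (use Fm in simp)
  have Gi: "integrable lborel (\<lambda>x. q x \<bullet> grad \<theta> x)"
    by (rule integrable_continuous_compact_support[OF _ C(1)])
       (use grad0 in \<open>auto intro!: continuous_intros q continuous_on_grad[OF \<theta>]\<close>)
  have Ai: "integrable lborel (?A k)" for k
    by (rule Bochner_Integration.integrable_bound[OF Gi])
       (use Am step_bounds in \<open>auto intro!: AE_I2 mult_left_le_one_le simp: abs_mult\<close>)
  note Gi' = lborel_integrable_imp_lebesgue_on[OF Gi \<Omega>_lebesgue]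
  note Ai' = lborel_integrable_imp_lebesgue_on[OF Ai \<Omega>_lebesgue]
  note Fi' = lborel_integrable_imp_lebesgue_on[OF Fi \<Omega>_lebesgue]
  let ?\<psi> = "\<lambda>k x. \<theta> x * step (?h k x)"
  have key: "- ((LINT x|lebesgue_on \<Omega>. ?A k x) + (LBINT x. ?F k x)) = (LINT x|lebesgue_on \<Omega>. ?\<psi> k x * r x)" for k
  proof -
    let ?G = "\<lambda>x. step (?h k x) *\<^sub>R grad \<theta> x + (tent (?h k x) / \<epsilon> k * \<theta> x) *\<^sub>R (Dg x - \<nu>)"
    obtain L where L: "lipschitz_test L \<Omega> (?\<psi> k) ?G" using cutoff_lipschitz_test[OF \<theta> C \<epsilon>] by blast
    have "- (LINT x|lebesgue_on \<Omega>. q x \<bullet> ?G x) = (LINT x|lebesgue_on \<Omega>. ?\<psi> k x * r x)"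
      by (rule distr_div_lipschitz_test[OF \<Omega> q r div L])
    moreover have "(LINT x|lebesgue_on \<Omega>. q x \<bullet> ?G x) = (LINT x|lebesgue_on \<Omega>. ?A k x + ?F k x)"
      by (rule Bochner_Integration.integral_cong) (auto simp: inner_add_right)
    moreover have "\<dots> = (LINT x|lebesgue_on \<Omega>. ?A k x) + (LINT x|lebesgue_on \<Omega>. ?F k x)"
      by (rule Bochner_Integration.integral_add[OF Ai' Fi'])
    moreover have "(LINT x|lebesgue_on \<Omega>. ?F k x) = (LBINT x. ?F k x)"
      by (rule integral_lebesgue_on_eq_lborel(1)[OF \<Omega>_lebesgue]) (use F0 Fm in auto)
    ultimately show ?thesis by (simp only:)
  qed
  have step_lim: "(\<lambda>k. step (?h k x)) \<longlonglongrightarrow> 1" if "height x > 0" for x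
  proof (rule tendsto_eventually)
    obtain m where m: "3 / height x < real m" using reals_Archimedean2 by blast
    have "step (?h k x) = 1" if "k \<ge> m" for k
    proof (rule step_simps(2))
      have "3 / height x \<le> real (Suc k)" using m that by linarith
      then show "2 \<le> ?h k x" using \<open>height x > 0\<close> by (simp add: \<epsilon>_def field_simps)
    qed
    then show "\<forall>\<^sub>F k in sequentially. step (?h k x) = 1" by (auto simp: eventually_sequentially)
  qed
  have cut_lim: "(\<lambda>k. step (?h k x) * a) \<longlonglongrightarrow> a" if "x \<in> \<Omega>" "x \<notin> C \<Longrightarrow> a = 0" for x a
  proof (cases "x \<in> C")
    case True
    then have "height x > 0" using mem_height[of x] C(2) that(1) by auto
    from tendsto_mult[OF step_lim[OF this] tendsto_const[of a]] show ?thesis by simp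
  qed (use that in simp)
  have 1: "(\<lambda>k. LINT x|lebesgue_on \<Omega>. ?A k x) \<longlonglongrightarrow> (LINT x|lebesgue_on \<Omega>. q x \<bullet> grad \<theta> x)"
  proof (rule integral_dominated_convergence[where w="\<lambda>x. \<bar>q x \<bullet> grad \<theta> x\<bar>"])
    show "AE x in lebesgue_on \<Omega>. (\<lambda>k. ?A k x) \<longlonglongrightarrow> q x \<bullet> grad \<theta> x"
      using grad0 by (intro AE_I2 cut_lim) auto
    show "AE x in lebesgue_on \<Omega>. norm (?A k x) \<le> \<bar>q x \<bullet> grad \<theta> x\<bar>" for k
      using step_bounds by (intro AE_I2) (auto intro!: mult_left_le_one_le simp: abs_mult)
  qed (use Gi' Ai' in auto)
  have 2: "(\<lambda>k. LINT x|lebesgue_on \<Omega>. ?\<psi> k x * r x) \<longlonglongrightarrow> (LINT x|lebesgue_on \<Omega>. \<theta> x * r x)"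
  proof (rule integral_dominated_convergence[where w="\<lambda>x. c * \<bar>r x\<bar>"])
    note [measurable] = borel_measurable_integrable[OF r]
    have m: "\<theta> \<in> borel_measurable (lebesgue_on \<Omega>)" "(\<lambda>x. step (?h k x)) \<in> borel_measurable (lebesgue_on \<Omega>)" for k
      by (rule lebesgue_on_measurable; measurable)+
    note [measurable] = m
    show "(\<lambda>x. \<theta> x * r x) \<in> borel_measurable (lebesgue_on \<Omega>)" "(\<lambda>x. ?\<psi> k x * r x) \<in> borel_measurable (lebesgue_on \<Omega>)" for k
      using m r by (auto intro!: borel_measurable_times)
    show "AE x in lebesgue_on \<Omega>. (\<lambda>k. ?\<psi> k x * r x) \<longlonglongrightarrow> \<theta> x * r x"
    proof (intro AE_I2)
      fix x assume "x \<in> space (lebesgue_on \<Omega>)"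
      then have "(\<lambda>k. step (?h k x) * (\<theta> x * r x)) \<longlonglongrightarrow> \<theta> x * r x"
        using C by (intro cut_lim) auto
      then show "(\<lambda>k. ?\<psi> k x * r x) \<longlonglongrightarrow> \<theta> x * r x" by (simp add: mult_ac)
    qed
    show "AE x in lebesgue_on \<Omega>. norm (?\<psi> k x * r x) \<le> c * \<bar>r x\<bar>" for k
    proof (intro AE_I2)
      fix x
      have "\<bar>\<theta> x\<bar> * \<bar>step (?h k x)\<bar> \<le> c * 1" using c step_bounds by (intro mult_mono) (auto intro: order_trans[OF abs_ge_zero c])
      then show "norm (?\<psi> k x * r x) \<le> c * \<bar>r x\<bar>" by (simp add: abs_mult mult_right_mono)
    qed
  qed (use r in auto)
  have 3: "(\<lambda>k. LBINT x. ?F k x) \<longlonglongrightarrow> - (LINT x|S. \<theta> x * (q x \<bullet> n x))"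
  proof -
    have "- (LINT x|S. \<theta> x * (q x \<bullet> n x)) = (LBINT x. indicator (slab \<nu>) x * (\<theta> (gp x) * (q (gp x) \<bullet> (Dg x - \<nu>))))"
      by (subst normal_flux(2)[OF \<theta> C R K]) simp_all
    then show ?thesis by (simp only:) (rule boundary_layer_limit[OF \<theta> C R K \<epsilon> \<epsilon>0])
  qed
  have "(\<lambda>k. - ((LINT x|lebesgue_on \<Omega>. ?A k x) + (LBINT x. ?F k x))) \<longlonglongrightarrow>
      - ((LINT x|lebesgue_on \<Omega>. q x \<bullet> grad \<theta> x) + - (LINT x|S. \<theta> x * (q x \<bullet> n x)))"
    by (intro tendsto_intros 1 3)
  then have "(\<lambda>k. LINT x|lebesgue_on \<Omega>. ?\<psi> k x * r x) \<longlonglongrightarrow>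
      - ((LINT x|lebesgue_on \<Omega>. q x \<bullet> grad \<theta> x) + - (LINT x|S. \<theta> x * (q x \<bullet> n x)))"
    unfolding key .
  from LIMSEQ_unique[OF 2 this]
  show "(LINT x|lebesgue_on \<Omega>. \<theta> x * r x) + (LINT x|lebesgue_on \<Omega>. q x \<bullet> grad \<theta> x) = (LINT x|S. \<theta> x * (q x \<bullet> n x))"
    by simp
qed
end

section \<open>The divergence theorem\<close>

context flux_domain
begin

definition flux_identity :: "(real^'d \<Rightarrow> real) \<Rightarrow> bool" where
  "flux_identity \<theta> \<longleftrightarrow> integrable S (\<lambda>x. \<theta> x * (q x \<bullet> n x)) \<and>
    (LINT x|lebesgue_on \<Omega>. \<theta> x * r x) + (LINT x|lebesgue_on \<Omega>. q x \<bullet> grad \<theta> x) = (LINT x|S. \<theta> x * (q x \<bullet> n x))"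

lemma space_S: "space S = frontier \<Omega>"
proof -
  have "sets S = sets (restrict_space borel (frontier \<Omega>))" using surface by (simp add: surface_measure_def)
  from sets_eq_imp_space_eq[OF this] show ?thesis by (simp add: space_restrict_space)
qed

lemma flux_identity_zero:
  assumes "smooth \<theta>" "\<And>x. x \<in> closure \<Omega> \<Longrightarrow> \<theta> x = 0"
  shows "flux_identity \<theta>"
proof -
  have fr: "\<theta> x = 0" if "x \<in> space S" for x using that assms(2) by (auto simp: space_S frontier_def)
  have om: "\<theta> x = 0" if "x \<in> \<Omega>" for x using that assms(2) closure_subset by blast
  have gr: "grad \<theta> x = 0" if "x \<in> \<Omega>" for x
    by (rule gradient_zero_outside_support[where \<psi>=\<theta> and C="- \<Omega>"])
       (use smooth_has_grad[OF assms(1)] \<Omega> that om in auto)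
  have "integrable S (\<lambda>x. \<theta> x * (q x \<bullet> n x)) \<longleftrightarrow> integrable S (\<lambda>x. 0 :: real)"
    by (rule Bochner_Integration.integrable_cong) (use fr in auto)
  moreover have "(LINT x|S. \<theta> x * (q x \<bullet> n x)) = (LINT x|S. 0)"
    by (rule Bochner_Integration.integral_cong) (use fr in auto)
  moreover have "(LINT x|lebesgue_on \<Omega>. \<theta> x * r x) = (LINT x|lebesgue_on \<Omega>. 0)"
    by (rule Bochner_Integration.integral_cong) (use om in auto)
  moreover have "(LINT x|lebesgue_on \<Omega>. q x \<bullet> grad \<theta> x) = (LINT x|lebesgue_on \<Omega>. 0)"
    by (rule Bochner_Integration.integral_cong) (use gr in auto)
  ultimately show ?thesis unfolding flux_identity_def by simp
qed

lemma flux_identity_test: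
  assumes "test_function \<Omega> \<theta>"
  shows "flux_identity \<theta>"
proof -
  obtain C where C: "compact C" "C \<subseteq> \<Omega>" "\<And>x. x \<notin> C \<Longrightarrow> \<theta> x = 0" using test_functionD(2)[OF assms] by blast
  have fr: "\<theta> x = 0" if "x \<in> space S" for x
    using that C \<Omega>(1) by (auto simp: space_S frontier_def interior_open)
  have "integrable S (\<lambda>x. \<theta> x * (q x \<bullet> n x)) \<longleftrightarrow> integrable S (\<lambda>x. 0 :: real)"
    by (rule Bochner_Integration.integrable_cong) (use fr in auto)
  moreover have "(LINT x|S. \<theta> x * (q x \<bullet> n x)) = (LINT x|S. 0)"
    by (rule Bochner_Integration.integral_cong) (use fr in auto)
  ultimately show ?thesis unfolding flux_identity_def using div[OF assms] by simp
qed

lemma continuous_bounded_on_\<Omega>: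
  fixes f :: "real^'d \<Rightarrow> real"
  assumes "continuous_on UNIV f"
  shows "\<exists>c\<ge>0. \<forall>x\<in>\<Omega>. \<bar>f x\<bar> \<le> c"
proof -
  have cpt: "compact (closure \<Omega>)" using \<Omega> by (simp add: compact_closure)
  obtain k where k: "\<And>x. x \<in> closure \<Omega> \<Longrightarrow> \<bar>f x\<bar> \<le> k"
    using compact_imp_bounded[OF compact_continuous_image[OF continuous_on_subset[OF assms subset_UNIV] cpt]]
    by (auto simp: bounded_iff)
  then have "\<forall>x\<in>\<Omega>. \<bar>f x\<bar> \<le> \<bar>k\<bar>" using closure_subset[of \<Omega>] by (meson abs_ge_self order_trans subsetD)
  then show ?thesis by (intro exI[of _ "\<bar>k\<bar>"]) auto
qed

lemma integrable_times_r:
  assumes "continuous_on UNIV f"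
  shows "integrable (lebesgue_on \<Omega>) (\<lambda>x. f x * r x)"
proof -
  obtain c where c: "c \<ge> 0" "\<And>x. x \<in> \<Omega> \<Longrightarrow> \<bar>f x\<bar> \<le> c" using continuous_bounded_on_\<Omega>[OF assms] by blast
  have "AE x in lebesgue_on \<Omega>. norm (f x) \<le> c" using c(2) by (intro AE_I2) auto
  from integrable_inner_bounded(2)[OF r continuous_lebesgue_on_measurable[OF assms] this] show ?thesis by simp
qed

lemma integrable_continuous:
  fixes f :: "real^'d \<Rightarrow> real"
  assumes "continuous_on UNIV f"
  shows "integrable (lebesgue_on \<Omega>) f"
proof -
  obtain c where c: "c \<ge> 0" "\<And>x. x \<in> \<Omega> \<Longrightarrow> \<bar>f x\<bar> \<le> c" using continuous_bounded_on_\<Omega>[OF assms] by blast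
  note [measurable] = continuous_lebesgue_on_measurable[OF assms]
  have "finite_measure (lebesgue_on \<Omega>)" using \<Omega> by (simp add: finite_measure_lebesgue_on lmeasurable_open)
  then have "integrable (lebesgue_on \<Omega>) (\<lambda>x. c)" by (simp add: finite_measure.integrable_const)
  then show ?thesis
    by (rule Bochner_Integration.integrable_bound) (use c in \<open>auto intro!: AE_I2\<close>)
qed

lemma flux_identity_add:
  assumes \<theta>: "smooth \<theta>1" "smooth \<theta>2" and "flux_identity \<theta>1" "flux_identity \<theta>2"
  shows "flux_identity (\<lambda>x. \<theta>1 x + \<theta>2 x)"
proof -
  have g: "grad (\<lambda>x. \<theta>1 x + \<theta>2 x) x = grad \<theta>1 x + grad \<theta>2 x" for x
  proof -
    have "((\<lambda>x. \<theta>1 x + \<theta>2 x) has_derivative (\<lambda>h. grad \<theta>1 x \<bullet> h + grad \<theta>2 x \<bullet> h)) (at x)"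
      by (intro has_derivative_add smooth_has_grad \<theta>)
    then have "grad (\<lambda>x. \<theta>1 x + \<theta>2 x) x \<bullet> h = (grad \<theta>1 x + grad \<theta>2 x) \<bullet> h" for h
      by (simp add: grad_inner inner_add_left)
    then show ?thesis by (intro inner_right_cancel_fun) auto
  qed
  note c = smooth_imp_continuous[OF \<theta>(1)] smooth_imp_continuous[OF \<theta>(2)]
  have qi: "integrable (lebesgue_on \<Omega>) (\<lambda>x. q x \<bullet> grad \<theta>1 x)" "integrable (lebesgue_on \<Omega>) (\<lambda>x. q x \<bullet> grad \<theta>2 x)"
    by (intro integrable_continuous continuous_intros q continuous_on_grad \<theta>)+
  show ?thesis
    using assms(3,4) integrable_times_r[OF c(1)] integrable_times_r[OF c(2)] qi
    unfolding flux_identity_def g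
    by (simp add: distrib_right inner_add_right)
qed

text \<open>
  In the interior the identity is the definition of the distributional divergence, at the boundary
  it is \<open>chart_divergence\<close>.
\<close>

lemma flux_identity_local:
  assumes charts: "\<And>p. p \<in> frontier \<Omega> \<Longrightarrow> \<exists>N \<nu> g. p \<in> N \<and> lipschitz_chart \<Omega> N \<nu> g" and p: "p \<in> closure \<Omega>"
  shows "\<exists>e>0. \<forall>\<theta>. smooth \<theta> \<and> (\<forall>x. x \<notin> cball p e \<longrightarrow> \<theta> x = 0) \<longrightarrow> flux_identity \<theta>"
proof (cases "p \<in> \<Omega>")
  case True
  then obtain e where "e > 0" "cball p e \<subseteq> \<Omega>" using \<Omega>(1) open_contains_cball by blast
  then show ?thesis
    using flux_identity_test test_functionI[OF _ compact_cball[of p e]] by (intro exI[of _ e]) blast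
next
  case False
  then have "p \<in> frontier \<Omega>" using p \<Omega>(1) by (simp add: frontier_def interior_open)
  then obtain N \<nu> g where N: "p \<in> N" "lipschitz_chart \<Omega> N \<nu> g" using charts by blast
  then obtain L0 Dg where "boundary_chart \<Omega> n S q r N \<nu> g L0 Dg" using boundary_chartI by blast
  then interpret bc: boundary_chart \<Omega> n S q r N \<nu> g L0 Dg .
  obtain e where e: "e > 0" "cball p e \<subseteq> N" using bc.N N(1) open_contains_cball by blast
  then show ?thesis
    using bc.chart_divergence[OF _ compact_cball[of p e]] unfolding flux_identity_def
    by (intro exI[of _ e]) blast
qed

text \<open>
  For a finite cover of the closure by good balls, split off the part of \<open>\<theta>\<close> near one ball after
  another by \<open>\<theta> = \<theta> \<kappa> + \<theta> (1 - \<kappa>)\<close> with a plateau function \<open>\<kappa>\<close>, until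
  nothing is left on the closure.
\<close>

theorem divergence_theorem:
  assumes charts: "\<And>p. p \<in> frontier \<Omega> \<Longrightarrow> \<exists>N \<nu> g. p \<in> N \<and> lipschitz_chart \<Omega> N \<nu> g"
  shows "(LINT x|lebesgue_on \<Omega>. r x) = (LINT x|S. q x \<bullet> n x)"
proof -
  have "\<exists>e. \<forall>p\<in>closure \<Omega>. e p > 0 \<and> (\<forall>\<theta>. smooth \<theta> \<and> (\<forall>x. x \<notin> cball p (e p) \<longrightarrow> \<theta> x = 0) \<longrightarrow> flux_identity \<theta>)"
    using flux_identity_local[OF charts] by (intro bchoice) blast
  then obtain e where e: "\<And>p. p \<in> closure \<Omega> \<Longrightarrow> e p > 0"
    "\<And>p \<theta>. p \<in> closure \<Omega> \<Longrightarrow> smooth \<theta> \<Longrightarrow> (\<forall>x. x \<notin> cball p (e p) \<longrightarrow> \<theta> x = 0) \<Longrightarrow> flux_identity \<theta>"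
    by blast
  have cpt: "compact (closure \<Omega>)" using \<Omega> by (simp add: compact_closure)
  obtain D where D: "D \<subseteq> closure \<Omega>" "finite D" "closure \<Omega> \<subseteq> (\<Union>p\<in>D. ball p (e p / 2))"
    using compactE_image[OF cpt, of "closure \<Omega>" "\<lambda>p. ball p (e p / 2)"] e(1) by force
  have "flux_identity \<theta>" if "smooth \<theta>" "\<And>x. x \<in> closure \<Omega> \<Longrightarrow> \<theta> x \<noteq> 0 \<Longrightarrow> x \<in> (\<Union>p\<in>D. ball p (e p / 2))" for \<theta>
    using D(2,1) that
  proof (induction D arbitrary: \<theta> rule: finite_induct)
    case empty
    then show ?case by (intro flux_identity_zero) auto
  next
    case (insert p F)
    have p: "p \<in> closure \<Omega>" using insert.prems by auto
    have "\<exists>\<kappa>::real^'d \<Rightarrow> real. smooth \<kappa> \<and> (\<forall>x\<in>cball p (e p / 2). \<kappa> x = 1) \<and>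
       (\<forall>x. (\<forall>y\<in>cball p (e p / 2). e p / 2 < dist x y) \<longrightarrow> \<kappa> x = 0)"
      by (rule smooth_plateau[OF compact_cball[of p "e p / 2"], of "e p / 2"]) (use e(1)[OF p] in auto)
    then obtain \<kappa> :: "real^'d \<Rightarrow> real" where \<kappa>: "smooth \<kappa>" "\<And>x. x \<in> cball p (e p / 2) \<Longrightarrow> \<kappa> x = 1"
      "\<And>x. (\<forall>y\<in>cball p (e p / 2). e p / 2 < dist x y) \<Longrightarrow> \<kappa> x = 0" by blast
    have \<kappa>0: "\<kappa> x = 0" if "x \<notin> cball p (e p)" for x
    proof (rule \<kappa>(3), rule ballI)
      fix y assume "y \<in> cball p (e p / 2)"
      then show "e p / 2 < dist x y" using that dist_triangle[of p x y] by (auto simp: dist_commute)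
    qed
    have s1: "smooth (\<lambda>x. \<theta> x * \<kappa> x)"
      using Ck_mult insert.prems(2) \<kappa>(1) by blast
    have s2: "smooth (\<lambda>x. \<theta> x * (1 + (-1) * \<kappa> x))"
      by (rule allI, rule Ck_mult[OF insert.prems(2)[rule_format] Ck_add[OF Ck_const Ck_mult[OF Ck_const \<kappa>(1)[rule_format]]]])
    have "flux_identity (\<lambda>x. \<theta> x * \<kappa> x)"
      by (rule e(2)[OF p s1]) (use \<kappa>0 in auto)
    moreover have "flux_identity (\<lambda>x. \<theta> x * (1 + (-1) * \<kappa> x))"
    proof (rule insert.IH[OF _ s2])
      show "F \<subseteq> closure \<Omega>" using insert.prems by auto
      fix x assume x: "x \<in> closure \<Omega>" "\<theta> x * (1 + (-1) * \<kappa> x) \<noteq> 0"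
      then have "\<theta> x \<noteq> 0" "x \<notin> ball p (e p / 2)" using \<kappa>(2)[of x] by auto
      then show "x \<in> (\<Union>p\<in>F. ball p (e p / 2))" using insert.prems(3)[OF x(1)] by auto
    qed
    ultimately have "flux_identity (\<lambda>x. \<theta> x * \<kappa> x + \<theta> x * (1 + (-1) * \<kappa> x))"
      by (rule flux_identity_add[OF s1 s2])
    then show ?case by (simp add: algebra_simps)
  qed
  then have "flux_identity (\<lambda>x. 1)" using D(3) Ck_const by blast
  moreover have "grad (\<lambda>x. 1) x = 0" for x :: "real^'d" by (simp add: grad_def vec_eq_iff)
  ultimately show ?thesis unfolding flux_identity_def by simp
qed
end

section \<open>Functions of class C1 up to the boundary\<close>

lemma Ck_upto_1_D:
  assumes "Ck_upto 1 S T f"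
  shows "\<And>x. x \<in> S \<Longrightarrow> (f has_derivative frechet_derivative f (at x)) (at x)"
    "\<exists>g. continuous_on T g \<and> (\<forall>x\<in>S. g x = f x)"
    "\<And>v. \<exists>g. continuous_on T g \<and> (\<forall>x\<in>S. g x = frechet_derivative f (at x) v)"
  using assms by (auto simp: One_nat_def simp flip: frechet_derivative_works)

lemma continuous_extension_imp:
  assumes "\<exists>g. continuous_on T g \<and> (\<forall>x\<in>S. g x = f x)" "S \<subseteq> T"
  shows "continuous_on S f"
  using assms continuous_on_subset by (metis (no_types, lifting) continuous_on_cong)

lemma continuous_extension_bounded:
  fixes f :: "'a::topological_space \<Rightarrow> 'b::real_normed_vector"
  assumes "\<exists>g. continuous_on T g \<and> (\<forall>x\<in>S. g x = f x)" and "compact K" "K \<subseteq> T"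
  shows "\<exists>c\<ge>0. \<forall>x\<in>S \<inter> K. norm (f x) \<le> c"
proof -
  obtain g where g: "continuous_on T g" "\<And>x. x \<in> S \<Longrightarrow> g x = f x" using assms(1) by blast
  have "bounded (g ` K)"
    by (intro compact_imp_bounded compact_continuous_image continuous_on_subset[OF g(1)] assms)
  then obtain c where c: "\<And>x. x \<in> K \<Longrightarrow> norm (g x) \<le> c" by (auto simp: bounded_iff)
  have "\<forall>x\<in>S \<inter> K. norm (f x) \<le> \<bar>c\<bar>" using c g(2) by (metis IntD1 IntD2 abs_ge_self order_trans)
  then show ?thesis by (intro exI[of _ "\<bar>c\<bar>"]) auto
qed

text \<open>
  By completeness of Lebesgue measure, measurability of \<open>g\<close> is a consequence.
\<close>

lemma lebesgue_on_cong_AE: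
  fixes f g :: "'a::euclidean_space \<Rightarrow> 'b::euclidean_space"
  assumes "S \<in> sets lebesgue" "f \<in> borel_measurable (lebesgue_on S)" "AE x in lebesgue_on S. f x = g x"
  shows "(LINT x|lebesgue_on S. f x) = (LINT x|lebesgue_on S. g x)"
    and "integrable (lebesgue_on S) f \<longleftrightarrow> integrable (lebesgue_on S) g"
  using integral_cong_AE[OF assms(2) borel_measurable_lebesgue_on_AE[OF assms] assms(3)]
    integrable_cong_AE[OF assms(2) borel_measurable_lebesgue_on_AE[OF assms] assms(3)] by auto

lemma grad_bounded:
  assumes "test_function \<Omega> \<phi>"
  shows "\<exists>c. \<forall>x. norm (grad \<phi> x) \<le> c" "\<exists>c. \<forall>x. norm (\<phi> x) \<le> c"
proof -
  note T = test_function_C1_test[OF assms]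
  obtain L where L: "lipschitz_test L \<Omega> \<phi> (grad \<phi>)" by (rule C1_test_lipschitz_test[OF T])
  obtain L' R where "\<And>x. norm (grad \<phi> x) \<le> L'" by (rule C1_test_bounds[OF T]) (rule that; blast)
  then show "\<exists>c. \<forall>x. norm (grad \<phi> x) \<le> c" by blast
  show "\<exists>c. \<forall>x. norm (\<phi> x) \<le> c" using lipschitz_test_bounded(1)[OF L] by auto
qed

lemma inner_vector_matrix: "(v v* J) \<bullet> h = (\<Sum>a\<in>UNIV. v $ a * (J $ a \<bullet> h))"
  for v :: "real^'m" and J :: "real^'d^'m"
proof -
  have "(v v* J) \<bullet> h = (\<Sum>k\<in>UNIV. \<Sum>a\<in>UNIV. J $ a $ k * v $ a * h $ k)"
    by (simp add: inner_vec_def vector_matrix_mult_def sum_distrib_left sum_distrib_right mult_ac)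
  also have "\<dots> = (\<Sum>a\<in>UNIV. \<Sum>k\<in>UNIV. J $ a $ k * v $ a * h $ k)" by (rule sum.swap)
  finally show ?thesis by (simp add: inner_vec_def sum_distrib_left mult_ac)
qed

lemma vector_matrix_bilinear: "bounded_bilinear (\<lambda>(v::real^'m) (J::real^'d^'m). v v* J)"
proof -
  have "bilinear (\<lambda>(v::real^'m) (J::real^'d^'m). v v* J)"
    unfolding bilinear_def
    by (auto intro!: linearI simp: vec_eq_iff vector_matrix_mult_def sum.distrib algebra_simps sum_distrib_left)
  then show ?thesis by (rule bilinear_conv_bounded_bilinear[THEN iffD1])
qed

section \<open>The balance in space\<close>

text \<open>
  Testing \<open>div (J1 + J2) = \<rho>\<close> with \<open>\<phi> v\<close> splits into the contribution of \<open>J1\<close>, which is the distribution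
  \<open>div q1\<close> by assumption, and that of \<open>J2\<close>, which by the product rule is \<open>div (v v* J2)\<close> minus
  \<open>\<nabla>v : J2\<close>. Hence the energy flux \<open>q1 + v v* J2\<close> has the integrable divergence
  \<open>v \<bullet> \<rho> + \<nabla>v : J2\<close>, and the divergence theorem applies to its continuous representative. The function
  \<open>v\<close> is the \<open>C\<^sup>1\<close> representative of the multiplier \<open>e\<close>.
\<close>

lemma energy_identity:
  fixes \<Omega> :: "(real^'d) set" and e v \<rho> :: "real^'d \<Rightarrow> real^'m" and J1 J2 :: "real^'d \<Rightarrow> real^'d^'m"
  assumes dom: "bounded_lipschitz_domain \<Omega>" "outward_unit_normal \<Omega> n" "surface_measure \<Omega> S"
    and v: "Ck_upto 1 \<Omega> (closure \<Omega>) v" and ve: "AE x in lebesgue_on \<Omega>. v x = e x"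
    and J: "integrable (lebesgue_on \<Omega>) J1" "integrable (lebesgue_on \<Omega>) J2"
    and div: "has_distr_div \<Omega> (\<lambda>x. J1 x + J2 x) \<rho>"
    and q1: "integrable (lebesgue_on \<Omega>) q1"
    and mult: "\<And>\<phi>. test_function \<Omega> \<phi> \<Longrightarrow> distr_mult_div \<Omega> e J1 \<phi> = distr_div \<Omega> q1 \<phi>"
    and flux: "has_boundary_flux \<Omega> n S (\<lambda>x. q1 x + e x v* J2 x) c"
  shows "integrable (lebesgue_on \<Omega>) (\<lambda>x. e x \<bullet> \<rho> x)" "integrable (lebesgue_on \<Omega>) (\<lambda>x. wgrad \<Omega> e x \<bullet> J2 x)"
    and "(LINT x|lebesgue_on \<Omega>. e x \<bullet> \<rho> x) + (LINT x|lebesgue_on \<Omega>. wgrad \<Omega> e x \<bullet> J2 x) = c"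
proof -
  have \<Omega>: "open \<Omega>" "bounded \<Omega>" using dom(1) by (auto simp: bounded_lipschitz_domain_def)
  have \<Omega>l: "\<Omega> \<in> sets lebesgue" using \<Omega> by auto
  have cpt: "compact (closure \<Omega>)" using \<Omega> by (simp add: compact_closure)
  have sub: "\<Omega> \<subseteq> closure \<Omega>" by (rule closure_subset)
  let ?L = "lebesgue_on \<Omega>"
  have AE\<Omega>: "AE x in ?L. x \<in> \<Omega>" by (intro AE_I2) auto
  note v1 = Ck_upto_1_D[OF v]
  have vc: "continuous_on \<Omega> v" by (rule continuous_extension_imp[OF v1(2) sub])
  define w where "w x a = (\<chi> k. frechet_derivative v (at x) (axis k 1) $ a)" for x a
  have vD: "((\<lambda>x. v x $ a) has_derivative (\<lambda>h. w x a \<bullet> h)) (at x)" if "x \<in> \<Omega>" for x a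
  proof -
    let ?D = "frechet_derivative v (at x)"
    have D: "((\<lambda>x. v x $ a) has_derivative (\<lambda>h. ?D h $ a)) (at x)"
      by (rule bounded_linear.has_derivative[OF bounded_linear_vec_nth v1(1)[OF that]])
    have "?D h $ a = w x a \<bullet> h" for h
    proof -
      have "grad (\<lambda>x. v x $ a) x \<bullet> h = ?D h $ a" by (rule grad_inner[OF D])
      moreover have "grad (\<lambda>x. v x $ a) x = w x a"
        using frechet_derivative_at[OF D] by (auto simp: grad_def w_def vec_eq_iff fun_eq_iff)
      ultimately show ?thesis by simp
    qed
    then show ?thesis using D by simp
  qed
  have fc: "continuous_on \<Omega> (\<lambda>x. frechet_derivative v (at x) h)" for h
    by (rule continuous_extension_imp[OF v1(3) sub])
  have wc: "continuous_on \<Omega> (\<lambda>x. w x a)" for a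
    unfolding w_def by (intro continuous_on_vec_lambda continuous_on_component fc)
  define P where "P x = (\<chi> a. w x a)" for x
  have Pc: "continuous_on \<Omega> P" unfolding P_def by (intro continuous_on_vec_lambda wc)
  have Pm: "P \<in> borel_measurable ?L" by (rule continuous_imp_measurable_on_sets_lebesgue[OF Pc \<Omega>l])
  have vm: "v \<in> borel_measurable ?L" by (rule continuous_imp_measurable_on_sets_lebesgue[OF vc \<Omega>l])
  have Pe: "AE x in ?L. wgrad \<Omega> e x = P x"
    unfolding P_def by (rule wgrad_classical[OF \<Omega>(1) ve vD wc])
  obtain cv where cv: "\<And>x. x \<in> \<Omega> \<Longrightarrow> norm (v x) \<le> cv"
    using continuous_extension_bounded[OF v1(2) cpt subset_refl] sub by blast
  have "\<exists>c. \<forall>x\<in>\<Omega>. norm (P x) \<le> c"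
  proof -
    have "\<exists>c\<ge>0. \<forall>x\<in>\<Omega> \<inter> closure \<Omega>. norm (frechet_derivative v (at x) (axis k 1)) \<le> c" for k
      by (rule continuous_extension_bounded[OF v1(3) cpt subset_refl])
    then obtain c where c: "\<And>k x. x \<in> \<Omega> \<Longrightarrow> norm (frechet_derivative v (at x) (axis k 1)) \<le> c k"
      using sub by (metis IntI subsetD)
    have "norm (P x) \<le> (\<Sum>a\<in>(UNIV::'m set). \<Sum>k\<in>UNIV. c k)" if "x \<in> \<Omega>" for x
    proof -
      have "norm (P x) \<le> (\<Sum>a\<in>UNIV. norm (P x $ a))" by (simp add: norm_vec_def[of "P x"] L2_set_le_sum)
      also have "\<dots> \<le> (\<Sum>a\<in>UNIV. \<Sum>k\<in>UNIV. \<bar>P x $ a $ k\<bar>)" by (intro sum_mono norm_le_l1_cart)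
      also have "\<dots> \<le> (\<Sum>a\<in>(UNIV::'m set). \<Sum>k\<in>UNIV. c k)"
        by (intro sum_mono) (use c[OF that] in \<open>auto simp: P_def w_def intro: order_trans[OF component_le_norm_cart]\<close>)
      finally show ?thesis .
    qed
    then show ?thesis by blast
  qed
  then obtain cP where cP: "\<And>x. x \<in> \<Omega> \<Longrightarrow> norm (P x) \<le> cP" by blast
  have \<rho>: "integrable ?L \<rho>" using div by (simp add: has_distr_div_def)
  have v\<rho>: "integrable ?L (\<lambda>x. v x \<bullet> \<rho> x)"
    by (rule integrable_inner_bounded(2)[OF \<rho> vm, of cv]) (use AE\<Omega> cv in \<open>auto elim: eventually_mono\<close>)
  have PJ: "integrable ?L (\<lambda>x. P x \<bullet> J2 x)"
    by (rule integrable_inner_bounded(2)[OF J(2) Pm, of cP]) (use AE\<Omega> cP in \<open>auto elim: eventually_mono\<close>)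
  have e\<rho>: "AE x in ?L. v x \<bullet> \<rho> x = e x \<bullet> \<rho> x" using ve by eventually_elim simp
  have eJ: "AE x in ?L. P x \<bullet> J2 x = wgrad \<Omega> e x \<bullet> J2 x" using Pe by eventually_elim simp
  note ce = lebesgue_on_cong_AE[OF \<Omega>l borel_measurable_integrable[OF v\<rho>] e\<rho>]
  note cJ = lebesgue_on_cong_AE[OF \<Omega>l borel_measurable_integrable[OF PJ] eJ]
  show "integrable ?L (\<lambda>x. e x \<bullet> \<rho> x)" using ce(2) v\<rho> by simp
  show "integrable ?L (\<lambda>x. wgrad \<Omega> e x \<bullet> J2 x)" using cJ(2) PJ by simp
  define R where "R x = v x \<bullet> \<rho> x + P x \<bullet> J2 x" for x
  have Ri: "integrable ?L R" unfolding R_def using v\<rho> PJ by simp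
  obtain q' where q': "AE x in ?L. q' x = q1 x + e x v* J2 x" "continuous_on (closure \<Omega>) q'" "c = (LINT x|S. q' x \<bullet> n x)"
    using flux unfolding has_boundary_flux_def by blast
  obtain q where q: "continuous_on UNIV q" "\<And>x. x \<in> closure \<Omega> \<Longrightarrow> q x = q' x"
    using Dugundji[of UNIV UNIV "closure \<Omega>" q'] q'(2) by auto
  have vJ2: "integrable ?L (\<lambda>x. v x v* J2 x)"
  proof -
    obtain K where K: "\<And>a b. norm ((a::real^'m) v* (b::real^'d^'m)) \<le> norm a * norm b * K" "K \<ge> 0"
      using bounded_bilinear.nonneg_bounded[OF vector_matrix_bilinear] by blast
    have m: "(\<lambda>x. v x v* J2 x) \<in> borel_measurable ?L"
    proof (rule borel_measurable_continuous_Pair[OF vm borel_measurable_integrable[OF J(2)]])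
      show "continuous_on UNIV (\<lambda>x. fst x v* (snd x :: real^'d^'m))"
        by (rule bounded_bilinear.continuous_on[OF vector_matrix_bilinear continuous_on_fst[OF continuous_on_id] continuous_on_snd[OF continuous_on_id]])
    qed
    have b: "AE x in ?L. norm (v x v* J2 x) \<le> norm ((cv * K) *\<^sub>R J2 x)"
      using AE\<Omega>
    proof eventually_elim
      case (elim x)
      have "norm (v x v* J2 x) \<le> norm (v x) * norm (J2 x) * K" by (rule K)
      also have "\<dots> \<le> cv * norm (J2 x) * K" using cv[OF elim] K(2) by (intro mult_right_mono) auto
      also have "\<dots> \<le> \<bar>cv * K\<bar> * norm (J2 x)"
        using mult_right_mono[OF abs_ge_self[of "cv * K"], of "norm (J2 x)"] by (simp add: mult_ac)
      finally show ?case by simp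
    qed
    show ?thesis by (rule Bochner_Integration.integrable_bound[OF _ m b]) (rule integrable_scaleR_right[OF J(2)])
  qed
  have qL: "AE x in ?L. q1 x + v x v* J2 x = q x"
    using q'(1) ve AE\<Omega> by eventually_elim (use q(2) sub in auto)
  have "flux_domain \<Omega> n S q R"
  proof (unfold_locales)
    show "open \<Omega>" "bounded \<Omega>" "outward_unit_normal \<Omega> n" "surface_measure \<Omega> S" "continuous_on UNIV q" "integrable ?L R"
      using \<Omega> dom q Ri by auto
    fix \<phi> assume \<phi>: "test_function \<Omega> \<phi>"
    note sm = test_functionD(1)[OF \<phi>]
    have \<phi>c: "continuous_on UNIV \<phi>" by (rule smooth_imp_continuous[OF sm])
    have gc: "continuous_on UNIV (grad \<phi>)" by (rule continuous_on_grad[OF sm])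
    have \<phi>m: "\<phi> \<in> borel_measurable ?L" by (rule continuous_lebesgue_on_measurable[OF \<phi>c])
    have gm: "grad \<phi> \<in> borel_measurable ?L" by (rule continuous_lebesgue_on_measurable[OF gc])
    obtain cg where cg: "\<And>x. norm (grad \<phi> x) \<le> cg" using grad_bounded(1)[OF \<phi>] by blast
    obtain c\<phi> where c\<phi>: "\<And>x. norm (\<phi> x) \<le> c\<phi>" using grad_bounded(2)[OF \<phi>] by blast
    have gi: "integrable ?L (\<lambda>x. f x \<bullet> grad \<phi> x)" if "integrable ?L f" for f
      by (rule integrable_inner_bounded(1)[OF that gm, of cg]) (use cg in auto)
    have \<phi>i: "integrable ?L (\<lambda>x. \<phi> x * f x)" if "integrable ?L f" for f :: "real^'d \<Rightarrow> real"
      using integrable_inner_bounded(2)[OF that \<phi>m, of c\<phi>] c\<phi> by auto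
    define g where "g a x = (if x \<in> \<Omega> then \<phi> x *\<^sub>R w x a + v x $ a *\<^sub>R grad \<phi> x else 0)" for a x
    have T: "C1_test \<Omega> (\<lambda>x. if x \<in> \<Omega> then \<phi> x * v x $ a else 0) (g a)" for a
      unfolding g_def by (rule C1_test_times[OF \<Omega>(1) vD wc test_function_C1_test[OF \<phi>]])
    have Ji: "integrable ?L (\<lambda>x. J1 x $ a)" "integrable ?L (\<lambda>x. J2 x $ a)" "integrable ?L (\<lambda>x. \<rho> x $ a)" for a
      using J \<rho> by (auto intro: integrable_bounded_linear[OF bounded_linear_vec_nth])
    have gam: "g a \<in> borel_measurable ?L" for a
      by (rule continuous_lebesgue_on_measurable[OF C1_testD(2)[OF T]])
    have gab: "\<exists>c. \<forall>x. norm (g a x) \<le> c" for a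
    proof -
      obtain L' R where "\<And>x. norm (g a x) \<le> L'" by (rule C1_test_bounds[OF T]) (rule that; blast)
      then show ?thesis by blast
    qed
    have Jgi: "integrable ?L (\<lambda>x. f x \<bullet> g a x)" if "integrable ?L f" for f a
    proof -
      obtain c where "\<And>x. norm (g a x) \<le> c" using gab[of a] by blast
      then show ?thesis by (intro integrable_inner_bounded(1)[OF that gam, where c=c]) auto
    qed
    have row: "- (LINT x|?L. (J1 x $ a + J2 x $ a) \<bullet> g a x) = (LINT x|?L. (\<phi> x * v x $ a) * \<rho> x $ a)"
      and rowi: "integrable ?L (\<lambda>x. (\<phi> x * v x $ a) * \<rho> x $ a)" for a
    proof -
      have D: "- (LINT x|?L. (J1 x $ a + J2 x $ a) \<bullet> grad \<phi> x) = (LINT x|?L. \<phi> x * \<rho> x $ a)"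
        if \<phi>: "test_function \<Omega> \<phi>" for \<phi>
      proof -
        note sm = test_functionD(1)[OF \<phi>]
        have gm: "grad \<phi> \<in> borel_measurable ?L" 
          by (rule continuous_lebesgue_on_measurable[OF continuous_on_grad[OF sm]])
        have \<phi>m: "\<phi> \<in> borel_measurable ?L"
          by (rule continuous_lebesgue_on_measurable[OF smooth_imp_continuous[OF sm]])
        obtain cg where cg: "\<And>x. norm (grad \<phi> x) \<le> cg" using grad_bounded(1)[OF \<phi>] by blast
        obtain c\<phi> where c\<phi>: "\<And>x. norm (\<phi> x) \<le> c\<phi>" using grad_bounded(2)[OF \<phi>] by blast
        have comp: "((J1 x + J2 x) *v grad \<phi> x) $ b = (J1 x $ b + J2 x $ b) \<bullet> grad \<phi> x" for x b
          by (simp add: matrix_vector_mult_def inner_vec_def)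
        have i: "integrable ?L (\<lambda>x. (J1 x $ b + J2 x $ b) \<bullet> grad \<phi> x)" for b
          by (rule integrable_inner_bounded(1)[OF _ gm, of _ cg]) (use cg Ji in auto)
        have "integrable ?L (\<lambda>x. \<Sum>b\<in>UNIV. ((J1 x $ b + J2 x $ b) \<bullet> grad \<phi> x) *\<^sub>R (axis b 1 :: real^'m))"
          by (intro Bochner_Integration.integrable_sum integrable_scaleR_left i)
        also have "(\<lambda>x. \<Sum>b\<in>UNIV. ((J1 x $ b + J2 x $ b) \<bullet> grad \<phi> x) *\<^sub>R (axis b 1 :: real^'m)) = (\<lambda>x. (J1 x + J2 x) *v grad \<phi> x)"
          unfolding comp[symmetric] scalar_mult_eq_scaleR[symmetric] by (simp only: basis_expansion)
        finally have I: "integrable ?L (\<lambda>x. (J1 x + J2 x) *v grad \<phi> x)" .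
        have I2: "integrable ?L (\<lambda>x. \<phi> x *\<^sub>R \<rho> x)"
        proof (rule Bochner_Integration.integrable_bound[of _ "\<lambda>x. c\<phi> *\<^sub>R \<rho> x"])
          show "AE x in ?L. norm (\<phi> x *\<^sub>R \<rho> x) \<le> norm (c\<phi> *\<^sub>R \<rho> x)"
            using c\<phi> by (intro AE_I2) (auto intro!: mult_right_mono intro: order_trans[OF _ abs_ge_self])
        qed (use \<rho> \<phi>m in auto)
        have "- (LINT x|?L. (J1 x + J2 x) *v grad \<phi> x) = (LINT x|?L. \<phi> x *\<^sub>R \<rho> x)"
          using div \<phi> unfolding has_distr_div_def by blast
        from arg_cong[OF this, of "\<lambda>y. y $ a"]
        have "- ((LINT x|?L. (J1 x + J2 x) *v grad \<phi> x) $ a) = (LINT x|?L. \<phi> x *\<^sub>R \<rho> x) $ a"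
          by (simp only: vector_uminus_component)
        then show ?thesis
          using integral_bounded_linear[OF bounded_linear_vec_nth I, of a] integral_bounded_linear[OF bounded_linear_vec_nth I2, of a]
          by (simp add: comp)
      qed
      have ji: "integrable ?L (\<lambda>x. J1 x $ a + J2 x $ a)" using Ji by simp
      have eq: "(if x \<in> \<Omega> then \<phi> x * v x $ a else 0) * \<rho> x $ a = (\<phi> x * v x $ a) * \<rho> x $ a" if "x \<in> space ?L" for x
        using that by simp
      note DD = distr_div_C1_test[OF \<Omega>(1) ji Ji(3)[of a] D T[of a]]
      have "(LINT x|?L. (if x \<in> \<Omega> then \<phi> x * v x $ a else 0) * \<rho> x $ a) = (LINT x|?L. (\<phi> x * v x $ a) * \<rho> x $ a)"
        by (rule Bochner_Integration.integral_cong) (use eq in auto)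
      then show "- (LINT x|?L. (J1 x $ a + J2 x $ a) \<bullet> g a x) = (LINT x|?L. (\<phi> x * v x $ a) * \<rho> x $ a)"
        using DD(1) by simp
      show "integrable ?L (\<lambda>x. (\<phi> x * v x $ a) * \<rho> x $ a)"
        using DD(3) by (rule Bochner_Integration.integrable_cong[THEN iffD1, rotated 2]) (use eq in auto)
    qed
    \<comment> \<open>The components of \<open>\<phi> v\<close>, extended by zero, are only \<open>C\<^sup>1\<close>; each row is tested with its own component.\<close>
    have A: "- (LINT x|?L. (\<Sum>a\<in>UNIV. J1 x $ a \<bullet> g a x)) - (LINT x|?L. (\<Sum>a\<in>UNIV. J2 x $ a \<bullet> g a x)) = (LINT x|?L. \<phi> x * (v x \<bullet> \<rho> x))"
    proof -
      have "(LINT x|?L. \<phi> x * (v x \<bullet> \<rho> x)) = (LINT x|?L. (\<Sum>a\<in>UNIV. (\<phi> x * v x $ a) * \<rho> x $ a))"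
        by (simp add: inner_vec_def sum_distrib_left mult.assoc)
      also have "\<dots> = (\<Sum>a\<in>UNIV. LINT x|?L. (\<phi> x * v x $ a) * \<rho> x $ a)"
        by (rule Bochner_Integration.integral_sum) (rule rowi)
      also have "\<dots> = (\<Sum>a\<in>UNIV. - (LINT x|?L. (J1 x $ a + J2 x $ a) \<bullet> g a x))" by (simp only: row)
      also have "\<dots> = (\<Sum>a\<in>UNIV. - (LINT x|?L. J1 x $ a \<bullet> g a x) - (LINT x|?L. J2 x $ a \<bullet> g a x))"
        by (intro sum.cong refl) (simp add: inner_add_left Jgi Ji)
      also have "\<dots> = - (LINT x|?L. (\<Sum>a\<in>UNIV. J1 x $ a \<bullet> g a x)) - (LINT x|?L. (\<Sum>a\<in>UNIV. J2 x $ a \<bullet> g a x))"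
        by (subst (1 2) Bochner_Integration.integral_sum) (auto simp: Jgi Ji sum_subtractf sum_negf)
      finally show ?thesis by simp
    qed
    have "distr_mult_div \<Omega> e J1 \<phi> = - (LINT x|?L. (\<Sum>a\<in>UNIV. J1 x $ a \<bullet> g a x))"
    proof -
      have "AE x in ?L. wgrad \<Omega> (\<lambda>y. \<phi> y *\<^sub>R e y) x = (\<chi> a. \<phi> x *\<^sub>R w x a + v x $ a *\<^sub>R grad \<phi> x)"
      proof (rule wgrad_classical[OF \<Omega>(1), where v="\<lambda>y. \<phi> y *\<^sub>R v y"])
        show "AE x in ?L. \<phi> x *\<^sub>R v x = \<phi> x *\<^sub>R e x" using ve by eventually_elim simp
        show "((\<lambda>x. (\<phi> x *\<^sub>R v x) $ a) has_derivative (\<lambda>h. (\<phi> x *\<^sub>R w x a + v x $ a *\<^sub>R grad \<phi> x) \<bullet> h)) (at x)" if "x \<in> \<Omega>" for x a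
          using has_derivative_mult[OF smooth_has_grad[OF sm] vD[OF that, of a]] by (simp add: inner_add_left mult.commute)
        show "continuous_on \<Omega> (\<lambda>x. \<phi> x *\<^sub>R w x a + v x $ a *\<^sub>R grad \<phi> x)" for a
          by (intro continuous_intros continuous_on_subset[OF \<phi>c] continuous_on_subset[OF gc] wc vc) auto
      qed
      with AE\<Omega> have "AE x in ?L. (\<Sum>a\<in>UNIV. J1 x $ a \<bullet> g a x) = J1 x \<bullet> wgrad \<Omega> (\<lambda>y. \<phi> y *\<^sub>R e y) x"
        by eventually_elim (simp add: inner_vec_def[of "J1 _"] g_def)
      moreover have "(\<lambda>x. \<Sum>a\<in>UNIV. J1 x $ a \<bullet> g a x) \<in> borel_measurable ?L"
        by (intro borel_measurable_sum borel_measurable_integrable Jgi Ji)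
      ultimately show ?thesis
        unfolding distr_mult_div_def by (subst lebesgue_on_cong_AE(1)[OF \<Omega>l, symmetric]) (assumption | rule refl)+
    qed
    then have B: "- (LINT x|?L. (\<Sum>a\<in>UNIV. J1 x $ a \<bullet> g a x)) = - (LINT x|?L. q1 x \<bullet> grad \<phi> x)"
      using mult[OF \<phi>] by (simp add: distr_div_def)
    \<comment> \<open>The product rule for the contribution of \<open>J2\<close>.\<close>
    have C: "(LINT x|?L. (\<Sum>a\<in>UNIV. J2 x $ a \<bullet> g a x)) = (LINT x|?L. \<phi> x * (P x \<bullet> J2 x)) + (LINT x|?L. (v x v* J2 x) \<bullet> grad \<phi> x)"
    proof -
      have "(LINT x|?L. (\<Sum>a\<in>UNIV. J2 x $ a \<bullet> g a x)) = (LINT x|?L. \<phi> x * (P x \<bullet> J2 x) + (v x v* J2 x) \<bullet> grad \<phi> x)"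
      proof (rule Bochner_Integration.integral_cong[OF refl])
        fix x assume "x \<in> space ?L"
        moreover have "P x \<bullet> J2 x = (\<Sum>a\<in>UNIV. w x a \<bullet> J2 x $ a)"
          by (subst inner_vec_def) (simp add: P_def)
        ultimately show "(\<Sum>a\<in>UNIV. J2 x $ a \<bullet> g a x) = \<phi> x * (P x \<bullet> J2 x) + (v x v* J2 x) \<bullet> grad \<phi> x"
          by (simp add: g_def inner_vector_matrix inner_add_right sum.distrib
              sum_distrib_left inner_commute[of "J2 _ $ _" "w _ _"])
      qed
      then show ?thesis using Bochner_Integration.integral_add[OF \<phi>i[OF PJ] gi[OF vJ2]] by simp
    qed
    have "(LINT x|?L. \<phi> x * R x) = (LINT x|?L. \<phi> x * (v x \<bullet> \<rho> x)) + (LINT x|?L. \<phi> x * (P x \<bullet> J2 x))"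
      unfolding R_def distrib_left by (rule Bochner_Integration.integral_add[OF \<phi>i[OF v\<rho>] \<phi>i[OF PJ]])
    also have "\<dots> = - ((LINT x|?L. q1 x \<bullet> grad \<phi> x) + (LINT x|?L. (v x v* J2 x) \<bullet> grad \<phi> x))"
      using A B C by simp
    also have "(LINT x|?L. q1 x \<bullet> grad \<phi> x) + (LINT x|?L. (v x v* J2 x) \<bullet> grad \<phi> x) = (LINT x|?L. q1 x \<bullet> grad \<phi> x + (v x v* J2 x) \<bullet> grad \<phi> x)"
      by (rule Bochner_Integration.integral_add[OF gi[OF q1] gi[OF vJ2], symmetric])
    also have "\<dots> = (LINT x|?L. q x \<bullet> grad \<phi> x)"
    proof (rule lebesgue_on_cong_AE(1)[OF \<Omega>l])
      show "(\<lambda>x. q1 x \<bullet> grad \<phi> x + (v x v* J2 x) \<bullet> grad \<phi> x) \<in> borel_measurable ?L"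
        using gi[OF q1] gi[OF vJ2] by (intro borel_measurable_integrable Bochner_Integration.integrable_add)
      show "AE x in ?L. q1 x \<bullet> grad \<phi> x + (v x v* J2 x) \<bullet> grad \<phi> x = q x \<bullet> grad \<phi> x"
        using qL by eventually_elim (simp flip: inner_add_left)
    qed
    finally show "- (LINT x|?L. q x \<bullet> grad \<phi> x) = (LINT x|?L. \<phi> x * R x)" by simp
  qed
  then interpret fd: flux_domain \<Omega> n S q R .
  have "(LINT x|?L. R x) = (LINT x|S. q x \<bullet> n x)"
    by (rule fd.divergence_theorem) (use dom(1) in \<open>auto simp: bounded_lipschitz_domain_def\<close>)
  also have "\<dots> = c" unfolding q'(3)
    by (rule Bochner_Integration.integral_cong) (use q(2) in \<open>auto simp: fd.space_S frontier_def\<close>)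
  finally have "(LINT x|?L. R x) = c" .
  moreover have "(LINT x|?L. R x) = (LINT x|?L. v x \<bullet> \<rho> x) + (LINT x|?L. P x \<bullet> J2 x)"
    unfolding R_def by (rule Bochner_Integration.integral_add[OF v\<rho> PJ])
  ultimately show "(LINT x|?L. e x \<bullet> \<rho> x) + (LINT x|?L. wgrad \<Omega> e x \<bullet> J2 x) = c"
    using ce(1) cJ(1) by simp
qed

section \<open>Symmetry of the Hessian\<close>

text \<open>
  The mean value theorem for the increment in direction \<open>w\<close>, as a function of the parameter along
  \<open>u\<close>, and then once more along \<open>w\<close>.
\<close>

lemma second_difference_mean_value:
  fixes f :: "'a::real_normed_vector \<Rightarrow> real"
  assumes D: "\<And>x. x \<in> V \<Longrightarrow> (f has_derivative D x) (at x)"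
    and E: "\<And>x. x \<in> V \<Longrightarrow> ((\<lambda>y. D y u) has_derivative E x) (at x)"
    and V: "\<And>a b. a \<in> {0..t} \<Longrightarrow> b \<in> {0..t} \<Longrightarrow> v + a *\<^sub>R u + b *\<^sub>R w \<in> V" and t: "t > 0"
  shows "\<exists>a\<in>{0<..<t}. \<exists>b\<in>{0<..<t}. f (v + t *\<^sub>R u + t *\<^sub>R w) - f (v + t *\<^sub>R u) - f (v + t *\<^sub>R w) + f v
      = t * t * E (v + a *\<^sub>R u + b *\<^sub>R w) w"
proof -
  define p where "p s = f (v + s *\<^sub>R u + t *\<^sub>R w) - f (v + s *\<^sub>R u)" for s
  have fD: "((\<lambda>s. f (c + s *\<^sub>R u)) has_real_derivative D (c + s *\<^sub>R u) u) (at s)" if "c + s *\<^sub>R u \<in> V" for c s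
  proof -
    have "((\<lambda>s. f (c + s *\<^sub>R u)) has_derivative (\<lambda>h. D (c + s *\<^sub>R u) (h *\<^sub>R u))) (at s)"
      by (rule has_derivative_compose[of "\<lambda>s. c + s *\<^sub>R u" "\<lambda>h. h *\<^sub>R u" s UNIV f, OF _ D[OF that]])
         (auto intro!: derivative_eq_intros)
    moreover have "(\<lambda>h. D (c + s *\<^sub>R u) (h *\<^sub>R u)) = (*) (D (c + s *\<^sub>R u) u)"
      using linear_cmul[OF has_derivative_linear[OF D[OF that]]] by (auto simp: mult.commute)
    ultimately show ?thesis by (simp add: has_field_derivative_def)
  qed
  have pD: "(p has_real_derivative D (v + t *\<^sub>R w + s *\<^sub>R u) u - D (v + s *\<^sub>R u) u) (at s)" if "0 \<le> s" "s \<le> t" for s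
  proof -
    have m: "v + t *\<^sub>R w + s *\<^sub>R u \<in> V" "v + s *\<^sub>R u \<in> V"
      using V[of s t] V[of s 0] that t by (auto simp: algebra_simps)
    have "p = (\<lambda>s. f (v + t *\<^sub>R w + s *\<^sub>R u) - f (v + s *\<^sub>R u))"
      by (simp add: p_def[abs_def] algebra_simps)
    then show ?thesis using DERIV_diff[OF fD[OF m(1)] fD[OF m(2)]] by simp
  qed
  have "\<exists>a>0. a < t \<and> p t - p 0 = (t - 0) * (D (v + t *\<^sub>R w + a *\<^sub>R u) u - D (v + a *\<^sub>R u) u)"
    by (rule MVT2[OF t]) (rule pD)
  then obtain a where a: "0 < a" "a < t" "p t - p 0 = (t - 0) * (D (v + t *\<^sub>R w + a *\<^sub>R u) u - D (v + a *\<^sub>R u) u)"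
    by blast
  define r where "r s = D (v + a *\<^sub>R u + s *\<^sub>R w) u" for s
  have rD: "(r has_real_derivative E (v + a *\<^sub>R u + s *\<^sub>R w) w) (at s)" if "0 \<le> s" "s \<le> t" for s
  proof -
    have m: "v + a *\<^sub>R u + s *\<^sub>R w \<in> V" using V[of a s] that a by auto
    have "((\<lambda>s. D (v + a *\<^sub>R u + s *\<^sub>R w) u) has_derivative (\<lambda>h. E (v + a *\<^sub>R u + s *\<^sub>R w) (h *\<^sub>R w))) (at s)"
      by (rule has_derivative_compose[of "\<lambda>s. v + a *\<^sub>R u + s *\<^sub>R w" "\<lambda>h. h *\<^sub>R w" s UNIV "\<lambda>y. D y u", OF _ E[OF m]])
         (auto intro!: derivative_eq_intros)
    moreover have "(\<lambda>h. E (v + a *\<^sub>R u + s *\<^sub>R w) (h *\<^sub>R w)) = (*) (E (v + a *\<^sub>R u + s *\<^sub>R w) w)"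
      using linear_cmul[OF has_derivative_linear[OF E[OF m]]] by (auto simp: mult.commute)
    ultimately show ?thesis by (simp add: has_field_derivative_def r_def[abs_def])
  qed
  have "\<exists>b>0. b < t \<and> r t - r 0 = (t - 0) * E (v + a *\<^sub>R u + b *\<^sub>R w) w"
    by (rule MVT2[OF t]) (rule rD)
  then obtain b where b: "0 < b" "b < t" "r t - r 0 = (t - 0) * E (v + a *\<^sub>R u + b *\<^sub>R w) w"
    by blast
  have "f (v + t *\<^sub>R u + t *\<^sub>R w) - f (v + t *\<^sub>R u) - f (v + t *\<^sub>R w) + f v = p t - p 0"
    by (simp add: p_def)
  also have "\<dots> = t * (r t - r 0)" using a(3) by (simp add: r_def algebra_simps)
  also have "\<dots> = t * t * E (v + a *\<^sub>R u + b *\<^sub>R w) w" using b(3) by simp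
  finally show ?thesis using a b by (intro bexI[of _ a] bexI[of _ b]) auto
qed

text \<open>
  The second difference is symmetric in \<open>u\<close> and \<open>w\<close>; hence the two mixed derivatives agree at points
  arbitrarily close to \<open>v\<close>, and by continuity at \<open>v\<close>.
\<close>

lemma second_derivative_symmetric:
  fixes f :: "'a::real_normed_vector \<Rightarrow> real"
  assumes V: "open V" "v \<in> V"
    and D: "\<And>x. x \<in> V \<Longrightarrow> (f has_derivative D x) (at x)"
    and E: "\<And>x u. x \<in> V \<Longrightarrow> ((\<lambda>y. D y u) has_derivative E u x) (at x)"
    and cont: "\<And>u w. continuous_on V (\<lambda>x. E u x w)"
  shows "E u v w = E w v u"
proof (rule ccontr)
  assume ne: "E u v w \<noteq> E w v u"
  define e where "e = \<bar>E u v w - E w v u\<bar> / 2"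
  have e: "e > 0" using ne by (simp add: e_def)
  have near: "\<exists>d>0. \<forall>y. dist y v < d \<longrightarrow> y \<in> V \<and> \<bar>E u y w - E u v w\<bar> < e" for u w
  proof -
    obtain d1 where d1: "d1 > 0" "\<And>y. y \<in> V \<Longrightarrow> dist y v < d1 \<Longrightarrow> dist (E u y w) (E u v w) < e"
      using cont[of u w] V(2) e unfolding continuous_on_iff by blast
    obtain d2 where d2: "d2 > 0" "ball v d2 \<subseteq> V" using V open_contains_ball by blast
    show ?thesis
      using d1 d2 by (intro exI[of _ "min d1 d2"]) (auto simp: dist_real_def dist_commute subset_iff)
  qed
  obtain d1 where d1: "d1 > 0" "\<And>y. dist y v < d1 \<Longrightarrow> y \<in> V \<and> \<bar>E u y w - E u v w\<bar> < e" using near by blast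
  obtain d2 where d2: "d2 > 0" "\<And>y. dist y v < d2 \<Longrightarrow> y \<in> V \<and> \<bar>E w y u - E w v u\<bar> < e" using near by blast
  define d where "d = min d1 d2"
  define t where "t = d / (2 * (norm u + norm w + 1))"
  have d: "d > 0" using d1 d2 by (simp add: d_def)
  have t: "t > 0" using d by (auto simp: t_def intro!: divide_pos_pos add_nonneg_pos)
  have cl: "dist (v + a *\<^sub>R u + b *\<^sub>R w) v < d" if "a \<in> {0..t}" "b \<in> {0..t}" for a b
  proof -
    have "dist (v + a *\<^sub>R u + b *\<^sub>R w) v = norm (a *\<^sub>R u + b *\<^sub>R w)" by (simp add: dist_norm)
    also have "\<dots> \<le> a * norm u + b * norm w" using norm_triangle_ineq[of "a *\<^sub>R u" "b *\<^sub>R w"] that by simp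
    also have "\<dots> \<le> t * norm u + t * norm w" using that by (intro add_mono mult_right_mono) auto
    also have "\<dots> \<le> t * (norm u + norm w + 1)" using t by (simp add: algebra_simps)
    also have "\<dots> = d / 2"
    proof -
      have "norm u + norm w + 1 \<noteq> 0" by (smt (verit) norm_ge_zero)
      then show ?thesis by (simp add: t_def field_simps)
    qed
    also have "\<dots> < d" using d by simp
    finally show ?thesis .
  qed
  have VV: "v + a *\<^sub>R u + b *\<^sub>R w \<in> V" "v + a *\<^sub>R w + b *\<^sub>R u \<in> V" if "a \<in> {0..t}" "b \<in> {0..t}" for a b
    using cl[OF that] cl[OF that(2,1)] d1(2) by (auto simp: d_def algebra_simps)
  obtain a b where ab: "a \<in> {0<..<t}" "b \<in> {0<..<t}"
    "f (v + t *\<^sub>R u + t *\<^sub>R w) - f (v + t *\<^sub>R u) - f (v + t *\<^sub>R w) + f v = t * t * E u (v + a *\<^sub>R u + b *\<^sub>R w) w"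
    using second_difference_mean_value[of V f D u "E u" t v w, OF D E VV(1) t] by blast
  obtain a' b' where ab': "a' \<in> {0<..<t}" "b' \<in> {0<..<t}"
    "f (v + t *\<^sub>R w + t *\<^sub>R u) - f (v + t *\<^sub>R w) - f (v + t *\<^sub>R u) + f v = t * t * E w (v + a' *\<^sub>R w + b' *\<^sub>R u) u"
    using second_difference_mean_value[of V f D w "E w" t v u, OF D E VV(2) t] by blast
  have "t * t * E u (v + a *\<^sub>R u + b *\<^sub>R w) w = t * t * E w (v + a' *\<^sub>R w + b' *\<^sub>R u) u"
    using ab(3) ab'(3) by (simp add: algebra_simps)
  then have eq: "E u (v + a *\<^sub>R u + b *\<^sub>R w) w = E w (v + a' *\<^sub>R w + b' *\<^sub>R u) u" using t by simp
  have "\<bar>E u (v + a *\<^sub>R u + b *\<^sub>R w) w - E u v w\<bar> < e"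
    using d1(2) cl[of a b] ab by (auto simp: d_def)
  moreover have "\<bar>E w (v + a' *\<^sub>R w + b' *\<^sub>R u) u - E w v u\<bar> < e"
    using d2(2) cl[of b' a'] ab' by (auto simp: d_def algebra_simps)
  ultimately show False unfolding eq using e_def by (simp add: abs_if split: if_splits)
qed

lemma hessian_symmetric:
  fixes f :: "real^'m \<Rightarrow> real"
  assumes V: "open V" "v \<in> V" and f: "Ck_upto 2 V V f"
  shows "x \<bullet> (jacobian (grad f) (at v) *v y) = (jacobian (grad f) (at v) *v x) \<bullet> y"
proof -
  define D where "D x = frechet_derivative f (at x)" for x
  define E where "E u x = frechet_derivative (\<lambda>y. D y u) (at x)" for u x
  have f2: "Ck_upto (Suc (Suc 0)) V V f" using f by (simp add: numeral_2_eq_2)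
  have D: "(f has_derivative D x) (at x)" if "x \<in> V" for x
    using f2 that by (auto simp: D_def simp flip: frechet_derivative_works)
  have f1: "Ck_upto 1 V V (\<lambda>x. D x u)" for u using f2 by (simp add: D_def One_nat_def)
  have E: "((\<lambda>y. D y u) has_derivative E u x) (at x)" if "x \<in> V" for x u
    using Ck_upto_1_D(1)[OF f1 that] by (simp add: E_def)
  have cont: "continuous_on V (\<lambda>x. E u x w)" for u w
    unfolding E_def by (rule continuous_extension_imp[OF Ck_upto_1_D(3)[OF f1]]) simp
  have sym: "E u v w = E w v u" for u w
    by (rule second_derivative_symmetric[OF V D E cont])
  have g: "(grad f has_derivative (\<lambda>h. \<chi> i. E (axis i 1) v h)) (at v)"
  proof -
    have "grad f = (\<lambda>x. \<chi> i. D x (axis i 1))" by (simp add: grad_def[abs_def] D_def)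
    moreover have "((\<lambda>x. \<chi> i. D x (axis i 1)) has_derivative (\<lambda>h. \<chi> i. E (axis i 1) v h)) (at v)"
      unfolding has_derivative_componentwise_within[of "\<lambda>x. \<chi> i. D x (axis i 1)"]
      using E[OF V(2)] by (auto simp: Basis_vec_def inner_axis)
    ultimately show ?thesis by simp
  qed
  have J: "jacobian (grad f) (at v) $ i $ j = E (axis i 1) v (axis j 1)" for i j
    by (simp add: jacobian_def matrix_def frechet_derivative_at[OF g, symmetric])
  have "transpose (jacobian (grad f) (at v)) = jacobian (grad f) (at v)"
    unfolding vec_eq_iff transpose_def by (simp add: J) (intro allI sym)
  then have "jacobian (grad f) (at v) *v x = x v* jacobian (grad f) (at v)"
    using transpose_matrix_vector[of "jacobian (grad f) (at v)" x] by simp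
  then show ?thesis by (simp only: dot_lmul_matrix)
qed

section \<open>The derivative of the linearized energy\<close>

lemma joint_C1_time_derivative:
  fixes w :: "real \<Rightarrow> 'a::real_normed_vector \<Rightarrow> 'b::real_normed_vector"
  assumes w: "Ck_upto 1 (I \<times> \<Omega>) Tt (\<lambda>(t, x). w t x)" and tx: "t \<in> I" "x \<in> \<Omega>"
  shows "((\<lambda>s. w s x) has_vector_derivative frechet_derivative (\<lambda>(t, x). w t x) (at (t, x)) (1, 0)) (at t)"
proof -
  let ?D = "frechet_derivative (\<lambda>(t, x). w t x) (at (t, x))"
  have D: "((\<lambda>(t, x). w t x) has_derivative ?D) (at (t, x))"
    by (rule Ck_upto_1_D(1)[OF w]) (use tx in auto)
  have "((\<lambda>s. (\<lambda>(t, x). w t x) (s, x)) has_derivative (\<lambda>h. ?D (h, 0))) (at t)"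
    by (rule has_derivative_compose[of "\<lambda>s. (s, x)" "\<lambda>h. (h, 0)" t UNIV, OF _ D])
       (auto intro!: derivative_eq_intros)
  moreover have "(\<lambda>h. ?D (h, 0)) = (\<lambda>h. h *\<^sub>R ?D (1, 0))"
  proof
    fix h :: real
    have "?D (h, 0) = ?D (h *\<^sub>R (1, 0))" by (simp only: scaleR_Pair scaleR_zero_right real_scaleR_def mult_1_right)
    also have "\<dots> = h *\<^sub>R ?D (1, 0)" by (rule linear_cmul[OF has_derivative_linear[OF D]])
    finally show "?D (h, 0) = h *\<^sub>R ?D (1, 0)" .
  qed
  ultimately show ?thesis unfolding has_vector_derivative_def by (simp only: prod.case)
qed

text \<open>
  The matrix field \<open>H\<close> may be unbounded, so the energy is differentiated in the form \<open>\<integral> w \<bullet> \<eta>\<close>, in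
  which both factors are \<open>C\<^sup>1\<close> up to the boundary. The relation \<open>\<eta> = H w\<close> holds for each time at
  almost every point; the exceptional set can be chosen independently of the time, because countably
  many times determine two continuous functions. It can then be differentiated in time, and the
  symmetry of \<open>H\<close> makes the two terms of the product rule equal.
\<close>

lemma quadratic_energy_derivative:
  fixes w \<eta> :: "real \<Rightarrow> real^'d \<Rightarrow> real^'m" and H :: "real^'d \<Rightarrow> real^'m^'m"
  assumes \<Omega>: "open \<Omega>" "bounded \<Omega>"
    and w: "Ck_upto 1 ({0<..<\<tau>} \<times> \<Omega>) ({0<..<\<tau>} \<times> closure \<Omega>) (\<lambda>(t, x). w t x)"
    and \<eta>: "Ck_upto 1 ({0<..<\<tau>} \<times> \<Omega>) ({0<..<\<tau>} \<times> closure \<Omega>) (\<lambda>(t, x). \<eta> t x)"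
    and eq: "\<And>t. t \<in> {0<..<\<tau>} \<Longrightarrow> AE x in lebesgue_on \<Omega>. \<eta> t x = H x *v w t x"
    and sym: "AE x in lebesgue_on \<Omega>. \<forall>u v. u \<bullet> (H x *v v) = (H x *v u) \<bullet> v"
    and t: "t \<in> {0<..<\<tau>}"
  shows "((\<lambda>s. (1/2) * (LINT x|lebesgue_on \<Omega>. w s x \<bullet> (H x *v w s x))) has_real_derivative
      (LINT x|lebesgue_on \<Omega>. (H x *v w t x) \<bullet> time_deriv w t x)) (at t)"
    and "integrable (lebesgue_on \<Omega>) (\<lambda>x. (H x *v w t x) \<bullet> time_deriv w t x)"
proof -
  let ?L = "lebesgue_on \<Omega>" and ?I = "{0<..<\<tau>}"
  have \<Omega>l: "\<Omega> \<in> sets lebesgue" using \<Omega> by auto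
  have cpt: "compact (closure \<Omega>)" using \<Omega> by (simp add: compact_closure)
  have sub: "\<Omega> \<subseteq> closure \<Omega>" by (rule closure_subset)
  have sub2: "?I \<times> \<Omega> \<subseteq> ?I \<times> closure \<Omega>" using sub by auto
  have AE\<Omega>: "AE x in ?L. x \<in> \<Omega>" by (intro AE_I2) auto
  let ?W = "\<lambda>(t, x). w t x" and ?N = "\<lambda>(t, x). \<eta> t x"
  define dw where "dw t x = frechet_derivative ?W (at (t, x)) (1, 0)" for t x
  define dn where "dn t x = frechet_derivative ?N (at (t, x)) (1, 0)" for t x
  have wD: "((\<lambda>s. w s x) has_vector_derivative dw t x) (at t)" if "t \<in> ?I" "x \<in> \<Omega>" for t x
    unfolding dw_def by (rule joint_C1_time_derivative[OF w that])
  have nD: "((\<lambda>s. \<eta> s x) has_vector_derivative dn t x) (at t)" if "t \<in> ?I" "x \<in> \<Omega>" for t x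
    unfolding dn_def by (rule joint_C1_time_derivative[OF \<eta> that])
  have td: "time_deriv w t x = dw t x" if "t \<in> ?I" "x \<in> \<Omega>" for t x
    unfolding time_deriv_def by (rule vector_derivative_at[OF wD[OF that]])
  have slice: "continuous_on \<Omega> (\<lambda>x. f (t, x))" if "\<exists>g. continuous_on (?I \<times> closure \<Omega>) g \<and> (\<forall>z\<in>?I \<times> \<Omega>. g z = f z)" "t \<in> ?I"
    for f :: "real \<times> (real^'d) \<Rightarrow> real^'m" and t
    by (rule continuous_on_compose2[OF continuous_extension_imp[OF that(1) sub2]])
       (use that in \<open>auto intro!: continuous_intros\<close>)
  have cw: "continuous_on \<Omega> (w t)" "continuous_on \<Omega> (dw t)" "continuous_on \<Omega> (\<eta> t)" "continuous_on \<Omega> (dn t)" if "t \<in> ?I" for t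
    using slice[OF Ck_upto_1_D(2)[OF w] that] slice[OF Ck_upto_1_D(3)[OF w] that, of "(1, 0)"]
      slice[OF Ck_upto_1_D(2)[OF \<eta>] that] slice[OF Ck_upto_1_D(3)[OF \<eta>] that, of "(1, 0)"]
    by (simp_all add: dw_def dn_def)
  have meas: "f \<in> borel_measurable ?L" if "continuous_on \<Omega> f" for f :: "real^'d \<Rightarrow> real^'m"
    by (rule continuous_imp_measurable_on_sets_lebesgue[OF that \<Omega>l])
  note mw = meas[OF cw(1)] meas[OF cw(2)] meas[OF cw(3)] meas[OF cw(4)]
  obtain \<delta> where \<delta>: "\<delta> > 0" "cball t \<delta> \<subseteq> ?I" using t open_contains_cball[of ?I] open_greaterThanLessThan by blast
  have cK: "compact (cball t \<delta> \<times> closure \<Omega>)" by (intro compact_Times compact_cball cpt)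
  have sK: "cball t \<delta> \<times> closure \<Omega> \<subseteq> ?I \<times> closure \<Omega>" using \<delta> by auto
  have bnd: "\<exists>c\<ge>0. \<forall>s x. s \<in> cball t \<delta> \<longrightarrow> x \<in> \<Omega> \<longrightarrow> norm (f (s, x)) \<le> c"
    if ext: "\<exists>g. continuous_on (?I \<times> closure \<Omega>) g \<and> (\<forall>z\<in>?I \<times> \<Omega>. g z = f z)" for f :: "real \<times> (real^'d) \<Rightarrow> real^'m"
  proof -
    obtain c where "c \<ge> 0" "\<forall>z\<in>(?I \<times> \<Omega>) \<inter> (cball t \<delta> \<times> closure \<Omega>). norm (f z) \<le> c"
      using continuous_extension_bounded[OF ext cK sK] by blast
    then show ?thesis using \<delta>(2) sub by (intro exI[of _ c]) blast
  qed
  obtain c1 where c1: "c1 \<ge> 0" "\<And>s x. s \<in> cball t \<delta> \<Longrightarrow> x \<in> \<Omega> \<Longrightarrow> norm (w s x) \<le> c1"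
    using bnd[OF Ck_upto_1_D(2)[OF w]] by auto
  obtain c2 where c2: "c2 \<ge> 0" "\<And>s x. s \<in> cball t \<delta> \<Longrightarrow> x \<in> \<Omega> \<Longrightarrow> norm (dw s x) \<le> c2"
    using bnd[OF Ck_upto_1_D(3)[OF w], of "(1, 0)"] unfolding dw_def by auto
  obtain c3 where c3: "c3 \<ge> 0" "\<And>s x. s \<in> cball t \<delta> \<Longrightarrow> x \<in> \<Omega> \<Longrightarrow> norm (\<eta> s x) \<le> c3"
    using bnd[OF Ck_upto_1_D(2)[OF \<eta>]] by auto
  obtain c4 where c4: "c4 \<ge> 0" "\<And>s x. s \<in> cball t \<delta> \<Longrightarrow> x \<in> \<Omega> \<Longrightarrow> norm (dn s x) \<le> c4"
    using bnd[OF Ck_upto_1_D(3)[OF \<eta>], of "(1, 0)"] unfolding dn_def by auto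
  have fin: "finite_measure ?L" using \<Omega> by (simp add: finite_measure_lebesgue_on lmeasurable_open)
  have const: "integrable ?L (\<lambda>x. c)" for c :: real using fin by (simp add: finite_measure.integrable_const)
  define B where "B = c1 * c4 + c2 * c3"
  let ?F = "\<lambda>s x. w s x \<bullet> \<eta> s x" and ?D = "\<lambda>s x. w s x \<bullet> dn s x + dw s x \<bullet> \<eta> s x"
  have FD: "((\<lambda>s. ?F s x) has_derivative (\<lambda>h. ?D s x * h)) (at s)" if "s \<in> ?I" "x \<in> \<Omega>" for s x
    using has_derivative_inner[OF wD[OF that, unfolded has_vector_derivative_def] nD[OF that, unfolded has_vector_derivative_def]]
    by (simp add: algebra_simps)
  have DB: "\<bar>?D s x\<bar> \<le> B" if "s \<in> cball t \<delta>" "x \<in> \<Omega>" for s x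
  proof -
    have "\<bar>?D s x\<bar> \<le> norm (w s x) * norm (dn s x) + norm (dw s x) * norm (\<eta> s x)"
      by (intro order_trans[OF abs_triangle_ineq] add_mono Cauchy_Schwarz_ineq2)
    also have "\<dots> \<le> B" unfolding B_def
      by (intro add_mono mult_mono c1 c2 c3 c4 that) auto
    finally show ?thesis .
  qed
  have FI: "integrable ?L (?F s)" if "s \<in> cball t \<delta>" for s
  proof (rule Bochner_Integration.integrable_bound[OF const[of "c1 * c3"]])
    have "s \<in> ?I" using that \<delta> by auto
    then show "?F s \<in> borel_measurable ?L" using mw by (intro borel_measurable_inner) auto
    show "AE x in ?L. norm (?F s x) \<le> norm (c1 * c3)"
      using AE\<Omega>
    proof eventually_elim
      case (elim x)
      have "\<bar>?F s x\<bar> \<le> norm (w s x) * norm (\<eta> s x)" by (rule Cauchy_Schwarz_ineq2)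
      also have "\<dots> \<le> c1 * c3" by (intro mult_mono c1 c3 that elim) auto
      finally show ?case by simp
    qed
  qed
  have "((\<lambda>s. LINT x|?L. ?F s x) has_derivative (\<lambda>h. LINT x|?L. ?D t x * h)) (at t)"
  proof (rule has_derivative_parametric_integral[where r=\<delta> and B="\<lambda>x. B"])
    show "\<delta> > 0" by (rule \<delta>)
    show "integrable ?L (?F (t + h))" if "norm h < \<delta>" for h
      using that by (intro FI) (auto simp: dist_norm)
    show "AE x in ?L. ((\<lambda>s. ?F s x) has_derivative (\<lambda>h. ?D t x * h)) (at t)"
      using AE\<Omega> by eventually_elim (rule FD[OF t])
    show "(\<lambda>x. ?D t x * h) \<in> borel_measurable ?L" for h
      using mw t by (intro borel_measurable_times borel_measurable_add borel_measurable_inner) auto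
    show "AE x in ?L. \<bar>?F (t + h) x - ?F t x\<bar> \<le> B * norm h" if "norm h < \<delta>" for h
      using AE\<Omega>
    proof eventually_elim
      case (elim x)
      have "norm (?F (t + h) x - ?F t x) \<le> B * norm ((t + h) - t)"
      proof (rule differentiable_bound[where S="cball t \<delta>" and f'="\<lambda>s h. ?D s x * h"])
        show "((\<lambda>s. ?F s x) has_derivative (\<lambda>h. ?D s x * h)) (at s within cball t \<delta>)" if "s \<in> cball t \<delta>" for s
        proof -
          have "s \<in> ?I" using that \<delta> by auto
          then show ?thesis by (rule has_derivative_at_withinI[OF FD[OF _ elim]])
        qed
        show "onorm (\<lambda>h. ?D s x * h) \<le> B" if "s \<in> cball t \<delta>" for s
          by (rule onorm_le) (use DB[OF that elim] in \<open>simp add: abs_mult mult_right_mono\<close>)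
      qed (use that \<delta> in \<open>auto simp: dist_norm\<close>)
      then show ?case by simp
    qed
  qed (rule const)
  then have der: "((\<lambda>s. LINT x|?L. ?F s x) has_real_derivative (LINT x|?L. ?D t x)) (at t)"
    by (simp add: has_field_derivative_def)
  have ae1: "AE x in ?L. \<forall>s\<in>?I. \<eta> s x = H x *v w s x"
  proof -
    \<comment> \<open>Countably many null sets suffice.\<close>
    have "AE x in ?L. \<forall>s\<in>\<rat> \<inter> ?I. \<eta> s x = H x *v w s x"
      by (subst AE_ball_countable) (auto intro: eq countable_Int1 countable_rat)
    with AE\<Omega> show ?thesis
    proof eventually_elim
      case (elim x)
      show ?case
      proof (rule ballI, rule ccontr)
        fix s assume s: "s \<in> ?I" and ne: "\<eta> s x \<noteq> H x *v w s x"
        have c: "isCont (\<lambda>s. \<eta> s x - H x *v w s x) s"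
          using has_vector_derivative_continuous[OF nD[OF s elim(1)]] has_vector_derivative_continuous[OF wD[OF s elim(1)]]
          by (intro continuous_intros bounded_linear.continuous[OF matrix_vector_mul_bounded_linear])
        obtain d where d: "d > 0" "\<And>y. dist s y < d \<Longrightarrow> \<eta> y x - H x *v w y x \<noteq> 0"
          using continuous_at_avoid[OF c, of 0] ne by auto
        define U where "U = ball s d"
        have U: "open U" "s \<in> U" "\<forall>y\<in>U. \<eta> y x - H x *v w y x \<noteq> 0" using d by (auto simp: U_def)
        have "open (U \<inter> ?I)" "s \<in> U \<inter> ?I" using U s by auto
        then obtain e where e: "e > 0" "ball s e \<subseteq> U \<inter> ?I" using open_contains_ball by blast
        obtain y where y: "y \<in> \<rat>" "s < y" "y < s + e" using Rats_dense_in_real[of s "s + e"] e by auto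
        then have "y \<in> ball s e" by (auto simp: dist_real_def)
        then have "y \<in> U \<inter> ?I" using e by blast
        then show False using U(3) elim(2) y by auto
      qed
    qed
  qed
  have ae2: "AE x in ?L. ?D t x = 2 * (\<eta> t x \<bullet> dw t x)"
    using ae1 sym AE\<Omega>
  proof eventually_elim
    case (elim x)
    have "((\<lambda>s. H x *v w s x) has_vector_derivative H x *v dw t x) (at t)"
      by (rule bounded_linear.has_vector_derivative[OF matrix_vector_mul_bounded_linear wD[OF t elim(3)]])
    then have "((\<lambda>s. \<eta> s x) has_vector_derivative H x *v dw t x) (at t)"
      by (rule has_vector_derivative_transform_within_open[where S="?I"]) (use t elim(1) in auto)
    then have "dn t x = H x *v dw t x" using nD[OF t elim(3)] vector_derivative_unique_at by blast
    then show ?case using elim(1,2) t by (simp add: inner_commute)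
  qed
  have ae3: "AE x in ?L. \<eta> t x \<bullet> dw t x = (H x *v w t x) \<bullet> time_deriv w t x"
    using ae1 AE\<Omega> by eventually_elim (use t td in auto)
  have m1: "(\<lambda>x. \<eta> t x \<bullet> dw t x) \<in> borel_measurable ?L"
    using mw t by (intro borel_measurable_inner) auto
  have i1: "integrable ?L (\<lambda>x. \<eta> t x \<bullet> dw t x)"
  proof (rule Bochner_Integration.integrable_bound[OF const[of "c3 * c2"] m1])
    have tt: "t \<in> cball t \<delta>" using \<delta> by simp
    show "AE x in ?L. norm (\<eta> t x \<bullet> dw t x) \<le> norm (c3 * c2)"
      using AE\<Omega>
    proof eventually_elim
      case (elim x)
      have "\<bar>\<eta> t x \<bullet> dw t x\<bar> \<le> norm (\<eta> t x) * norm (dw t x)" by (rule Cauchy_Schwarz_ineq2)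
      also have "\<dots> \<le> c3 * c2" by (intro mult_mono c2 c3 tt elim) auto
      finally show ?case by simp
    qed
  qed
  note C3 = lebesgue_on_cong_AE[OF \<Omega>l m1 ae3]
  show "integrable ?L (\<lambda>x. (H x *v w t x) \<bullet> time_deriv w t x)" using i1 C3(2) by simp
  have "(LINT x|?L. ?D t x) = (LINT x|?L. 2 * (\<eta> t x \<bullet> dw t x))"
  proof (rule lebesgue_on_cong_AE(1)[OF \<Omega>l _ ae2])
    show "?D t \<in> borel_measurable ?L"
      using mw t by (intro borel_measurable_add borel_measurable_inner) auto
  qed
  then have val: "(1/2) * (LINT x|?L. ?D t x) = (LINT x|?L. (H x *v w t x) \<bullet> time_deriv w t x)"
    using C3(1) by simp
  have Feq: "(LINT x|?L. ?F s x) = (LINT x|?L. w s x \<bullet> (H x *v w s x))" if "s \<in> ?I" for s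
  proof (rule lebesgue_on_cong_AE(1)[OF \<Omega>l])
    show "?F s \<in> borel_measurable ?L" using mw that by (intro borel_measurable_inner) auto
    show "AE x in ?L. ?F s x = w s x \<bullet> (H x *v w s x)" using eq[OF that] by eventually_elim simp
  qed
  have "((\<lambda>s. (1/2) * (LINT x|?L. ?F s x)) has_real_derivative (1/2) * (LINT x|?L. ?D t x)) (at t)"
    by (rule DERIV_cmult[OF der])
  then have "((\<lambda>s. (1/2) * (LINT x|?L. ?F s x)) has_real_derivative (LINT x|?L. (H x *v w t x) \<bullet> time_deriv w t x)) (at t)"
    by (simp only: val)
  then show "((\<lambda>s. (1/2) * (LINT x|?L. w s x \<bullet> (H x *v w s x))) has_real_derivative
      (LINT x|?L. (H x *v w t x) \<bullet> time_deriv w t x)) (at t)"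
    by (rule has_field_derivative_transform_within_open[where S="?I"]) (use t Feq in auto)
qed

section \<open>The linearized balance law\<close>

lemma Ck_upto_SucD: "Ck_upto (Suc n) S T f \<Longrightarrow> Ck_upto n S T f"
  by (induction n arbitrary: f) auto

theorem theorem5p6:
  fixes k :: enat
    and T :: "('d::finite, 'm::finite, 'e::real_normed_vector, 'f::real_normed_vector) octs"
    and qrev qdiss :: "(real^'d \<Rightarrow> real^'m) \<Rightarrow> real^'d \<Rightarrow> real^'d"
    and \<sigma> :: "(real^'d \<Rightarrow> real^'m) \<Rightarrow> real^'d \<Rightarrow> real"
    and us :: "real^'d \<Rightarrow> real^'m"
    and M :: "(real^'d \<Rightarrow> real^'m) \<Rightarrow> real^'d \<Rightarrow> real^'d^'m \<Rightarrow> real^'d^'m"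
    and A :: "(real^'d \<Rightarrow> real^'m) \<Rightarrow> real^'d \<Rightarrow> real^'d^'m"
    and G :: "(real^'d \<Rightarrow> real^'m) \<Rightarrow> real^'d \<Rightarrow> real^'m"
    and E :: "(real^'d \<Rightarrow> real^'m) \<Rightarrow> 'e"
    and F :: "(real^'d \<Rightarrow> real^'m) \<Rightarrow> 'f"
    and qlin_rev :: "(real^'d \<Rightarrow> real^'m) \<Rightarrow> real^'d \<Rightarrow> real^'d"
    and \<tau> :: real
    and w :: "real \<Rightarrow> real^'d \<Rightarrow> real^'m"
  assumes "1 \<le> k"
    and "open_continuum_thermodynamic_system k T qrev qdiss \<sigma>"
    and "thermodynamically_consistent k T \<sigma>"
    and "dissipation_neutral_equilibrium T \<sigma> us"
    and "linearizable_class k T us M A G E F qlin_rev"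
    and "boundary_matching k T us M E F qlin_rev"
    and "smooth_linear_solution k T us M A G \<tau> w"
  shows "\<forall>t\<in>{0<..<\<tau>}.
           ((\<lambda>s. F_lin T us (w s)) has_real_derivative
              (- D_lin T us M (w t) + B_lin T E F (w t) + S_lin T us G (w t))) (at t)"
proof
  fix t assume t: "t \<in> {0<..<\<tau>}"
  let ?\<Omega> = "dom T" and ?L = "lebesgue_on (dom T)"
  have geometry: "bounded_lipschitz_domain ?\<Omega>" "outward_unit_normal ?\<Omega> (nrml T)" "surface_measure ?\<Omega> (surf T)"
    using assms(2) by (auto simp: open_continuum_thermodynamic_system_def open_constitutive_structure_def)
  then have \<Omega>: "open ?\<Omega>" "bounded ?\<Omega>" by (auto simp: bounded_lipschitz_domain_def)
  have pert: "smooth_perturbation k T us M (w s)" if "s \<in> {0<..<\<tau>}" for s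
    using assms(7) that by (simp add: smooth_linear_solution_def)
  obtain \<eta> where \<eta>: "\<And>t. t \<in> {0<..<\<tau>} \<Longrightarrow> AE x in ?L. \<eta> t x = eta T us (w t) x"
    "Ck_upto 1 ({0<..<\<tau>} \<times> ?\<Omega>) ({0<..<\<tau>} \<times> closure ?\<Omega>) (\<lambda>(t, x). \<eta> t x)"
    using assms(7) unfolding smooth_linear_solution_def by blast
  have "smooth_upto k ({0<..<\<tau>} \<times> ?\<Omega>) ({0<..<\<tau>} \<times> closure ?\<Omega>) (\<lambda>(t, x). w t x)"
    using assms(7) by (simp add: smooth_linear_solution_def)
  then have w1: "Ck_upto 1 ({0<..<\<tau>} \<times> ?\<Omega>) ({0<..<\<tau>} \<times> closure ?\<Omega>) (\<lambda>(t, x). w t x)"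
    using assms(1) unfolding smooth_upto_def one_enat_def by blast
  have "AE x in ?L. \<exists>V. open V \<and> us x \<in> V \<and> V \<subseteq> states T \<and> Ck_upto 3 V V (psi T x)"
    using assms(5) unfolding linearizable_class_def by blast
  then have sym: "AE x in ?L. \<forall>u v. u \<bullet> (Hstar T us x *v v) = (Hstar T us x *v u) \<bullet> v"
  proof eventually_elim
    case (elim x)
    then obtain V where V: "open V" "us x \<in> V" "Ck_upto 3 V V (psi T x)" by blast
    then have "Ck_upto 2 V V (psi T x)"
      using Ck_upto_SucD[of 2 V V "psi T x"] by (simp add: eval_nat_numeral)
    then show ?case using hessian_symmetric[OF V(1,2)] by (simp add: Hstar_def)
  qed
  note energy = quadratic_energy_derivative[OF \<Omega> w1 \<eta>(2) \<eta>(1)[unfolded eta_def] sym t]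
  have deriv: "((\<lambda>s. F_lin T us (w s)) has_real_derivative
      (LINT x|?L. eta T us (w t) x \<bullet> time_deriv w t x)) (at t)"
    using energy(1) by (simp add: F_lin_def eta_def)
  have dw: "integrable ?L (\<lambda>x. eta T us (w t) x \<bullet> time_deriv w t x)"
    using energy(2) by (simp add: eta_def)
  obtain v where v: "Ck_upto 1 ?\<Omega> (closure ?\<Omega>) v" "AE x in ?L. v x = eta T us (w t) x"
    using pert[OF t] unfolding smooth_perturbation_def by blast
  have JA: "integrable ?L (A (w t))"
  proof -
    have "frechet_L1 T (Jrev T) us A" using assms(5) unfolding linearizable_class_def by blast
    moreover have "w t \<in> H1 ?\<Omega>" using pert[OF t] unfolding smooth_perturbation_def by blast
    ultimately show ?thesis unfolding frechet_L1_def by blast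
  qed
  have JM: "integrable ?L (Jlin_diss T us M (w t))"
    using pert[OF t] unfolding smooth_perturbation_def by blast
  have div: "has_distr_div ?\<Omega> (\<lambda>x. A (w t) x + Jlin_diss T us M (w t) x) (\<lambda>x. G (w t) x - time_deriv w t x)"
    using assms(7) t unfolding smooth_linear_solution_def by blast
  have q: "integrable ?L (qlin_rev (w t))"
    "\<And>\<phi>. test_function ?\<Omega> \<phi> \<Longrightarrow> distr_mult_div ?\<Omega> (eta T us (w t)) (A (w t)) \<phi> = distr_div ?\<Omega> (qlin_rev (w t)) \<phi>"
    using assms(5) pert[OF t] unfolding linearizable_class_def by blast+
  have flux: "has_boundary_flux ?\<Omega> (nrml T) (surf T)
      (\<lambda>x. qlin_rev (w t) x + eta T us (w t) x v* Jlin_diss T us M (w t) x) (- B_lin T E F (w t))"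
    using assms(6) pert[OF t] unfolding boundary_matching_def qlin_diss_def by blast
  note balance = energy_identity[OF geometry v JA JM div q flux]
  have "(LINT x|?L. eta T us (w t) x \<bullet> (G (w t) x - time_deriv w t x))
      = S_lin T us G (w t) - (LINT x|?L. eta T us (w t) x \<bullet> time_deriv w t x)"
  proof -
    have "integrable ?L (\<lambda>x. eta T us (w t) x \<bullet> (G (w t) x - time_deriv w t x) + eta T us (w t) x \<bullet> time_deriv w t x)"
      by (rule Bochner_Integration.integrable_add[OF balance(1) dw])
    then have "integrable ?L (\<lambda>x. eta T us (w t) x \<bullet> G (w t) x)" by (simp flip: inner_add_right)
    from Bochner_Integration.integral_diff[OF this dw] show ?thesis
      by (simp add: S_lin_def inner_diff_right)
  qed
  moreover have "(LINT x|?L. wgrad ?\<Omega> (eta T us (w t)) x \<bullet> Jlin_diss T us M (w t) x) = - D_lin T us M (w t)"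
    by (simp add: D_lin_def Jlin_diss_def)
  ultimately have "(LINT x|?L. eta T us (w t) x \<bullet> time_deriv w t x)
      = - D_lin T us M (w t) + B_lin T E F (w t) + S_lin T us G (w t)"
    using balance(3) by linarith
  with deriv show "((\<lambda>s. F_lin T us (w s)) has_real_derivative
      (- D_lin T us M (w t) + B_lin T E F (w t) + S_lin T us G (w t))) (at t)"
    by simp
qed

end
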